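(* Let $m,p,n$ be positive integers with $p\mid m$. For an element $g\in G(m,p,n)$ with $k$ cycles, of colors $a_1,\ldots,a_k$, let $d=\gcd(a_1,\ldots,a_k,p)$ and $a=\gcd(\operatorname{col}(g),m)/p$. Let $F^{\mathrm{full}}_{m,p,n}(g)$ denote the number of minimum-length full reflection factorizations of $g$ in $G(m,p,n)$. If $m=p$, we have $$ F^{\mathrm{full}}_{m,m,n}(g)=\begin{cases} m^{k-1}\cdot H_0(\lambda), & \text{if } d=1,\\[4pt] m^{k+1}\cdot\dfrac{J_2(d)}{d^2}\cdot H_1(\lambda), & \text{if } d\ne1,\end{cases} $$ while if $m\neq p$, we have $$ F^{\mathrm{full}}_{m,p,n}(g)=\begin{cases} n(n+k-1)\cdot m^{k-1}\cdot H_0(\lambda), & \text{if } a=1\text{ and }d=1,\\[6pt] \dfrac{n^2(n+k)(n+k-1)m^{k}}{2}\cdot\dfrac{\varphi(a)}{pa}\cdot H_0(\lambda), & \text{if } a\ne1\text{ and }d=1,\\[6pt] n(n+k+1)m^{k+1}\cdot\dfrac{J_2(d)}{d^2}\cdot H_1(\lambda), & \text{if } a=1\text{ and }d\ne1,\\[6pt] \dfrac{n^2(n+k+2)(n+k+1)m^{k+2}}{2}\cdot\dfrac{\varphi(a)}{pa}\cdot\dfrac{J_2(d)}{d^2}\cdot H_1(\lambda), & \text{if } a\ne1\text{ and }d\ne1, \end{cases} $$ where $\lambda$ is the cycle type of the underlying permutation $\pi_{m/1}(g)$.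
   Context: A reflection on $\mathbb C^n$ is a unitary map whose fixed space is a hyperplane. For $p\mid m$, put $\zeta_m=\exp(2\pi i/m)$ and let $G(m,p,n)$ be the group of $n\times n$ monomial matrices whose nonzero entries are $m$-th roots of unity with product an $(m/p)$-th root of unity; it is generated by its reflections. An element $w\in G(m,1,n)$ is encoded as $[u;b]$ with $u\in\mathfrak S_n$ (the symmetric group) and $b=(b_1,\dots,b_n)\in(\mathbb Z/m\mathbb Z)^n$: the nonzero entry of column $j$ of $w$ is in row $u(j)$ and equals $\zeta_m^{b_j}$. The underlying permutation of $w$ is $u=:\pi_{m/1}(w)$. A cycle of $w$ is a cycle of $u$ (fixed points count as cycles); the color of a cycle with support $S$ is $\sum_{j\in S}b_j\in\mathbb Z/m\mathbb Z$; the color of $w$ is $\operatorname{col}(w)=b_1+\cdots+b_n\in\mathbb Z/m\mathbb Z$. The group $G(m,p,n)$ consists of those $w$ with $p\mid\operatorname{col}(w)$. The gcd's defining $d$ and $a$ are computed with any integer representatives (well defined since $p\mid m$; $\gcd(0,m)=m$). A full reflection factorization of $g\in W=G(m,p,n)$ is a tuple $(t_1,\dots,t_N)$ of reflections of $W$ with $t_1\cdots t_N=g$ and $\langle t_1,\dots,t_N\rangle=W$; minimum-length means $N$ is the smallest length for which a full reflection factorization of $g$ exists. $\varphi$ is Euler's totient function and $J_2(d)=\sum_{b\mid d}\mu(d/b)\,b^2$ is the Jordan totient function ($\mu$ the number-theoretic Möbius function). For a partition $\lambda$ of $n$ with $k$ parts and $h\ge 0$, the genus-$h$ Hurwitz number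 $H_h(\lambda)$ is the number of tuples $(t_1,\dots,t_c)$ of transpositions in $\mathfrak S_n$, with $c=n+k+2h-2$, whose product is a fixed permutation of cycle type $\lambda$ and such that $\langle t_1,\dots,t_c\rangle$ acts transitively on $\{1,\dots,n\}$.
   Formalization: The case n = 1 with p > 1 is excluded: there d = p ≠ 1 and the formula gives a multiple of H_1((1)) = 0, although every element of the cyclic group G(m,p,1) has a full reflection factorization, so the stated formula fails in all these cases. *)

theory Defs
  imports
    Complex_Main
    "HOL-Library.Multiset"
    "HOL-Combinatorics.Combinatorics"
    "HOL-Algebra.Sym_Groups"
    "HOL-Algebra.Generated_Groups"
    "HOL-Computational_Algebra.Squarefree"
    "HOL-Number_Theory.Totient"
    "Jordan_Normal_Form.Schur_Decomposition"
begin

text \<open>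
  Permutations live on \<open>{1..n}\<close>, as in \<^const>\<open>sym_group\<close>, whereas the rows and columns of
  matrices are indexed by \<open>{0..<n}\<close>. Row/column \<open>i\<close> of a matrix corresponds to the point \<open>Suc i\<close>.
\<close>

subsection \<open>Reflections and the groups \<open>G(m,p,n)\<close>\<close>

definition unitary_mat :: "nat \<Rightarrow> complex mat \<Rightarrow> bool" where
  "unitary_mat n A \<longleftrightarrow> A \<in> carrier_mat n n \<and> A * mat_adjoint A = 1\<^sub>m n"

definition hyperplane :: "nat \<Rightarrow> complex vec set \<Rightarrow> bool" where
  "hyperplane n H \<longleftrightarrow>
     (\<exists>c \<in> carrier_vec n. c \<noteq> 0\<^sub>v n \<and> H = {v \<in> carrier_vec n. c \<bullet> v = 0})"

definition reflection :: "nat \<Rightarrow> complex mat \<Rightarrow> bool" where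
  "reflection n A \<longleftrightarrow>
     unitary_mat n A \<and> hyperplane n {v \<in> carrier_vec n. A *\<^sub>v v = v}"

definition monomial_mat :: "nat \<Rightarrow> complex mat \<Rightarrow> bool" where
  "monomial_mat n A \<longleftrightarrow> A \<in> carrier_mat n n \<and>
     (\<forall>i<n. \<exists>!j. j < n \<and> A $$ (i, j) \<noteq> 0) \<and>
     (\<forall>j<n. \<exists>!i. i < n \<and> A $$ (i, j) \<noteq> 0)"

definition nonzero_positions :: "nat \<Rightarrow> complex mat \<Rightarrow> (nat \<times> nat) set" where
  "nonzero_positions n A = {(i, j). i < n \<and> j < n \<and> A $$ (i, j) \<noteq> 0}"

definition Gmpn :: "nat \<Rightarrow> nat \<Rightarrow> nat \<Rightarrow> complex mat monoid" where
  "Gmpn m p n =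
     \<lparr> carrier = {A. monomial_mat n A \<and>
          (\<forall>ij \<in> nonzero_positions n A. (A $$ ij) ^ m = 1) \<and>
          (\<Prod>ij \<in> nonzero_positions n A. A $$ ij) ^ (m div p) = 1},
       mult = (*),
       one = 1\<^sub>m n \<rparr>"

subsection \<open>The encoding \<open>[u;b]\<close>\<close>

definition zeta :: "nat \<Rightarrow> complex" where
  "zeta m = exp (2 * complex_of_real pi * \<i> / of_nat m)"

text \<open>The exponents \<open>b j\<close> are arbitrary integer representatives of classes modulo \<open>m\<close>.\<close>

definition colored_perm_mat :: "nat \<Rightarrow> nat \<Rightarrow> (nat \<Rightarrow> nat) \<Rightarrow> (nat \<Rightarrow> int) \<Rightarrow> complex mat" where
  "colored_perm_mat m n u b =
     mat n n (\<lambda>(i, j). if Suc i = u (Suc j) then zeta m powi b (Suc j) else 0)"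

definition cycle_supports :: "nat \<Rightarrow> (nat \<Rightarrow> nat) \<Rightarrow> nat set set" where
  "cycle_supports n u = Orbits.orbit u ` {1..n}"

definition cycle_type :: "nat \<Rightarrow> (nat \<Rightarrow> nat) \<Rightarrow> nat multiset" where
  "cycle_type n u = image_mset card (mset_set (cycle_supports n u))"

text \<open>An integer representative of the color of the cycle with support \<open>S\<close>; the color of the
  whole element is that of \<open>{1..n}\<close>.\<close>

definition color :: "(nat \<Rightarrow> int) \<Rightarrow> nat set \<Rightarrow> int" where
  "color b S = (\<Sum>j\<in>S. b j)"

subsection \<open>Full reflection factorizations\<close>

definition full_refl_factorizations ::
    "nat \<Rightarrow> nat \<Rightarrow> nat \<Rightarrow> complex mat \<Rightarrow> complex mat list set" where
  "full_refl_factorizations m p n g =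
     {ts. set ts \<subseteq> {t \<in> carrier (Gmpn m p n). reflection n t} \<and>
          foldr (*) ts (1\<^sub>m n) = g \<and>
          generate (Gmpn m p n) (set ts) = carrier (Gmpn m p n)}"

definition min_full_length :: "nat \<Rightarrow> nat \<Rightarrow> nat \<Rightarrow> complex mat \<Rightarrow> nat" where
  "min_full_length m p n g = (LEAST N. \<exists>ts \<in> full_refl_factorizations m p n g. length ts = N)"

definition F_full :: "nat \<Rightarrow> nat \<Rightarrow> nat \<Rightarrow> complex mat \<Rightarrow> nat" where
  "F_full m p n g =
     card {ts \<in> full_refl_factorizations m p n g. length ts = min_full_length m p n g}"

subsection \<open>Arithmetic functions and Hurwitz numbers\<close>

definition moebius :: "nat \<Rightarrow> int" where
  "moebius n = (if squarefree n then (- 1) ^ card (prime_factors n) else 0)"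

definition jordan_totient2 :: "nat \<Rightarrow> int" where
  "jordan_totient2 d = (\<Sum>b | b dvd d. moebius (d div b) * int b ^ 2)"

definition transpositions :: "nat \<Rightarrow> (nat \<Rightarrow> nat) set" where
  "transpositions n =
     {Transposition.transpose i j | i j. i \<in> {1..n} \<and> j \<in> {1..n} \<and> i \<noteq> j}"

definition generates_transitive :: "nat \<Rightarrow> (nat \<Rightarrow> nat) set \<Rightarrow> bool" where
  "generates_transitive n T \<longleftrightarrow>
     (\<forall>i\<in>{1..n}. \<forall>j\<in>{1..n}. \<exists>s \<in> generate (sym_group n) T. s i = j)"

text \<open>The partition \<open>L\<close> of \<open>n = sum_mset L\<close> is the multiset of its \<open>k = size L\<close> parts. In the
  exponent the truncated subtraction is harmless, as \<open>n + k \<ge> 2\<close> for every partition of a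
  positive \<open>n\<close>.\<close>

definition hurwitz :: "nat \<Rightarrow> nat multiset \<Rightarrow> nat" where
  "hurwitz h L =
     (let n = sum_mset L;
          k = size L;
          s = (SOME s. s permutes {1..n} \<and> cycle_type n s = L)
      in card {ts. set ts \<subseteq> transpositions n \<and> length ts = n + k + 2 * h - 2 \<and>
                   foldr (\<circ>) ts id = s \<and> generates_transitive n (set ts)})"

subsection \<open>Every element of \<open>G(m,p,n)\<close> has an encoding\<close>

lemma zeta_powi: "zeta m powi k = cis (2 * pi * of_int k / of_nat m)"
proof -
  have "zeta m = cis (2 * pi / of_nat m)"
    unfolding zeta_def cis_conv_exp by (simp add: mult_ac)
  then show ?thesis
    by (simp add: cis_power_int mult_ac)
qed

lemma zeta_powi_eq_1_iff:
  assumes "m > 0"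
  shows "zeta m powi k = 1 \<longleftrightarrow> int m dvd k"
proof -
  have "zeta m powi k = 1 \<longleftrightarrow> (\<exists>l::int. 2 * pi * of_int k / of_nat m = of_int l * 2 * pi)"
  proof
    assume "zeta m powi k = 1"
    then have "cos (2 * pi * of_int k / of_nat m) = 1"
      unfolding zeta_powi by (metis cis.simps(1) one_complex.simps(1))
    then show "\<exists>l::int. 2 * pi * of_int k / of_nat m = of_int l * 2 * pi"
      using cos_one_2pi_int by blast
  next
    assume "\<exists>l::int. 2 * pi * of_int k / of_nat m = of_int l * 2 * pi"
    then obtain l :: int where l: "2 * pi * of_int k / of_nat m = 2 * pi * of_int l"
      by (auto simp: mult_ac)
    show "zeta m powi k = 1"
      unfolding zeta_powi l by simp
  qed
  also have "\<dots> \<longleftrightarrow> (\<exists>l::int. k = int m * l)"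
  proof (intro ex_cong1)
    fix l :: int
    have "2 * pi * of_int k / of_nat m = of_int l * 2 * pi \<longleftrightarrow>
            (of_int k :: real) = of_int (int m * l)"
      using assms by (simp add: field_simps)
    then show "2 * pi * of_int k / of_nat m = of_int l * 2 * pi \<longleftrightarrow> k = int m * l"
      using of_int_eq_iff by metis
  qed
  finally show ?thesis by (auto simp: dvd_def)
qed

lemma zeta_nonzero: "zeta m \<noteq> 0"
  unfolding zeta_def by simp

lemma root_of_unity_eq_zeta_powi:
  assumes "m > 0" "z ^ m = 1"
  shows "\<exists>k::int. z = zeta m powi k"
proof -
  obtain k where "z = cis (2 * pi * real k / real m)"
    using bij_betw_roots_unity[OF assms(1)] assms(2) unfolding bij_betw_def by blast
  then have "z = zeta m powi int k"
    unfolding zeta_powi by simp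
  then show ?thesis ..
qed

lemma nonzero_positions_colored_perm_mat:
  assumes "u permutes {1..n}"
  shows "nonzero_positions n (colored_perm_mat m n u b) = (\<lambda>j. (u (Suc j) - 1, j)) ` {..<n}"
proof -
  have "u (Suc j) \<in> {1..n}" if "j < n" for j
    using that permutes_in_image[OF assms, of "Suc j"] by auto
  then have u: "u (Suc j) - 1 < n \<and> Suc (u (Suc j) - 1) = u (Suc j)" if "j < n" for j
    using that by force
  have nz: "colored_perm_mat m n u b $$ (i, j) \<noteq> 0 \<longleftrightarrow> Suc i = u (Suc j)"
    if "i < n" "j < n" for i j
    using that by (simp add: colored_perm_mat_def zeta_nonzero)
  show ?thesis
  proof (intro Set.set_eqI iffI)
    fix x assume "x \<in> nonzero_positions n (colored_perm_mat m n u b)"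
    then obtain i j where x: "x = (i, j)" "i < n" "j < n" "Suc i = u (Suc j)"
      unfolding nonzero_positions_def using nz by auto
    then have "i = u (Suc j) - 1" by simp
    then show "x \<in> (\<lambda>j. (u (Suc j) - 1, j)) ` {..<n}" using x by auto
  next
    fix x assume "x \<in> (\<lambda>j. (u (Suc j) - 1, j)) ` {..<n}"
    then obtain j where j: "j < n" "x = (u (Suc j) - 1, j)" by auto
    then show "x \<in> nonzero_positions n (colored_perm_mat m n u b)"
      unfolding nonzero_positions_def using nz[of "u (Suc j) - 1" j] u[of j] by simp
  qed
qed

lemma color_as_sum: "color b {1..n} = (\<Sum>j<n. b (Suc j))"
  unfolding color_def by (simp add: sum.atLeast1_atMost_eq)

lemma zeta_powi_sum: "zeta m powi (\<Sum>j\<in>S. f j) = (\<Prod>j\<in>S. zeta m powi f j)"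
  by (induction S rule: infinite_finite_induct) (auto simp: power_int_add zeta_nonzero)

lemma prod_colored_perm_mat:
  assumes "u permutes {1..n}"
  shows "(\<Prod>ij \<in> nonzero_positions n (colored_perm_mat m n u b). colored_perm_mat m n u b $$ ij)
           = zeta m powi color b {1..n}"
proof -
  have u: "u (Suc j) \<in> {1..n}" if "j < n" for j
    using that permutes_in_image[OF assms, of "Suc j"] by auto
  have "(\<Prod>ij \<in> nonzero_positions n (colored_perm_mat m n u b). colored_perm_mat m n u b $$ ij)
          = (\<Prod>j<n. colored_perm_mat m n u b $$ (u (Suc j) - 1, j))"
    unfolding nonzero_positions_colored_perm_mat[OF assms]
    by (subst prod.reindex) (auto simp: inj_on_def)
  also have "\<dots> = (\<Prod>j<n. zeta m powi b (Suc j))"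
    by (intro prod.cong refl) (use u in \<open>force simp: colored_perm_mat_def\<close>)
  also have "\<dots> = zeta m powi color b {1..n}"
    unfolding color_as_sum zeta_powi_sum ..
  finally show ?thesis .
qed

lemma monomial_colored_perm_mat:
  assumes "u permutes {1..n}"
  shows "monomial_mat n (colored_perm_mat m n u b)"
proof -
  have u: "u (Suc j) \<in> {1..n}" if "j < n" for j
    using that permutes_in_image[OF assms, of "Suc j"] by auto
  have nz: "colored_perm_mat m n u b $$ (i, j) \<noteq> 0 \<longleftrightarrow> Suc i = u (Suc j)"
    if "i < n" "j < n" for i j
    using that by (simp add: colored_perm_mat_def zeta_nonzero)
  have "\<exists>!j. j < n \<and> colored_perm_mat m n u b $$ (i, j) \<noteq> 0" if i: "i < n" for i
  proof -
    have "Suc i \<in> u ` {1..n}"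
      using i permutes_image[OF assms] by auto
    then obtain x where x: "x \<in> {1..n}" "u x = Suc i" by auto
    show ?thesis
    proof (intro ex1I[of _ "x - 1"] conjI)
      show x1: "x - 1 < n" using x i by auto
      show "colored_perm_mat m n u b $$ (i, x - 1) \<noteq> 0"
        using x i nz[OF i x1] by simp
      fix j assume "j < n \<and> colored_perm_mat m n u b $$ (i, j) \<noteq> 0"
      then have "u (Suc j) = u x" using nz[of i j] i x by auto
      then have "Suc j = x" by (rule injD[OF permutes_inj[OF assms]])
      then show "j = x - 1" by simp
    qed
  qed
  moreover have "\<exists>!i. i < n \<and> colored_perm_mat m n u b $$ (i, j) \<noteq> 0" if j: "j < n" for j
  proof (intro ex1I[of _ "u (Suc j) - 1"] conjI)
    show "u (Suc j) - 1 < n" using u[OF j] by auto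
    then show "colored_perm_mat m n u b $$ (u (Suc j) - 1, j) \<noteq> 0"
      using nz[of "u (Suc j) - 1" j] j u[OF j] by auto
    fix i assume "i < n \<and> colored_perm_mat m n u b $$ (i, j) \<noteq> 0"
    then show "i = u (Suc j) - 1" using nz[of i j] j by simp
  qed
  ultimately show ?thesis
    unfolding monomial_mat_def by (simp add: colored_perm_mat_def)
qed

lemma colored_perm_mat_in_Gmpn_iff:
  assumes "m > 0" "p > 0" "p dvd m" "u permutes {1..n}"
  shows "colored_perm_mat m n u b \<in> carrier (Gmpn m p n) \<longleftrightarrow> int p dvd color b {1..n}"
proof -
  obtain q where q: "m = p * q" using assms(3) by auto
  have q0: "q > 0" using q assms(1) by simp
  have "(zeta m powi b (Suc j)) ^ m = 1" for j
  proof -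
    have "(zeta m powi b (Suc j)) ^ m = zeta m powi (b (Suc j) * int m)"
      by (simp add: power_int_mult)
    then show ?thesis by (simp add: zeta_powi_eq_1_iff assms(1))
  qed
  moreover have "colored_perm_mat m n u b $$ ij \<in> (\<lambda>j. zeta m powi b (Suc j)) ` {..<n}"
    if "ij \<in> nonzero_positions n (colored_perm_mat m n u b)" for ij
    using that unfolding nonzero_positions_def colored_perm_mat_def
    by (auto split: if_splits)
  ultimately have roots: "\<forall>ij \<in> nonzero_positions n (colored_perm_mat m n u b).
      (colored_perm_mat m n u b $$ ij) ^ m = 1"
    by fastforce
  have "(zeta m powi color b {1..n}) ^ (m div p) = zeta m powi (color b {1..n} * int q)"
    using q assms(2) by (simp add: power_int_mult)
  then have "(zeta m powi color b {1..n}) ^ (m div p) = 1 \<longleftrightarrow>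
      int p * int q dvd color b {1..n} * int q"
    using zeta_powi_eq_1_iff[OF assms(1)] q by simp
  also have "\<dots> \<longleftrightarrow> int p dvd color b {1..n}"
    using q0 by simp
  finally show ?thesis
    unfolding Gmpn_def
    by (simp add: monomial_colored_perm_mat[OF assms(4)] prod_colored_perm_mat[OF assms(4)] roots)
qed

lemma mem_Gmpn_iff:
  assumes "m > 0" "p > 0" "p dvd m"
  shows "A \<in> carrier (Gmpn m p n) \<longleftrightarrow>
    (\<exists>u b. u permutes {1..n} \<and> int p dvd color b {1..n} \<and> A = colored_perm_mat m n u b)"
proof
  assume "\<exists>u b. u permutes {1..n} \<and> int p dvd color b {1..n} \<and> A = colored_perm_mat m n u b"
  then show "A \<in> carrier (Gmpn m p n)"
    using colored_perm_mat_in_Gmpn_iff[OF assms] by blast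
next
  assume A: "A \<in> carrier (Gmpn m p n)"
  then have mono: "monomial_mat n A"
    and roots: "\<And>i j. i < n \<Longrightarrow> j < n \<Longrightarrow> A $$ (i, j) \<noteq> 0 \<Longrightarrow> (A $$ (i, j)) ^ m = 1"
    unfolding Gmpn_def nonzero_positions_def by auto
  have dimA: "A \<in> carrier_mat n n" using mono unfolding monomial_mat_def by simp
  have rows: "\<exists>!j. j < n \<and> A $$ (i, j) \<noteq> 0" if "i < n" for i
    using mono that unfolding monomial_mat_def by simp
  have cols: "\<exists>!i. i < n \<and> A $$ (i, j) \<noteq> 0" if "j < n" for j
    using mono that unfolding monomial_mat_def by simp
  define r where "r j = (THE i. i < n \<and> A $$ (i, j) \<noteq> 0)" for j
  have r: "r j < n \<and> A $$ (r j, j) \<noteq> 0" if "j < n" for j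
    unfolding r_def by (rule theI'[OF cols[OF that]])
  have r_unique: "i = r j" if "i < n" "j < n" "A $$ (i, j) \<noteq> 0" for i j
    unfolding r_def using the1_equality[OF cols[OF that(2)], of i] that by simp
  have r_inj: "j = j'" if "j < n" "j' < n" "r j = r j'" for j j'
  proof -
    have "j < n \<and> A $$ (r j, j) \<noteq> 0" "j' < n \<and> A $$ (r j, j') \<noteq> 0"
      using r[OF that(1)] r[OF that(2)] that by simp_all
    then show ?thesis
      using r[OF that(1)] ex1E[OF rows[of "r j"], of ?thesis] by auto
  qed
  have "\<forall>j. \<exists>k::int. j < n \<longrightarrow> A $$ (r j, j) = zeta m powi k"
  proof
    fix j
    show "\<exists>k::int. j < n \<longrightarrow> A $$ (r j, j) = zeta m powi k"
    proof (cases "j < n")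
      case True
      then show ?thesis
        using root_of_unity_eq_zeta_powi[OF assms(1) roots] r[OF True] by blast
    qed simp
  qed
  then obtain c :: "nat \<Rightarrow> int" where c: "\<And>j. j < n \<Longrightarrow> A $$ (r j, j) = zeta m powi c j"
    by metis
  define u where "u x = (if x \<in> {1..n} then Suc (r (x - 1)) else x)" for x
  define b where "b x = c (x - 1)" for x
  have "u permutes {1..n}"
  proof (rule bij_imp_permutes)
    have "inj_on u {1..n}"
    proof (rule inj_onI)
      fix x y assume xy: "x \<in> {1..n}" "y \<in> {1..n}" "u x = u y"
      have "x - 1 = y - 1" by (rule r_inj, use xy in \<open>auto simp: u_def\<close>)
      then show "x = y" using xy by auto
    qed
    moreover have "u ` {1..n} \<subseteq> {1..n}"
    proof
      fix y assume "y \<in> u ` {1..n}"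
      then obtain x where "x \<in> {1..n}" "y = Suc (r (x - 1))" by (auto simp: u_def)
      moreover from this have "x - 1 < n" by auto
      ultimately show "y \<in> {1..n}" using r[of "x - 1"] by simp
    qed
    ultimately show "bij_betw u {1..n} {1..n}"
      unfolding bij_betw_def using endo_inj_surj[of "{1..n}" u] by blast
  qed (auto simp: u_def)
  moreover have "A = colored_perm_mat m n u b"
  proof (rule eq_matI)
    fix i j assume "i < dim_row (colored_perm_mat m n u b)" "j < dim_col (colored_perm_mat m n u b)"
    then have ij: "i < n" "j < n" by (auto simp: colored_perm_mat_def)
    have uj: "u (Suc j) = Suc (r j)" using ij by (simp add: u_def)
    show "A $$ (i, j) = colored_perm_mat m n u b $$ (i, j)"
      using ij r_unique[OF ij] c[OF ij(2)] by (auto simp: colored_perm_mat_def uj b_def)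
  qed (use dimA in \<open>auto simp: colored_perm_mat_def\<close>)
  ultimately show
    "\<exists>u b. u permutes {1..n} \<and> int p dvd color b {1..n} \<and> A = colored_perm_mat m n u b"
    using A colored_perm_mat_in_Gmpn_iff[OF assms] by blast
qed

subsection \<open>The degenerate case \<open>n = 1\<close>, \<open>p > 1\<close>\<close>

text \<open>
  For \<open>n = 1\<close> and \<open>p > 1\<close> one always has \<open>d = p \<noteq> 1\<close>, so the counting formula is a multiple of
  \<open>H\<^sub>1((1)) = 0\<close>, whereas \<open>G(m,p,1)\<close> is cyclic and each of its elements has a full reflection
  factorization. The formula is therefore only claimed when \<open>n \<noteq> 1 \<or> p = 1\<close>. The simplest
  instance is \<open>m = p\<close>, where the group is trivial.
\<close>

lemma hurwitz_1_point: "hurwitz 1 {#1#} = 0"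
proof -
  have "transpositions 1 = {}"
    unfolding transpositions_def by auto
  then have "card {ts. set ts \<subseteq> transpositions 1 \<and> length ts = Suc (Suc 0) \<and>
      foldr (\<circ>) ts id = s \<and> generates_transitive 1 (set ts)} = 0" for s
    by (auto simp: card_eq_0_iff)
  then show ?thesis
    unfolding hurwitz_def Let_def by simp
qed

lemma carrier_Gmpn_trivial:
  assumes "m > 0"
  shows "carrier (Gmpn m m 1) = {1\<^sub>m 1}"
proof -
  have id_mat: "colored_perm_mat m 1 id b = 1\<^sub>m 1" if "int m dvd b 1" for b
    by (rule eq_matI) (use that zeta_powi_eq_1_iff[OF assms] in \<open>auto simp: colored_perm_mat_def\<close>)
  have "A \<in> carrier (Gmpn m m 1) \<longleftrightarrow> A = 1\<^sub>m 1" for A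
  proof
    assume "A \<in> carrier (Gmpn m m 1)"
    then obtain u b where ub: "u permutes {1..1::nat}" "int m dvd color b {1..1}"
        "A = colored_perm_mat m 1 u b"
      unfolding mem_Gmpn_iff[OF assms assms dvd_refl] by blast
    have "u = id" using ub(1) by simp
    moreover have "int m dvd b 1" using ub(2) by (simp add: color_def)
    ultimately show "A = 1\<^sub>m 1" using id_mat ub(3) by simp
  next
    assume A: "A = 1\<^sub>m 1"
    have "A = colored_perm_mat m 1 id (\<lambda>_. 0)" using id_mat[of "\<lambda>_. 0"] A by simp
    moreover have "id permutes {1..1::nat}" by (rule permutes_id)
    moreover have "int m dvd color (\<lambda>_. 0) {1..1}" by (simp add: color_def)
    ultimately show "A \<in> carrier (Gmpn m m 1)"
      unfolding mem_Gmpn_iff[OF assms assms dvd_refl] by blast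
  qed
  then show ?thesis by blast
qed

lemma F_full_trivial_group:
  assumes "m > 0"
  shows "F_full m m 1 (1\<^sub>m 1) = 1"
proof -
  have "generate (Gmpn m m 1) {} \<subseteq> {1\<^sub>m 1}"
  proof
    fix A assume "A \<in> generate (Gmpn m m 1) {}"
    then show "A \<in> {1\<^sub>m 1}"
      by (induction rule: generate.induct) (auto simp: Gmpn_def)
  qed
  moreover have "1\<^sub>m 1 \<in> generate (Gmpn m m 1) {}"
    using generate.one[of "Gmpn m m 1" "{}"] by (simp add: Gmpn_def)
  ultimately have nil: "[] \<in> full_refl_factorizations m m 1 (1\<^sub>m 1)"
    unfolding full_refl_factorizations_def using carrier_Gmpn_trivial[OF assms] by auto
  then have "min_full_length m m 1 (1\<^sub>m 1) = 0"
    unfolding min_full_length_def by (intro Least_eq_0) auto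
  then have "{ts \<in> full_refl_factorizations m m 1 (1\<^sub>m 1).
      length ts = min_full_length m m 1 (1\<^sub>m 1)} = {[]}"
    using nil by auto
  then show ?thesis unfolding F_full_def by simp
qed

end

theory Submission
  imports Defs
begin

text \<open>
  The idea is to record a factorization of \<open>g = [u;b]\<close> as a word with voltages. Reflections of \<open>G(m,p,n)\<close> are
  either diagonal, with one nontrivial entry \<open>\<zeta>\<^sup>e\<close>, or lie over a transposition \<open>(v w)\<close> and are determined by a
  voltage in \<open>\<int>/m\<close> on the edge from \<open>v\<close> to \<open>w\<close> (\<open>reflection_cases\<close>). The transpositions of a factorization of \<open>g\<close>
  form a factorization of \<open>u\<close>, and the voltages must make the product have the coloring \<open>b\<close>.

  The factorization is full iff three conditions hold (\<open>word_mats_generate_iff\<close>): the edges connect all points, the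
  labels \<open>e\<close> and \<open>m\<close> have gcd \<open>p\<close>, and for no divisor \<open>q > 1\<close> of \<open>p\<close> the voltages are congruent to a gradient
  \<open>\<psi>(w) - \<psi>(v)\<close> modulo \<open>q\<close>. Labels are multiples of \<open>p\<close>, so the third condition does not involve the
  diagonal letters.

  Fix a connected word with \<open>c = n + k - 2 + 2 h\<close> edges. The coloring of the product is an affine function of the
  voltages, whose linear part has all vectors of sum zero as its image. So there are
  \<open>m ^ (c - n + 1) = m ^ (k - 1 + 2 h)\<close> solutions. Now consider those that are the gradient of some \<open>\<psi>\<close> modulo
  \<open>q\<close>. Such voltages arise from an uncolored word by conjugation with the diagonal matrix of \<open>\<psi>\<close>, so
  \<open>\<psi> \<circ> u - \<psi> \<equiv> b\<close>. This is solvable iff \<open>q\<close> divides the colors of all cycles, and then by \<open>q ^ k\<close>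
  functions \<open>\<psi>\<close>; each belongs to \<open>(m / q) ^ (c - n + 1)\<close> solutions, and each solution has \<open>q\<close> potentials. This
  makes \<open>m ^ (k - 1 + 2 h) / q ^ (2 h)\<close> solutions. The moduli \<open>q\<close> for which given voltages are a gradient are
  the divisors of one number, so Moebius inversion shows that
  \<open>m ^ (k - 1 + 2 h) \<cdot> (\<Sum>q | q dvd d. \<mu>(q) / q ^ (2 h))\<close> solutions make the factorization full
  (\<open>card_nondegenerate_solutions\<close>).

  The sum is \<open>1\<close> or \<open>0\<close> for \<open>h = 0\<close>, according to whether \<open>d = 1\<close>, and \<open>J\<^sub>2(d) / d\<^sup>2 > 0\<close> for \<open>h = 1\<close>. Taking
  \<open>m = q = 2\<close> in the same count shows that \<open>h \<ge> 0\<close> (\<open>genus_nonnegative\<close>), and the sign of \<open>u\<close> shows that \<open>h\<close> is an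
  integer. So the least number of edges belongs to genus \<open>0\<close> if \<open>d = 1\<close> and to genus \<open>1\<close> if \<open>d \<noteq> 1\<close>, and the edge words
  of this length are counted by the Hurwitz number. Independently, the least number \<open>r\<close> of diagonal letters is
  found from the second condition and the color of \<open>g\<close>. Edges and diagonal letters can be interleaved in
  \<open>(c + r) choose c\<close> ways, and the product of these numbers is the formula (\<open>F_full_eq\<close>).
\<close>

section \<open>Counting solutions of linear systems modulo \<open>m\<close>\<close>

lemma card_zero_sum_vectors:
  fixes m n :: nat
  assumes "m > 0" "n > 0"
  shows "card {t \<in> {1..n} \<rightarrow>\<^sub>E {0..<int m}. int m dvd (\<Sum>j\<in>{1..n}. t j)} = m ^ (n - 1)"
    (is "card ?T = _")
proof -
  have split: "{1..n} = insert 1 {2..n}" using assms by auto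
  have sum1: "(\<Sum>j\<in>{1..n}. t j) = t 1 + (\<Sum>j\<in>{2..n}. t j)" for t :: "nat \<Rightarrow> int"
    unfolding split by (subst sum.insert) auto
  define ext where "ext t = t(1 := (- (\<Sum>j\<in>{2..n}. t j)) mod int m)" for t :: "nat \<Rightarrow> int"
  have "bij_betw (\<lambda>t. restrict t {2..n}) ?T ({2..n} \<rightarrow>\<^sub>E {0..<int m})"
  proof (rule bij_betw_byWitness[where f' = ext])
    show "\<forall>t\<in>?T. ext (restrict t {2..n}) = t"
    proof
      fix t assume t: "t \<in> ?T"
      have t1: "t 1 \<in> {0..<int m}" using t assms by (auto simp: PiE_iff)
      have "(- (\<Sum>j\<in>{2..n}. t j)) mod int m = t 1 mod int m"
        using t unfolding sum1 by (auto simp: mod_eq_dvd_iff) (metis dvd_minus_iff minus_add_distrib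
            uminus_add_conv_diff)
      then have "(- (\<Sum>j\<in>{2..n}. t j)) mod int m = t 1" using t1 by simp
      then show "ext (restrict t {2..n}) = t"
        using t by (intro ext) (auto simp: ext_def restrict_def PiE_iff extensional_def)
    qed
    show "\<forall>t\<in>{2..n} \<rightarrow>\<^sub>E {0..<int m}. restrict (ext t) {2..n} = t"
      by (auto simp: ext_def restrict_def PiE_iff extensional_def fun_eq_iff)
    show "(\<lambda>t. restrict t {2..n}) ` ?T \<subseteq> {2..n} \<rightarrow>\<^sub>E {0..<int m}"
      by (auto simp: PiE_iff)
    show "ext ` ({2..n} \<rightarrow>\<^sub>E {0..<int m}) \<subseteq> ?T"
    proof
      fix s assume "s \<in> ext ` ({2..n} \<rightarrow>\<^sub>E {0..<int m})"
      then obtain t where t: "t \<in> {2..n} \<rightarrow>\<^sub>E {0..<int m}" and s: "s = ext t" by auto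
      have "(\<Sum>j\<in>{1..n}. s j) = (- (\<Sum>j\<in>{2..n}. t j)) mod int m + (\<Sum>j\<in>{2..n}. t j)"
        unfolding sum1 by (auto simp: s ext_def intro!: sum.cong)
      then have "int m dvd (\<Sum>j\<in>{1..n}. s j)"
        by (simp add: dvd_eq_mod_eq_0 mod_add_left_eq)
      moreover have "s \<in> {1..n} \<rightarrow>\<^sub>E {0..<int m}"
        using t assms by (auto simp: s ext_def PiE_iff extensional_def)
      ultimately show "s \<in> ?T" by simp
    qed
  qed
  then have "card ?T = card ({2..n} \<rightarrow>\<^sub>E {0..<int m})" by (rule bij_betw_same_card)
  also have "\<dots> = m ^ (n - 1)" by (subst card_PiE) (auto simp: assms)
  finally show ?thesis .
qed

text \<open>
  The image of \<open>M\<close> modulo \<open>m\<close> is the set of vectors of sum zero, since it contains the differences of unit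
  vectors. Solution sets for different right-hand sides are translates of each other, so they all
  have the same size.
\<close>

lemma card_linear_solutions:
  fixes M :: "(nat \<Rightarrow> int) \<Rightarrow> nat \<Rightarrow> int" and m n :: nat
  assumes I: "finite I" and m: "m > 0" and n: "n > 0"
    and add: "\<And>x y j. M (\<lambda>i. x i + y i) j = M x j + M y j"
    and scale: "\<And>c x j. M (\<lambda>i. c * x i) j = c * M x j"
    and cong: "\<And>x y j. (\<And>i. i \<in> I \<Longrightarrow> [x i = y i] (mod int m)) \<Longrightarrow> [M x j = M y j] (mod int m)"
    and sum0: "\<And>x. (\<Sum>j\<in>{1..n}. M x j) = 0"
    and diff: "\<And>v w. v \<in> {1..n} \<Longrightarrow> w \<in> {1..n} \<Longrightarrow>
                \<exists>z. \<forall>j\<in>{1..n}. M z j = of_bool (j = v) - of_bool (j = w)"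
    and t: "int m dvd (\<Sum>j\<in>{1..n}. t j)"
  shows "card {x \<in> I \<rightarrow>\<^sub>E {0..<int m}. \<forall>j\<in>{1..n}. [M x j = t j] (mod int m)} * m ^ (n - 1)
           = m ^ card I"
proof -
  let ?X = "I \<rightarrow>\<^sub>E {0..<int m}"
  define fib where "fib t = {x \<in> ?X. \<forall>j\<in>{1..n}. [M x j = t j] (mod int m)}" for t
  define T where "T = {t \<in> {1..n} \<rightarrow>\<^sub>E {0..<int m}. int m dvd (\<Sum>j\<in>{1..n}. t j)}"
  have finX: "finite ?X" using I by (auto intro: finite_PiE)
  have Msum: "M (\<lambda>i. \<Sum>v\<in>V. f v * z v i) j = (\<Sum>v\<in>V. f v * M (z v) j)"
    if "finite V" for V :: "nat set" and f z j
    using that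
  proof (induction V rule: finite_induct)
    case empty
    show ?case using scale[of 0 "\<lambda>_. 0"] by simp
  next
    case (insert v V)
    then show ?case by (simp add: add scale)
  qed
  have solvable: "\<exists>z. \<forall>j\<in>{1..n}. [M z j = t j] (mod int m)"
    if t: "int m dvd (\<Sum>j\<in>{1..n}. t j)" for t
  proof -
    have "\<forall>v\<in>{1..n}. \<exists>z. \<forall>j\<in>{1..n}. M z j = of_bool (j = v) - of_bool (j = 1)"
      using diff n by auto
    then obtain z where z: "\<And>v j. v \<in> {1..n} \<Longrightarrow> j \<in> {1..n} \<Longrightarrow>
        M (z v) j = of_bool (j = v) - of_bool (j = 1)"
      by metis
    have "[M (\<lambda>i. \<Sum>v\<in>{1..n}. t v * z v i) j = t j] (mod int m)" if j: "j \<in> {1..n}" for j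
    proof -
      have "M (\<lambda>i. \<Sum>v\<in>{1..n}. t v * z v i) j
              = (\<Sum>v\<in>{1..n}. t v * (of_bool (j = v) - of_bool (j = 1)))"
        unfolding Msum[OF finite_atLeastAtMost] using z j by (intro sum.cong) auto
      also have "\<dots> = t j - of_bool (j = 1) * (\<Sum>v\<in>{1..n}. t v)"
      proof -
        have "(\<Sum>v\<in>{1..n}. t v * of_bool (j = v)) = (\<Sum>v\<in>{1..n}. if j = v then t v else 0)"
          by (intro sum.cong) auto
        also have "\<dots> = t j" using j by simp
        finally show ?thesis
          by (simp add: right_diff_distrib sum_subtractf sum_distrib_left mult.commute)
      qed
      finally show ?thesis using t by (simp add: cong_iff_dvd_diff)
    qed
    then show ?thesis by blast
  qed
  have le: "card (fib t) \<le> card (fib t')"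
    if "int m dvd (\<Sum>j\<in>{1..n}. t j)" "int m dvd (\<Sum>j\<in>{1..n}. t' j)" for t t'
  proof -
    have "int m dvd (\<Sum>j\<in>{1..n}. t' j - t j)" using that by (simp add: sum_subtractf)
    then obtain z where z: "\<And>j. j \<in> {1..n} \<Longrightarrow> [M z j = t' j - t j] (mod int m)"
      using solvable by blast
    define shift where "shift x = (\<lambda>i\<in>I. (x i + z i) mod int m)" for x
    show ?thesis
    proof (rule card_inj_on_le[of shift])
      show "inj_on shift (fib t)"
      proof (rule inj_onI)
        fix x y assume xy: "x \<in> fib t" "y \<in> fib t" "shift x = shift y"
        have "x i = y i" if i: "i \<in> I" for i
        proof -
          have "[x i + z i = y i + z i] (mod int m)"
            using fun_cong[OF xy(3), of i] i by (simp add: shift_def cong_def)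
          then have "[x i = y i] (mod int m)" by (simp add: cong_add_rcancel)
          then show ?thesis using xy i by (auto simp: fib_def cong_def PiE_iff)
        qed
        then show "x = y" using xy unfolding fib_def by (intro PiE_ext[of x I _ y]) auto
      qed
      show "shift ` fib t \<subseteq> fib t'"
      proof
        fix y assume "y \<in> shift ` fib t"
        then obtain x where x: "x \<in> fib t" "y = shift x" by auto
        have "[M y j = t' j] (mod int m)" if j: "j \<in> {1..n}" for j
        proof -
          have "[M y j = M (\<lambda>i. x i + z i) j] (mod int m)"
            by (rule cong) (auto simp: x shift_def cong_def)
          also have "M (\<lambda>i. x i + z i) j = M x j + M z j" by (rule add)
          also have "[M x j + M z j = t j + (t' j - t j)] (mod int m)"
            using x z j by (intro cong_add) (auto simp: fib_def)
          finally show ?thesis by simp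
        qed
        moreover have "y \<in> ?X" using m by (auto simp: x shift_def)
        ultimately show "y \<in> fib t'" by (simp add: fib_def)
      qed
      show "finite (fib t')" using finX by (simp add: fib_def)
    qed
  qed
  have "?X = (\<Union>t'\<in>T. fib t')"
  proof (intro Set.set_eqI iffI)
    fix x assume x: "x \<in> ?X"
    define t' where "t' = (\<lambda>j\<in>{1..n}. M x j mod int m)"
    have "[(\<Sum>j\<in>{1..n}. t' j) = (\<Sum>j\<in>{1..n}. M x j)] (mod int m)"
      by (rule cong_sum) (simp add: t'_def cong_def)
    then have "int m dvd (\<Sum>j\<in>{1..n}. t' j)"
      unfolding sum0 by (simp add: cong_iff_dvd_diff)
    then have "t' \<in> T" using m by (auto simp: T_def t'_def)
    moreover have "x \<in> fib t'" using x by (auto simp: fib_def t'_def cong_def)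
    ultimately show "x \<in> (\<Union>t'\<in>T. fib t')" by blast
  qed (auto simp: fib_def)
  moreover have "card (\<Union>t'\<in>T. fib t') = (\<Sum>t'\<in>T. card (fib t'))"
  proof (rule card_UN_disjoint)
    show "finite T" unfolding T_def by (simp add: finite_PiE)
    show "\<forall>t\<in>T. finite (fib t)" using finX by (simp add: fib_def)
    show "\<forall>t\<in>T. \<forall>t'\<in>T. t \<noteq> t' \<longrightarrow> fib t \<inter> fib t' = {}"
    proof (intro ballI impI)
      fix t t' assume tt: "t \<in> T" "t' \<in> T" "t \<noteq> t'"
      then obtain j where j: "j \<in> {1..n}" "t j \<noteq> t' j"
        unfolding T_def using PiE_ext[of t "{1..n}" "\<lambda>_. {0..<int m}" t'] by blast
      show "fib t \<inter> fib t' = {}"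
      proof (rule ccontr)
        assume "fib t \<inter> fib t' \<noteq> {}"
        then obtain x where "[M x j = t j] (mod int m)" "[M x j = t' j] (mod int m)"
          using j unfolding fib_def by blast
        then have "t j mod int m = t' j mod int m" unfolding cong_def by simp
        moreover have "t j \<in> {0..<int m}" "t' j \<in> {0..<int m}"
          using tt j by (auto simp: T_def PiE_iff)
        ultimately show False using j by simp
      qed
    qed
  qed
  moreover have "card (fib t') = card (fib t)" if "t' \<in> T" for t'
    using le[of t t'] le[of t' t] t that unfolding T_def by auto
  ultimately have "card ?X = card T * card (fib t)" by simp
  also have "card T = m ^ (n - 1)" unfolding T_def by (rule card_zero_sum_vectors[OF m n])
  finally show ?thesis
    using card_PiE[OF I, of "\<lambda>_. {0..<int m}"] by (simp add: fib_def mult.commute)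
qed

section \<open>Words of edges and diagonal letters\<close>

text \<open>
  Otherwise simplification replaces the interval \<open>{1..n}\<close> of points by \<open>{Suc 0..n}\<close>.
\<close>

declare One_nat_def [simp del]

text \<open>
  The letter \<open>Inl (v, w)\<close> with \<open>v < w\<close> stands for the reflections over the transposition \<open>(v w)\<close>, which differ by
  a voltage \<open>y\<close>: such a reflection maps the unit vector \<open>e\<^sub>v\<close> to \<open>\<zeta>\<^sup>y e\<^sub>w\<close> and \<open>e\<^sub>w\<close> to
  \<open>\<zeta>\<^sup>-\<^sup>y e\<^sub>v\<close>. The letter \<open>Inr (i, e)\<close> stands for the diagonal reflection that multiplies \<open>e\<^sub>i\<close> by
  \<open>\<zeta>\<^sup>e\<close>. Voltages are kept apart from the word \<open>sk\<close>, as a function \<open>x\<close> of the position, because they are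
  counted for a fixed word; the value of \<open>x\<close> at a diagonal letter is ignored.
\<close>

type_synonym letter = "nat \<times> nat + nat \<times> int"

fun letter_perm :: "letter \<Rightarrow> nat \<Rightarrow> nat" where
  "letter_perm (Inl (v, w)) = Transposition.transpose v w"
| "letter_perm (Inr _) = id"

fun letter_color :: "letter \<Rightarrow> int \<Rightarrow> nat \<Rightarrow> int" where
  "letter_color (Inl (v, w)) y j = (if j = v then y else if j = w then - y else 0)"
| "letter_color (Inr (i, e)) y j = (if j = i then e else 0)"

fun word_perm :: "letter list \<Rightarrow> nat \<Rightarrow> nat" where
  "word_perm [] = id"
| "word_perm (s # sk) = letter_perm s \<circ> word_perm sk"

fun word_color :: "letter list \<Rightarrow> (nat \<Rightarrow> int) \<Rightarrow> nat \<Rightarrow> int" where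
  "word_color [] x j = 0"
| "word_color (s # sk) x j =
     letter_color s (x 0) (word_perm sk j) + word_color sk (\<lambda>i. x (Suc i)) j"

lemma letter_cases [case_names edge diag]:
  fixes s :: letter
  obtains v w where "s = Inl (v, w)" | i e where "s = Inr (i, e)"
  by (cases s) auto

text \<open>
  The diagonal letters contribute a constant to the coloring; without it the coloring is linear in the voltages.
\<close>

definition word_lin :: "letter list \<Rightarrow> (nat \<Rightarrow> int) \<Rightarrow> nat \<Rightarrow> int" where
  "word_lin sk x j = word_color sk x j - word_color sk (\<lambda>_. 0) j"

definition edge_positions :: "letter list \<Rightarrow> nat set" where
  "edge_positions sk = {i. i < length sk \<and> isl (sk ! i)}"

fun letter_on :: "nat \<Rightarrow> letter \<Rightarrow> bool" where
  "letter_on n (Inl (v, w)) \<longleftrightarrow> v \<in> {1..n} \<and> w \<in> {1..n} \<and> v < w"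
| "letter_on n (Inr (i, e)) \<longleftrightarrow> i \<in> {1..n}"

fun diag_label :: "letter \<Rightarrow> int" where
  "diag_label (Inl _) = 0"
| "diag_label (Inr (i, e)) = e"

definition diag_sum :: "letter list \<Rightarrow> int" where
  "diag_sum sk = (\<Sum>s\<leftarrow>sk. diag_label s)"

definition links :: "(nat \<times> nat) set \<Rightarrow> (nat \<times> nat) set" where
  "links E = (E \<union> E\<inverse>)\<^sup>*"

definition linked :: "nat \<Rightarrow> (nat \<times> nat) set \<Rightarrow> bool" where
  "linked n E \<longleftrightarrow> {1..n} \<times> {1..n} \<subseteq> links E"

definition edges_of :: "letter list \<Rightarrow> (nat \<times> nat) set" where
  "edges_of sk = {e. Inl e \<in> set sk}"

lemma edges_of_simps [simp]:
  "edges_of [] = {}" "edges_of (Inl e # sk) = insert e (edges_of sk)"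
  "edges_of (Inr f # sk) = edges_of sk"
  by (auto simp: edges_of_def)

lemma links_refl [simp]: "(v, v) \<in> links E"
  by (simp add: links_def)

lemma links_sym: "(v, w) \<in> links E \<Longrightarrow> (w, v) \<in> links E"
  unfolding links_def by (rule symD[OF sym_rtrancl]) (auto simp: sym_def)

lemma links_trans: "(v, w) \<in> links E \<Longrightarrow> (w, z) \<in> links E \<Longrightarrow> (v, z) \<in> links E"
  unfolding links_def by (rule rtrancl_trans)

lemma links_mono: "E \<subseteq> F \<Longrightarrow> links E \<subseteq> links F"
  unfolding links_def by (rule rtrancl_mono) auto

lemma links_edge: "e \<in> E \<Longrightarrow> e \<in> links E"
  unfolding links_def by auto

lemma links_induct [consumes 1, case_names refl sym trans edge]:
  assumes "(v, w) \<in> links E"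
    and refl: "\<And>v. R v v" and sym: "\<And>v w. R v w \<Longrightarrow> R w v"
    and trans: "\<And>v w z. R v w \<Longrightarrow> R w z \<Longrightarrow> R v z"
    and edge: "\<And>v w. (v, w) \<in> E \<Longrightarrow> R v w"
  shows "R v w"
  using assms(1) unfolding links_def
proof (induction rule: rtrancl_induct)
  case (step y z)
  then show ?case using trans edge sym by blast
qed (rule refl)

lemma bij_letter_perm: "bij (letter_perm s)"
  by (cases s rule: letter_cases) auto

lemma bij_word_perm: "bij (word_perm sk)"
proof (induction sk)
  case (Cons s sk)
  then show ?case unfolding word_perm.simps by (intro bij_comp bij_letter_perm)
qed (unfold word_perm.simps, rule bij_id)

lemma letter_perm_permutes: "letter_on n s \<Longrightarrow> letter_perm s permutes {1..n}"
  by (cases s rule: letter_cases) (auto intro: permutes_swap_id permutes_id)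

lemma word_perm_permutes:
  "\<forall>s\<in>set sk. letter_on n s \<Longrightarrow> word_perm sk permutes {1..n}"
proof (induction sk)
  case (Cons s sk)
  then show ?case unfolding word_perm.simps by (intro permutes_compose letter_perm_permutes) auto
qed (unfold word_perm.simps, rule permutes_id)

lemma word_perm_links: "(j, word_perm sk j) \<in> links (edges_of sk)"
proof (induction sk)
  case (Cons s sk)
  have 1: "(j, word_perm sk j) \<in> links (edges_of (s # sk))"
    using Cons links_mono[of "edges_of sk" "edges_of (s # sk)"] by (auto simp: edges_of_def)
  have 2: "(x, letter_perm s x) \<in> links (edges_of (s # sk))" for x
  proof (cases s rule: letter_cases)
    case (edge v w)
    then have "(v, w) \<in> links (edges_of (s # sk))" by (auto intro: links_edge)
    then show ?thesis using edge links_sym by (auto simp: transpose_def)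
  qed auto
  show ?case using links_trans[OF 1 2] by simp
qed simp

lemma word_lin_Nil [simp]: "word_lin [] x j = 0"
  by (simp add: word_lin_def)

lemma word_lin_Cons [simp]:
  "word_lin (Inl e # sk) x j =
     letter_color (Inl e) (x 0) (word_perm sk j) + word_lin sk (\<lambda>i. x (Suc i)) j"
  "word_lin (Inr f # sk) x j = word_lin sk (\<lambda>i. x (Suc i)) j"
  by (cases e; cases f; simp add: word_lin_def)+

lemma word_color_lin: "word_color sk x j = word_lin sk x j + word_color sk (\<lambda>_. 0) j"
  by (simp add: word_lin_def)

lemma word_lin_add: "word_lin sk (\<lambda>i. x i + y i) j = word_lin sk x j + word_lin sk y j"
proof (induction sk arbitrary: x y)
  case (Cons s sk)
  then show ?case by (cases s rule: letter_cases) auto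
qed simp

lemma word_lin_scale: "word_lin sk (\<lambda>i. c * x i) j = c * word_lin sk x j"
proof (induction sk arbitrary: x)
  case (Cons s sk)
  then show ?case by (cases s rule: letter_cases) (auto simp: algebra_simps)
qed simp

lemma edge_positions_Cons:
  "edge_positions (s # sk) = (if isl s then {0} else {}) \<union> Suc ` edge_positions sk"
proof -
  have "i \<in> edge_positions (s # sk) \<longleftrightarrow> i \<in> (if isl s then {0} else {}) \<union> Suc ` edge_positions sk" for i
    by (cases i) (auto simp: edge_positions_def)
  then show ?thesis by blast
qed

lemma finite_edge_positions [simp]: "finite (edge_positions sk)"
  by (simp add: edge_positions_def)

lemma card_edge_positions: "card (edge_positions sk) = length (filter isl sk)"
  by (simp add: edge_positions_def length_filter_conv_card)

lemma word_lin_cong: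
  "(\<And>i. i \<in> edge_positions sk \<Longrightarrow> [x i = y i] (mod q)) \<Longrightarrow> [word_lin sk x j = word_lin sk y j] (mod q)"
proof (induction sk arbitrary: x y)
  case (Cons s sk)
  have IH: "[word_lin sk (\<lambda>i. x (Suc i)) j = word_lin sk (\<lambda>i. y (Suc i)) j] (mod q)"
    by (rule Cons.IH) (use Cons.prems in \<open>auto simp: edge_positions_Cons\<close>)
  show ?case
  proof (cases s rule: letter_cases)
    case (edge v w)
    then have "[x 0 = y 0] (mod q)" using Cons.prems by (auto simp: edge_positions_Cons)
    then have "[letter_color s (x 0) i = letter_color s (y 0) i] (mod q)" for i
      using edge by (simp add: cong_minus_minus_iff)
    then show ?thesis using edge IH by (simp del: letter_color.simps add: cong_add)
  qed (use IH in auto)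
qed simp

lemma word_color_cong:
  "(\<And>i. i \<in> edge_positions sk \<Longrightarrow> [x i = y i] (mod q)) \<Longrightarrow>
     [word_color sk x j = word_color sk y j] (mod q)"
  unfolding word_color_lin[of sk x] word_color_lin[of sk y] by (intro cong_add word_lin_cong) auto

lemma sum_letter_color:
  assumes "letter_on n s"
  shows "(\<Sum>j\<in>{1..n}. letter_color s y j) = diag_label s"
proof (cases s rule: letter_cases)
  case (edge v w)
  then have vw: "v \<in> {1..n}" "w \<in> {1..n}" "v \<noteq> w" using assms by auto
  have "letter_color s y = (\<lambda>j. (if j = v then y else 0) + (if j = w then - y else 0))"
    using vw(3) by (auto simp: edge)
  then show ?thesis using vw by (simp add: sum.distrib edge)
next
  case (diag i e)
  then have "letter_color s y = (\<lambda>j. if j = i then e else 0)" by (auto simp: diag)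
  then show ?thesis using assms by (simp add: diag)
qed

lemma sum_word_color:
  "\<forall>s\<in>set sk. letter_on n s \<Longrightarrow> (\<Sum>j\<in>{1..n}. word_color sk x j) = diag_sum sk"
proof (induction sk arbitrary: x)
  case (Cons s sk)
  then have "word_perm sk permutes {1..n}" by (intro word_perm_permutes) simp
  then have "(\<Sum>j\<in>{1..n}. letter_color s (x 0) (word_perm sk j)) = (\<Sum>j\<in>{1..n}. letter_color s (x 0) j)"
    using sum.permute[of "word_perm sk" "{1..n}" "letter_color s (x 0)"] by (simp add: comp_def)
  also have "\<dots> = diag_label s" by (rule sum_letter_color) (use Cons.prems in simp)
  finally show ?case using Cons by (simp add: sum.distrib diag_sum_def)
qed (simp add: diag_sum_def)

lemma sum_word_lin:
  "\<forall>s\<in>set sk. letter_on n s \<Longrightarrow> (\<Sum>j\<in>{1..n}. word_lin sk x j) = 0"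
  by (simp add: word_lin_def sum_subtractf sum_word_color)

definition realizes_difference :: "letter list \<Rightarrow> nat \<Rightarrow> nat \<Rightarrow> bool" where
  "realizes_difference sk v w \<longleftrightarrow>
     (\<exists>z. \<forall>j. word_lin sk z j = of_bool (j = v) - of_bool (j = w))"

lemma word_lin_zero [simp]: "word_lin sk (\<lambda>_. 0) j = 0"
  by (simp add: word_lin_def)

lemma realizes_difference_refl: "realizes_difference sk v v"
  unfolding realizes_difference_def by (intro exI[of _ "\<lambda>_. 0"]) simp

lemma realizes_difference_sym:
  assumes "realizes_difference sk v w" shows "realizes_difference sk w v"
proof -
  obtain z where z: "\<And>j. word_lin sk z j = of_bool (j = v) - of_bool (j = w)"
    using assms unfolding realizes_difference_def by metis
  have "word_lin sk (\<lambda>i. (-1) * z i) j = of_bool (j = w) - of_bool (j = v)" for j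
    unfolding word_lin_scale z by simp
  then show ?thesis unfolding realizes_difference_def by metis
qed

lemma realizes_difference_trans:
  assumes "realizes_difference sk v w" "realizes_difference sk w z"
  shows "realizes_difference sk v z"
proof -
  obtain a where a: "\<And>j. word_lin sk a j = of_bool (j = v) - of_bool (j = w)"
    using assms(1) unfolding realizes_difference_def by metis
  obtain b where b: "\<And>j. word_lin sk b j = of_bool (j = w) - of_bool (j = z)"
    using assms(2) unfolding realizes_difference_def by metis
  have "word_lin sk (\<lambda>i. a i + b i) j = of_bool (j = v) - of_bool (j = z)" for j
    unfolding word_lin_add a b by simp
  then show ?thesis unfolding realizes_difference_def by metis
qed

lemma realizes_difference_Cons:
  assumes "realizes_difference sk v w" shows "realizes_difference (s # sk) v w"
proof -
  obtain z where z: "\<And>j. word_lin sk z j = of_bool (j = v) - of_bool (j = w)"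
    using assms unfolding realizes_difference_def by metis
  have "word_lin (s # sk) (case_nat 0 z) j = of_bool (j = v) - of_bool (j = w)" for j
    by (cases s rule: letter_cases) (simp_all add: z)
  then show ?thesis unfolding realizes_difference_def by metis
qed

text \<open>
  A voltage on the first letter \<open>(a c)\<close> adds to the color of the point that the rest of the word carries
  to \<open>a\<close> and subtracts from the color of the point carried to \<open>c\<close>. Each of these two points is linked to \<open>a\<close> or
  \<open>c\<close>, respectively, by the rest of the word, so the induction hypothesis leads from one to the other.
\<close>

lemma word_lin_realizes_differences:
  "(v, w) \<in> links (edges_of sk) \<Longrightarrow> realizes_difference sk v w"
proof (induction sk arbitrary: v w)
  case Nil
  then have "v = w" by (simp add: links_def)
  then show ?case by (simp add: realizes_difference_refl)
next
  case (Cons s sk)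
  have edge: "realizes_difference (s # sk) a c" if ac: "(a, c) \<in> edges_of (s # sk)" for a c
  proof (cases "(a, c) \<in> edges_of sk")
    case True
    then show ?thesis by (intro realizes_difference_Cons Cons.IH links_edge)
  next
    case False
    then have s: "s = Inl (a, c)" using ac by (auto simp: edges_of_def)
    \<comment> \<open>The new letter acts on the two trails that are at \<open>a\<close> and \<open>c\<close> when it is applied.\<close>
    obtain a' c' where ac': "word_perm sk a' = a" "word_perm sk c' = c"
      using bij_word_perm[of sk] by (metis bij_pointE)
    have "(a', a) \<in> links (edges_of sk)" "(c', c) \<in> links (edges_of sk)"
      using word_perm_links[of a' sk] word_perm_links[of c' sk] ac' by simp_all
    then have 1: "realizes_difference (s # sk) a a'" "realizes_difference (s # sk) c' c"
      by (auto intro!: realizes_difference_Cons Cons.IH links_sym)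
    have 2: "realizes_difference (s # sk) a' c'"
    proof (cases "a' = c'")
      case True
      then show ?thesis by (simp add: realizes_difference_refl)
    next
      case False
      have "word_perm sk j = a \<longleftrightarrow> j = a'" "word_perm sk j = c \<longleftrightarrow> j = c'" for j
        using ac' by (metis bij_is_inj bij_word_perm inj_eq)+
      then have "word_lin (s # sk) (case_nat 1 (\<lambda>_. 0)) j = of_bool (j = a') - of_bool (j = c')" for j
        using False by (simp add: s)
      then show ?thesis unfolding realizes_difference_def by metis
    qed
    show ?thesis using realizes_difference_trans[OF realizes_difference_trans[OF 1(1) 2] 1(2)] .
  qed
  from Cons.prems show ?case
    by (rule links_induct)
      (fact realizes_difference_refl, fact realizes_difference_sym,
       fact realizes_difference_trans, fact edge)
qed

text \<open>
  Connectedness makes the linear part of the coloring surjective onto the vectors of sum zero.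
\<close>

lemma card_word_lin_solutions:
  fixes m n :: nat
  assumes "m > 0" "n > 0" "\<forall>s\<in>set sk. letter_on n s" "linked n (edges_of sk)"
    and "int m dvd (\<Sum>j\<in>{1..n}. t j)"
  shows "card {x \<in> edge_positions sk \<rightarrow>\<^sub>E {0..<int m}. \<forall>j\<in>{1..n}. [word_lin sk x j = t j] (mod int m)}
           * m ^ (n - 1) = m ^ length (filter isl sk)"
  unfolding card_edge_positions[symmetric]
proof (rule card_linear_solutions)
  fix v w assume "v \<in> {1..n}" "w \<in> {1..n}"
  then have "(v, w) \<in> links (edges_of sk)" using assms(4) by (auto simp: linked_def)
  then show "\<exists>z. \<forall>j\<in>{1..n}. word_lin sk z j = of_bool (j = v) - of_bool (j = w)"
    using word_lin_realizes_differences unfolding realizes_difference_def by metis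
qed (use assms in \<open>auto simp: word_lin_add word_lin_scale intro: word_lin_cong simp: sum_word_lin\<close>)

section \<open>Gradients and potentials\<close>

text \<open>
  Edges are oriented from the smaller to the larger end.
\<close>

definition grad :: "(nat \<Rightarrow> int) \<Rightarrow> letter list \<Rightarrow> nat \<Rightarrow> int" where
  "grad \<psi> sk i = (case sk ! i of Inl (v, w) \<Rightarrow> \<psi> w - \<psi> v | Inr _ \<Rightarrow> 0)"

definition potential :: "nat \<Rightarrow> (nat \<Rightarrow> int) \<Rightarrow> letter list \<Rightarrow> (nat \<Rightarrow> int) \<Rightarrow> bool" where
  "potential q \<psi> sk x \<longleftrightarrow> (\<forall>i\<in>edge_positions sk. [x i = grad \<psi> sk i] (mod int q))"

text \<open>
  Gradient voltages turn every edge into the conjugate of an uncolored transposition by the diagonal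
  matrix with exponents \<open>\<psi>\<close>. So the product is conjugate to the underlying permutation.
\<close>

lemma word_lin_grad: "word_lin sk (grad \<psi> sk) j = \<psi> (word_perm sk j) - \<psi> j"
proof (induction sk)
  case (Cons s sk)
  have tail: "(\<lambda>i. grad \<psi> (s # sk) (Suc i)) = grad \<psi> sk"
    by (auto simp: grad_def)
  show ?case
  proof (cases s rule: letter_cases)
    case (edge v w)
    then have "grad \<psi> (s # sk) 0 = \<psi> w - \<psi> v" by (simp add: grad_def)
    then show ?thesis unfolding edge word_lin_Cons tail[unfolded edge] Cons.IH
      by (simp add: transpose_def)
  next
    case (diag i e)
    show ?thesis unfolding diag word_lin_Cons tail[unfolded diag] Cons.IH by simp
  qed
qed simp

lemma dvd_word_color_zero:
  "\<forall>s\<in>set sk. q dvd diag_label s \<Longrightarrow> q dvd word_color sk (\<lambda>_. 0) j"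
proof (induction sk)
  case (Cons s sk)
  have "q dvd letter_color s 0 i" for i
    using Cons.prems by (cases s rule: letter_cases) auto
  then show ?case using Cons by simp
qed simp

section \<open>Invariant functions and cocycles of a permutation\<close>

lemma cycle_supports_finite [simp]: "finite (cycle_supports n u)"
  by (simp add: cycle_supports_def)

lemma permutes_self_in_orbit:
  assumes "u permutes {1..n::nat}"
  shows "x \<in> Orbits.orbit u x"
  by (rule permutation_self_in_orbit) (use assms in \<open>auto simp: permutation_permutes\<close>)

lemma permutes_orbit_step:
  assumes "u permutes {1..n::nat}"
  shows "Orbits.orbit u (u x) = Orbits.orbit u x"
  by (rule permutation_orbit_step) (use assms in \<open>auto simp: permutation_permutes\<close>)

lemma permutes_orbit_eq:
  assumes "u permutes {1..n::nat}" "y \<in> Orbits.orbit u x"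
  shows "Orbits.orbit u y = Orbits.orbit u x"
  using assms(2) by (induction rule: Orbits.orbit.induct) (simp_all add: permutes_orbit_step[OF assms(1)])

lemma invariant_on_orbit:
  assumes "u permutes {1..n}" "\<forall>x\<in>{1..n}. f (u x) = f x" "x \<in> {1..n}" "y \<in> Orbits.orbit u x"
  shows "y \<in> {1..n} \<and> f y = f x"
  using assms(4)
proof (induction rule: Orbits.orbit.induct)
  case base
  then show ?case using assms permutes_in_image[OF assms(1)] by auto
next
  case (step y)
  then show ?case using assms permutes_in_image[OF assms(1)] by auto
qed

text \<open>
  Besides counting potentials, this identity serves to compare the numbers of cycles of two permutations.
\<close>

lemma card_invariant_functions:
  assumes u: "u permutes {1..n}" and A: "finite A"
  shows "card {f \<in> {1..n} \<rightarrow>\<^sub>E A. \<forall>x\<in>{1..n}. f (u x) = f x} = card A ^ card (cycle_supports n u)"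
    (is "card ?F = _")
proof -
  define pull where "pull g = (\<lambda>x\<in>{1..n}. g (Orbits.orbit u x))" for g :: "nat set \<Rightarrow> 'a"
  have "inj_on pull (cycle_supports n u \<rightarrow>\<^sub>E A)"
  proof (rule inj_onI)
    fix g h assume gh: "g \<in> cycle_supports n u \<rightarrow>\<^sub>E A" "h \<in> cycle_supports n u \<rightarrow>\<^sub>E A" "pull g = pull h"
    have "g S = h S" if S: "S \<in> cycle_supports n u" for S
    proof -
      obtain x where "x \<in> {1..n}" "S = Orbits.orbit u x" using S unfolding cycle_supports_def by blast
      then show ?thesis using fun_cong[OF gh(3), of x] by (simp add: pull_def)
    qed
    then show "g = h" using gh by (intro PiE_ext[of g _ _ h])
  qed
  moreover have "pull ` (cycle_supports n u \<rightarrow>\<^sub>E A) = ?F"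
  proof (intro Set.set_eqI iffI)
    fix f assume "f \<in> pull ` (cycle_supports n u \<rightarrow>\<^sub>E A)"
    then obtain g where g: "g \<in> cycle_supports n u \<rightarrow>\<^sub>E A" "f = pull g" by blast
    have "f (u x) = f x" if "x \<in> {1..n}" for x
      using that permutes_in_image[OF u, of x]
      by (simp add: g(2) pull_def permutes_orbit_step[OF u])
    moreover have "f \<in> {1..n} \<rightarrow>\<^sub>E A"
      using g by (auto simp: pull_def PiE_iff cycle_supports_def)
    ultimately show "f \<in> ?F" by simp
  next
    fix f assume f: "f \<in> ?F"
    define g where "g = (\<lambda>S\<in>cycle_supports n u. f (SOME x. x \<in> S))"
    have *: "f (SOME y. y \<in> Orbits.orbit u x) = f x" if x: "x \<in> {1..n}" for x
      using invariant_on_orbit[OF u _ x, of f "SOME y. y \<in> Orbits.orbit u x"] f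
        someI[of "\<lambda>y. y \<in> Orbits.orbit u x", OF permutes_self_in_orbit[OF u]] by simp
    have "f = pull g"
    proof
      fix x show "f x = pull g x"
      proof (cases "x \<in> {1..n}")
        case True
        then show ?thesis using *[OF True] by (simp add: pull_def g_def cycle_supports_def)
      next
        case False
        then show ?thesis using f by (auto simp: pull_def PiE_iff extensional_def)
      qed
    qed
    moreover have "g \<in> cycle_supports n u \<rightarrow>\<^sub>E A"
      using f * by (auto simp: g_def cycle_supports_def PiE_iff)
    ultimately show "f \<in> pull ` (cycle_supports n u \<rightarrow>\<^sub>E A)" by blast
  qed
  ultimately have "card ?F = card (cycle_supports n u \<rightarrow>\<^sub>E A)"
    by (metis card_image)
  also have "\<dots> = card A ^ card (cycle_supports n u)" by (simp add: card_PiE)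
  finally show ?thesis .
qed

lemma funpow_dist_to_image:
  assumes inj: "inj u" and x: "x \<in> Orbits.orbit u r" and ne: "u x \<noteq> r"
  shows "funpow_dist u r (u x) = Suc (funpow_dist u r x)"
  unfolding funpow_dist_def[of u r "u x"]
proof (rule Least_equality)
  have "(u ^^ funpow_dist u r x) r = x" by (rule funpow_dist_prop[OF x])
  then show "(u ^^ Suc (funpow_dist u r x)) r = u x" by simp
  fix t assume t: "(u ^^ t) r = u x"
  then obtain t' where t': "t = Suc t'" using ne by (cases t) auto
  then have "(u ^^ t') r = x" using t inj by (simp add: inj_eq)
  then show "Suc (funpow_dist u r x) \<le> t"
    unfolding t' funpow_dist_def by (simp add: Least_le)
qed

lemma funpow_dist_closing:
  assumes inj: "inj u" and x: "x \<in> Orbits.orbit u r" and closing: "u x = r"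
  shows "funpow_dist u (u r) r = funpow_dist u r x"
proof -
  have "((u ^^ t) (u r) = r) = ((u ^^ t) r = x)" for t
    using inj closing by (metis funpow_swap1 inj_eq)
  then show ?thesis unfolding funpow_dist_def by simp
qed

text \<open>
  Summing \<open>\<psi> (u x) - \<psi> x\<close> around a cycle gives \<open>0\<close>. Conversely, \<open>\<psi>\<close> is the sum of \<open>b\<close> along the cycle from
  a chosen representative, and only the step that closes the cycle imposes a condition.
\<close>

lemma cocycle_iff_cycle_colors:
  assumes u: "u permutes {1..n}"
  shows "(\<exists>\<psi>. \<forall>x\<in>{1..n}. [\<psi> (u x) - \<psi> x = b x] (mod q)) \<longleftrightarrow>
         (\<forall>S\<in>cycle_supports n u. q dvd color b S)"
proof
  assume "\<exists>\<psi>. \<forall>x\<in>{1..n}. [\<psi> (u x) - \<psi> x = b x] (mod q)"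
  then obtain \<psi> where \<psi>: "\<And>x. x \<in> {1..n} \<Longrightarrow> [\<psi> (u x) - \<psi> x = b x] (mod q)" by blast
  show "\<forall>S\<in>cycle_supports n u. q dvd color b S"
  proof
    fix S assume "S \<in> cycle_supports n u"
    then obtain x where x: "x \<in> {1..n}" "S = Orbits.orbit u x" unfolding cycle_supports_def by blast
    have sub: "S \<subseteq> {1..n}" using invariant_on_orbit[OF u, of "\<lambda>_. 0::nat" x] x by blast
    have fin: "finite S" using finite_subset[OF sub] by simp
    have "u ` S \<subseteq> S" unfolding x(2) by (auto intro: Orbits.orbit.step)
    moreover have inj: "inj_on u S" using permutes_inj_on[OF u] .
    ultimately have img: "u ` S = S" using fin by (simp add: endo_inj_surj)
    have "[(\<Sum>j\<in>S. \<psi> (u j) - \<psi> j) = color b S] (mod q)"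
      unfolding color_def by (rule cong_sum) (use \<psi> sub in blast)
    moreover have "(\<Sum>j\<in>S. \<psi> (u j)) = (\<Sum>j\<in>S. \<psi> j)"
      using sum.reindex[OF inj, of \<psi>] by (simp add: img comp_def)
    ultimately show "q dvd color b S"
      by (simp add: sum_subtractf cong_0_iff cong_sym_eq[of 0])
  qed
next
  assume b: "\<forall>S\<in>cycle_supports n u. q dvd color b S"
  have inj: "inj u" using permutes_inj[OF u] .
  define r where "r x = (SOME y. y \<in> Orbits.orbit u x)" for x
  have r: "r x \<in> Orbits.orbit u x" for x
    unfolding r_def by (rule someI[of "\<lambda>y. y \<in> Orbits.orbit u x", OF permutes_self_in_orbit[OF u]])
  have r_step: "r (u x) = r x" for x unfolding r_def permutes_orbit_step[OF u] ..
  have x_in: "x \<in> Orbits.orbit u (r x)" for x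
    using permutes_orbit_eq[OF u r[of x]] permutes_self_in_orbit[OF u, of x] by simp
  define \<psi> where "\<psi> x = (\<Sum>t<funpow_dist u (r x) x. b ((u ^^ t) (r x)))" for x
  have "[\<psi> (u x) - \<psi> x = b x] (mod q)" if x: "x \<in> {1..n}" for x
  proof -
    define k where "k = funpow_dist u (r x) x"
    have k: "(u ^^ k) (r x) = x" unfolding k_def by (rule funpow_dist_prop[OF x_in])
    have sum_k: "(\<Sum>t<Suc k. b ((u ^^ t) (r x))) = \<psi> x + b x"
      by (simp add: \<psi>_def k flip: k_def)
    show ?thesis
    proof (cases "u x = r x")
      case False
      have "\<psi> (u x) = (\<Sum>t<Suc k. b ((u ^^ t) (r x)))"
        unfolding \<psi>_def r_step funpow_dist_to_image[OF inj x_in False] k_def ..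
      then show ?thesis using sum_k by simp
    next
      case True
      \<comment> \<open>The sum around the whole cycle is its color, which vanishes modulo \<open>q\<close>.\<close>
      have "funpow_dist u (u (r x)) (r x) = k"
        unfolding k_def by (rule funpow_dist_closing[OF inj x_in True])
      then have "Orbits.orbit u (r x) = (\<lambda>t. (u ^^ t) (r x)) ` {0..<Suc k}"
        and "inj_on (\<lambda>t. (u ^^ t) (r x)) {0..<Suc k}"
        using orbit_conv_funpow_dist1[OF permutes_self_in_orbit[OF u, of "r x"]]
          inj_on_funpow_dist1[OF permutes_self_in_orbit[OF u, of "r x"]] by simp_all
      then have "color b (Orbits.orbit u (r x)) = (\<Sum>t<Suc k. b ((u ^^ t) (r x)))"
        unfolding color_def by (simp add: sum.reindex atLeast0LessThan)
      moreover have "Orbits.orbit u (r x) \<in> cycle_supports n u"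
        using permutes_orbit_eq[OF u r[of x]] x by (simp add: cycle_supports_def)
      moreover have "\<psi> (u x) = 0"
        unfolding \<psi>_def r_step by (simp add: funpow_dist_0[OF True[symmetric]])
      ultimately have dvd: "q dvd \<psi> x + b x" and eq: "\<psi> (u x) - \<psi> x - b x = - (\<psi> x + b x)"
        using b sum_k by auto
      show ?thesis unfolding cong_iff_dvd_diff eq dvd_minus_iff by (rule dvd)
    qed
  qed
  then show "\<exists>\<psi>. \<forall>x\<in>{1..n}. [\<psi> (u x) - \<psi> x = b x] (mod q)" by blast
qed

text \<open>
  If there is a solution at all, then the solutions are its translates by the functions modulo \<open>q\<close>
  that are constant on the cycles.
\<close>

lemma card_cocycles:
  assumes u: "u permutes {1..n}" and q: "q > 0"
  shows "card {\<psi> \<in> {1..n} \<rightarrow>\<^sub>E {0..<int q}. \<forall>x\<in>{1..n}. [\<psi> (u x) - \<psi> x = b x] (mod int q)} =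
    (if \<forall>S\<in>cycle_supports n u. int q dvd color b S then q ^ card (cycle_supports n u) else 0)"
    (is "card ?C = _")
proof (cases "\<forall>S\<in>cycle_supports n u. int q dvd color b S")
  case True
  then obtain \<psi> where \<psi>: "\<And>x. x \<in> {1..n} \<Longrightarrow> [\<psi> (u x) - \<psi> x = b x] (mod int q)"
    using cocycle_iff_cycle_colors[OF u] by blast
  have ux: "u x \<in> {1..n} \<longleftrightarrow> x \<in> {1..n}" for x using permutes_in_image[OF u] .
  let ?F = "{f \<in> {1..n} \<rightarrow>\<^sub>E {0..<int q}. \<forall>x\<in>{1..n}. f (u x) = f x}"
  have "bij_betw (\<lambda>f. \<lambda>x\<in>{1..n}. (f x + \<psi> x) mod int q) ?F ?C"
  proof (rule bij_betw_byWitness[where f' = "\<lambda>f. \<lambda>x\<in>{1..n}. (f x - \<psi> x) mod int q"])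
    show "\<forall>f\<in>?F. (\<lambda>x\<in>{1..n}. ((\<lambda>x\<in>{1..n}. (f x + \<psi> x) mod int q) x - \<psi> x) mod int q) = f"
    proof
      fix f assume f: "f \<in> ?F"
      show "(\<lambda>x\<in>{1..n}. ((\<lambda>x\<in>{1..n}. (f x + \<psi> x) mod int q) x - \<psi> x) mod int q) = f"
        using f by (intro PiE_ext[of _ "{1..n}" "\<lambda>_. {0..<int q}" f]) (auto simp: mod_diff_left_eq PiE_iff q)
    qed
    show "\<forall>f\<in>?C. (\<lambda>x\<in>{1..n}. ((\<lambda>x\<in>{1..n}. (f x - \<psi> x) mod int q) x + \<psi> x) mod int q) = f"
    proof
      fix f assume f: "f \<in> ?C"
      show "(\<lambda>x\<in>{1..n}. ((\<lambda>x\<in>{1..n}. (f x - \<psi> x) mod int q) x + \<psi> x) mod int q) = f"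
        using f by (intro PiE_ext[of _ "{1..n}" "\<lambda>_. {0..<int q}" f]) (auto simp: mod_add_left_eq PiE_iff q)
    qed
    show "(\<lambda>f. \<lambda>x\<in>{1..n}. (f x + \<psi> x) mod int q) ` ?F \<subseteq> ?C"
    proof
      fix g assume "g \<in> (\<lambda>f. \<lambda>x\<in>{1..n}. (f x + \<psi> x) mod int q) ` ?F"
      then obtain f where f: "f \<in> ?F" and g: "g = (\<lambda>x\<in>{1..n}. (f x + \<psi> x) mod int q)" by blast
      have "[g (u x) - g x = b x] (mod int q)" if x: "x \<in> {1..n}" for x
      proof -
        have "[g (u x) - g x = (f (u x) + \<psi> (u x)) - (f x + \<psi> x)] (mod int q)"
          using x by (intro cong_diff) (simp_all add: g ux del: atLeastAtMost_iff)
        also have "(f (u x) + \<psi> (u x)) - (f x + \<psi> x) = \<psi> (u x) - \<psi> x" using f x by simp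
        also have "[\<psi> (u x) - \<psi> x = b x] (mod int q)" by (rule \<psi>[OF x])
        finally show ?thesis .
      qed
      then show "g \<in> ?C" using q by (simp add: g del: atLeastAtMost_iff)
    qed
    show "(\<lambda>f. \<lambda>x\<in>{1..n}. (f x - \<psi> x) mod int q) ` ?C \<subseteq> ?F"
    proof
      fix g assume "g \<in> (\<lambda>f. \<lambda>x\<in>{1..n}. (f x - \<psi> x) mod int q) ` ?C"
      then obtain f where f: "f \<in> ?C" and g: "g = (\<lambda>x\<in>{1..n}. (f x - \<psi> x) mod int q)" by blast
      have "g (u x) = g x" if x: "x \<in> {1..n}" for x
      proof -
        have "[f (u x) - f x = \<psi> (u x) - \<psi> x] (mod int q)"
          using f x cong_trans[OF _ cong_sym[OF \<psi>[OF x]]] by blast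
        then have "[f (u x) - \<psi> (u x) = f x - \<psi> x] (mod int q)"
          unfolding cong_iff_dvd_diff by (simp add: algebra_simps)
        then show ?thesis using x by (simp add: g cong_def ux del: atLeastAtMost_iff)
      qed
      then show "g \<in> ?F" using q by (simp add: g del: atLeastAtMost_iff)
    qed
  qed
  then have "card ?C = card ?F" by (simp add: bij_betw_same_card)
  then show ?thesis using True card_invariant_functions[OF u, of "{0..<int q}"] by simp
next
  case False
  then have "?C = {}" using cocycle_iff_cycle_colors[OF u, where b = b and q = "int q"] by blast
  then show ?thesis using False by (simp only: card.empty if_False)
qed

section \<open>Potentials on a connected word\<close>

lemma grad_at:
  assumes "sk ! i = Inl (v, w)" shows "grad \<psi> sk i = \<psi> w - \<psi> v"
  using assms by (simp add: grad_def)

lemma potential_iff: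
  "potential q \<psi> sk x \<longleftrightarrow>
     (\<forall>i v w. i < length sk \<longrightarrow> sk ! i = Inl (v, w) \<longrightarrow> [x i = \<psi> w - \<psi> v] (mod int q))"
proof -
  have "i \<in> edge_positions sk \<longleftrightarrow> i < length sk \<and> (\<exists>v w. sk ! i = Inl (v, w))" for i
    by (cases "sk ! i" rule: letter_cases) (auto simp: edge_positions_def)
  then show ?thesis unfolding potential_def by (metis grad_at)
qed

text \<open>
  The number \<open>h\<close> is the sum of the voltages along a path from \<open>v\<close> to \<open>w\<close>, taken with signs.
\<close>

lemma universal_potential_difference:
  assumes "(v, w) \<in> links (edges_of sk)"
  shows "\<exists>h. \<forall>q \<psi>. potential q \<psi> sk x \<longrightarrow> [\<psi> w - \<psi> v = h] (mod int q)"
  using assms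
proof (induction v w rule: links_induct)
  case (refl v)
  then show ?case by (intro exI[of _ 0]) simp
next
  case (sym v w)
  then obtain h where h: "\<And>q \<psi>. potential q \<psi> sk x \<Longrightarrow> [\<psi> w - \<psi> v = h] (mod int q)" by blast
  have "[\<psi> v - \<psi> w = - h] (mod int q)" if "potential q \<psi> sk x" for q \<psi>
    using h[OF that] cong_minus_minus_iff[of "\<psi> w - \<psi> v" h] by simp
  then show ?case by blast
next
  case (trans v w z)
  then obtain h h' where h: "\<And>q \<psi>. potential q \<psi> sk x \<Longrightarrow> [\<psi> w - \<psi> v = h] (mod int q)"
    "\<And>q \<psi>. potential q \<psi> sk x \<Longrightarrow> [\<psi> z - \<psi> w = h'] (mod int q)" by blast
  have "[\<psi> z - \<psi> v = h + h'] (mod int q)" if "potential q \<psi> sk x" for q \<psi>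
    using cong_add[OF h(1)[OF that] h(2)[OF that]] by simp
  then show ?case by blast
next
  case (edge v w)
  then obtain i where "i < length sk" "sk ! i = Inl (v, w)"
    by (auto simp: edges_of_def in_set_conv_nth)
  then have "\<forall>q \<psi>. potential q \<psi> sk x \<longrightarrow> [\<psi> w - \<psi> v = x i] (mod int q)"
    unfolding potential_iff using cong_sym by blast
  then show ?case by blast
qed

text \<open>
  By the previous lemma one integral function \<open>h\<close> is, up to constants, the only possible potential for
  every modulus at once. So the moduli with a potential are the common divisors of the defects
  \<open>x i - grad h sk i\<close>.
\<close>

lemma potential_exists_iff_dvd:
  assumes "linked n (edges_of sk)" "\<forall>s\<in>set sk. letter_on n s"
  shows "\<exists>D::nat. \<forall>q. (\<exists>\<psi>. potential q \<psi> sk x) \<longleftrightarrow> q dvd D"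
proof -
  have "\<exists>h. \<forall>q \<psi>. potential q \<psi> sk x \<longrightarrow> [\<psi> w - \<psi> 1 = h] (mod int q)" if "w \<in> {1..n}" for w
    using that assms(1) by (intro universal_potential_difference) (auto simp: linked_def)
  then obtain h where h: "\<And>w q \<psi>. w \<in> {1..n} \<Longrightarrow> potential q \<psi> sk x \<Longrightarrow>
      [\<psi> w - \<psi> 1 = h w] (mod int q)"
    by metis
  define D where "D = nat (Gcd ((\<lambda>i. x i - grad h sk i) ` edge_positions sk))"
  have D: "int D = Gcd ((\<lambda>i. x i - grad h sk i) ` edge_positions sk)"
    unfolding D_def by simp
  have "(\<exists>\<psi>. potential q \<psi> sk x) \<longleftrightarrow> q dvd D" for q
  proof
    assume "q dvd D"
    then have "int q dvd Gcd ((\<lambda>i. x i - grad h sk i) ` edge_positions sk)"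
      unfolding D[symmetric] by simp
    then have "int q dvd x i - grad h sk i" if "i \<in> edge_positions sk" for i
      using that by (meson Gcd_dvd dvd_trans imageI)
    then have "potential q h sk x" unfolding potential_def by (simp add: cong_iff_dvd_diff)
    then show "\<exists>\<psi>. potential q \<psi> sk x" by blast
  next
    assume "\<exists>\<psi>. potential q \<psi> sk x"
    then obtain \<psi> where \<psi>: "potential q \<psi> sk x" ..
    have "int q dvd x i - grad h sk i" if i: "i \<in> edge_positions sk" for i
    proof -
      obtain v w where vw: "sk ! i = Inl (v, w)"
        using i by (cases "sk ! i" rule: letter_cases) (auto simp: edge_positions_def)
      have "letter_on n (sk ! i)" using i assms(2) by (auto simp: edge_positions_def)
      then have "v \<in> {1..n}" "w \<in> {1..n}" by (simp_all add: vw)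
      from cong_diff[OF h[OF this(2) \<psi>] h[OF this(1) \<psi>]]
      have 1: "[\<psi> w - \<psi> v = h w - h v] (mod int q)" by simp
      have "[x i = \<psi> w - \<psi> v] (mod int q)"
        using \<psi> vw i unfolding potential_iff by (auto simp: edge_positions_def)
      from cong_trans[OF this 1] show ?thesis by (simp add: grad_at[OF vw] cong_iff_dvd_diff)
    qed
    then have "int q dvd Gcd ((\<lambda>i. x i - grad h sk i) ` edge_positions sk)"
      by (auto intro: Gcd_greatest)
    then show "q dvd D" unfolding D[symmetric] by simp
  qed
  then show ?thesis by blast
qed

text \<open>
  On a connected word two potentials modulo \<open>q\<close> differ by a constant.
\<close>

lemma card_potentials:
  assumes "linked n (edges_of sk)" "\<forall>s\<in>set sk. letter_on n s" "n > 0" "q > 0"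
  shows "card {\<psi> \<in> {1..n} \<rightarrow>\<^sub>E {0..<int q}. potential q \<psi> sk x} =
    (if \<exists>\<psi>. potential q \<psi> sk x then q else 0)" (is "card ?P = _")
proof (cases "\<exists>\<psi>. potential q \<psi> sk x")
  case True
  then obtain \<psi> where \<psi>: "potential q \<psi> sk x" ..
  define shift where "shift c = (\<lambda>j\<in>{1..n}. (\<psi> j + c) mod int q)" for c
  have on: "v \<in> {1..n} \<and> w \<in> {1..n}" if "i < length sk" "sk ! i = Inl (v, w)" for i v w
    using assms(2) that by (metis letter_on.simps(1) nth_mem)
  have "bij_betw shift {0..<int q} ?P"
    unfolding bij_betw_def
  proof
    show "inj_on shift {0..<int q}"
    proof (rule inj_onI)
      fix c c' assume c: "c \<in> {0..<int q}" "c' \<in> {0..<int q}" "shift c = shift c'"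
      have "[\<psi> 1 + c = \<psi> 1 + c'] (mod int q)"
        using fun_cong[OF c(3), of 1] assms(3) by (simp add: shift_def cong_def)
      then show "c = c'" using c by (simp add: cong_add_lcancel) (simp add: cong_def)
    qed
    show "shift ` {0..<int q} = ?P"
    proof (intro Set.set_eqI iffI)
      fix \<phi> assume "\<phi> \<in> shift ` {0..<int q}"
      then obtain c where \<phi>: "\<phi> = shift c" by blast
      have "[x i = \<phi> w - \<phi> v] (mod int q)" if i: "i < length sk" "sk ! i = Inl (v, w)" for i v w
      proof -
        have "[\<phi> w - \<phi> v = (\<psi> w + c) - (\<psi> v + c)] (mod int q)"
          using on[OF i] by (intro cong_diff) (auto simp: \<phi> shift_def)
        then have 1: "[\<psi> w - \<psi> v = \<phi> w - \<phi> v] (mod int q)" by (simp add: cong_sym)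
        have "[x i = \<psi> w - \<psi> v] (mod int q)" using \<psi> i unfolding potential_iff by blast
        from cong_trans[OF this 1] show ?thesis .
      qed
      then show "\<phi> \<in> ?P" unfolding potential_iff using assms(4) by (auto simp: \<phi> shift_def)
    next
      fix \<phi> assume \<phi>: "\<phi> \<in> ?P"
      define c where "c = (\<phi> 1 - \<psi> 1) mod int q"
      have "\<phi> = shift c"
      proof (rule PiE_ext[of _ "{1..n}" "\<lambda>_. {0..<int q}"])
        fix j assume j: "j \<in> {1..n}"
        then have "(1, j) \<in> links (edges_of sk)" using assms(1) by (auto simp: linked_def)
        then obtain h where h: "[\<phi> j - \<phi> 1 = h] (mod int q)" "[\<psi> j - \<psi> 1 = h] (mod int q)"
          using universal_potential_difference \<phi> \<psi> by blast
        have "[\<phi> j - \<phi> 1 = \<psi> j - \<psi> 1] (mod int q)" using cong_trans[OF h(1) cong_sym[OF h(2)]] .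
        from cong_add[OF this cong_refl[of "\<phi> 1"]]
        have "[\<phi> j = \<psi> j + (\<phi> 1 - \<psi> 1)] (mod int q)" by (simp add: algebra_simps)
        then have "\<phi> j mod int q = (\<psi> j + c) mod int q"
          by (simp add: c_def cong_def mod_add_right_eq)
        moreover have "\<phi> j mod int q = \<phi> j" using \<phi> j by (auto simp: PiE_iff)
        ultimately show "\<phi> j = shift c j" using j by (simp add: shift_def)
      qed (use \<phi> assms(4) in \<open>auto simp: shift_def\<close>)
      moreover have "c \<in> {0..<int q}" using assms(4) by (simp add: c_def)
      ultimately show "\<phi> \<in> shift ` {0..<int q}" by blast
    qed
  qed
  from bij_betw_same_card[OF this] have "card ?P = card {0..<int q}" by (rule sym)
  then show ?thesis using True by simp
qed simp

section \<open>Counting voltages with a potential modulo \<open>q\<close>\<close>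

definition solutions :: "nat \<Rightarrow> nat \<Rightarrow> (nat \<Rightarrow> int) \<Rightarrow> letter list \<Rightarrow> (nat \<Rightarrow> int) set" where
  "solutions m n b sk =
     {x \<in> edge_positions sk \<rightarrow>\<^sub>E {0..<int m}. \<forall>j\<in>{1..n}. [word_color sk x j = b j] (mod int m)}"

lemma finite_solutions [simp]: "finite (solutions m n b sk)"
  unfolding solutions_def by (simp add: finite_PiE)

lemma word_color_grad_shift:
  "word_color sk (\<lambda>i. grad \<psi> sk i + q * y i) j =
     \<psi> (word_perm sk j) - \<psi> j + q * word_lin sk y j + word_color sk (\<lambda>_. 0) j"
  unfolding word_color_lin[of sk "\<lambda>i. grad \<psi> sk i + q * y i"] word_lin_add word_lin_scale word_lin_grad ..

text \<open>
  The voltages with potential \<open>\<psi>\<close> are \<open>grad \<psi> + q y\<close>, and their coloring is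
  \<open>\<psi> \<circ> u - \<psi>\<close> plus \<open>q\<close> times a linear function of \<open>y\<close> plus the part of the diagonal letters. By the
  cocycle condition all terms of the equation are multiples of \<open>q\<close>, so it is a linear system for \<open>y\<close> modulo \<open>m / q\<close>.
\<close>

lemma card_solutions_over_potential:
  assumes m: "m > 0" and n: "n > 0" and on: "\<forall>s\<in>set sk. letter_on n s"
    and linked: "linked n (edges_of sk)" and qm: "q dvd m" and diag: "\<forall>s\<in>set sk. int q dvd diag_label s"
    and cocycle: "\<And>j. j \<in> {1..n} \<Longrightarrow> [\<psi> (word_perm sk j) - \<psi> j = b j] (mod int q)"
    and total: "int m dvd (\<Sum>j\<in>{1..n}. b j) - diag_sum sk"
  shows "card {x \<in> solutions m n b sk. potential q \<psi> sk x} * (m div q) ^ (n - 1)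
           = (m div q) ^ length (filter isl sk)"
proof -
  define r where "r = m div q"
  have m_qr: "m = q * r" using qm by (simp add: r_def)
  then have q: "q > 0" and r: "r > 0" using m by simp_all
  let ?I = "edge_positions sk" and ?c = "\<lambda>j. word_color sk (\<lambda>_. 0) j"
  define t where "t j = (b j - ?c j - (\<psi> (word_perm sk j) - \<psi> j)) div int q" for j
  have qt: "int q * t j = b j - ?c j - (\<psi> (word_perm sk j) - \<psi> j)" if j: "j \<in> {1..n}" for j
  proof -
    have "int q dvd (\<psi> (word_perm sk j) - \<psi> j) - b j"
      using cocycle[OF j] by (simp add: cong_iff_dvd_diff)
    then have "int q dvd - ((\<psi> (word_perm sk j) - \<psi> j) - b j) - ?c j"
      using dvd_word_color_zero[OF diag] by (intro dvd_diff) (simp_all only: dvd_minus_iff)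
    also have "- ((\<psi> (word_perm sk j) - \<psi> j) - b j) - ?c j = b j - ?c j - (\<psi> (word_perm sk j) - \<psi> j)"
      by simp
    finally show ?thesis unfolding t_def by simp
  qed
  have "int q * (\<Sum>j\<in>{1..n}. t j) = (\<Sum>j\<in>{1..n}. b j - ?c j - (\<psi> (word_perm sk j) - \<psi> j))"
    unfolding sum_distrib_left by (rule sum.cong) (simp_all only: qt)
  also have "\<dots> = (\<Sum>j\<in>{1..n}. b j) - diag_sum sk"
  proof -
    have "(\<Sum>j\<in>{1..n}. \<psi> (word_perm sk j)) = (\<Sum>j\<in>{1..n}. \<psi> j)"
      using sum.permute[OF word_perm_permutes[OF on], of \<psi>] by (simp add: comp_def)
    then show ?thesis by (simp add: sum_subtractf sum_word_color[OF on])
  qed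
  finally have "int q * int r dvd int q * (\<Sum>j\<in>{1..n}. t j)" using total by (simp add: m_qr)
  then have sum_t: "int r dvd (\<Sum>j\<in>{1..n}. t j)" using q by simp
  let ?Y = "{y \<in> ?I \<rightarrow>\<^sub>E {0..<int r}. \<forall>j\<in>{1..n}. [word_lin sk y j = t j] (mod int r)}"
  let ?X = "{x \<in> solutions m n b sk. potential q \<psi> sk x}"
  have equiv: "(\<forall>j\<in>{1..n}. [word_color sk x j = b j] (mod int m)) \<longleftrightarrow>
      (\<forall>j\<in>{1..n}. [word_lin sk y j = t j] (mod int r))"
    if xy: "\<And>i. i \<in> ?I \<Longrightarrow> [x i = grad \<psi> sk i + int q * y i] (mod int m)" for x y
  proof (rule ball_cong[OF refl])
    fix j assume j: "j \<in> {1..n}"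
    let ?s = "\<psi> (word_perm sk j) - \<psi> j + int q * word_lin sk y j + ?c j"
    have "[word_color sk x j = ?s] (mod int m)"
      unfolding word_color_grad_shift[symmetric] by (rule word_color_cong) (rule xy)
    then have "[word_color sk x j = b j] (mod int m) \<longleftrightarrow> [?s = b j] (mod int m)"
      by (simp add: cong_def)
    also have "\<dots> \<longleftrightarrow> int q * int r dvd int q * (word_lin sk y j - t j)"
      unfolding cong_iff_dvd_diff m_qr right_diff_distrib qt[OF j] by (simp add: algebra_simps)
    also have "\<dots> \<longleftrightarrow> [word_lin sk y j = t j] (mod int r)"
      using q by (simp add: cong_iff_dvd_diff)
    finally show "[word_color sk x j = b j] (mod int m) \<longleftrightarrow> [word_lin sk y j = t j] (mod int r)" .
  qed
  define to where "to y = (\<lambda>i\<in>?I. (grad \<psi> sk i + int q * y i) mod int m)" for y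
  define quo where "quo x = (\<lambda>i\<in>?I. ((x i - grad \<psi> sk i) div int q) mod int r)" for x :: "nat \<Rightarrow> int"
  have "bij_betw to ?Y ?X"
  proof (rule bij_betw_byWitness[where f' = quo])
    show "\<forall>y\<in>?Y. quo (to y) = y"
    proof
      fix y assume y: "y \<in> ?Y"
      show "quo (to y) = y"
      proof (rule PiE_ext[of _ ?I "\<lambda>_. {0..<int r}"])
        fix i assume i: "i \<in> ?I"
        define z where "z = (grad \<psi> sk i + int q * y i) div int m"
        have "to y i = grad \<psi> sk i + int q * y i - int m * z"
          using i by (simp add: to_def z_def minus_mult_div_eq_mod)
        then have "to y i - grad \<psi> sk i = int q * (y i - int r * z)"
          by (simp add: m_qr right_diff_distrib mult.assoc)
        then have "quo (to y) i = (y i - int r * z) mod int r"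
          using i q by (simp add: quo_def)
        also have "\<dots> = y i mod int r" by (simp add: mod_eq_dvd_iff)
        also have "\<dots> = y i" using y i by (auto simp: PiE_iff)
        finally show "quo (to y) i = y i" .
      qed (use y r in \<open>auto simp: quo_def\<close>)
    qed
    have back_cong: "(grad \<psi> sk i + int q * quo x i) mod int m = x i mod int m"
      if "potential q \<psi> sk x" "i \<in> ?I" for x i
    proof -
      have "int q dvd x i - grad \<psi> sk i" using that by (simp add: potential_def cong_iff_dvd_diff)
      then obtain z where z: "x i - grad \<psi> sk i = int q * z" by (elim dvdE)
      have "quo x i = z mod int r" using that(2) q by (simp add: quo_def z)
      then have quo: "int q * quo x i = (int q * z) mod int m"
        by (simp only: m_qr of_nat_mult mult_mod_right)
      have "x i = grad \<psi> sk i + int q * z" using z by simp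
      then show ?thesis unfolding quo by (simp only: mod_add_right_eq)
    qed
    show "\<forall>x\<in>?X. to (quo x) = x"
    proof
      fix x assume x: "x \<in> ?X"
      then have x_in: "x \<in> ?I \<rightarrow>\<^sub>E {0..<int m}" and px: "potential q \<psi> sk x"
        by (auto simp: solutions_def)
      show "to (quo x) = x"
      proof (rule PiE_ext[of _ ?I "\<lambda>_. {0..<int m}"])
        fix i assume i: "i \<in> ?I"
        then have "to (quo x) i = x i mod int m" using back_cong[OF px i] by (simp add: to_def)
        also have "\<dots> = x i" using x_in i by (auto simp: PiE_iff)
        finally show "to (quo x) i = x i" .
      qed (use x_in m in \<open>auto simp: to_def\<close>)
    qed
    show "to ` ?Y \<subseteq> ?X"
    proof
      fix x assume "x \<in> to ` ?Y"
      then obtain y where y: "y \<in> ?Y" "x = to y" by blast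
      have c: "[x i = grad \<psi> sk i + int q * y i] (mod int m)" if "i \<in> ?I" for i
        using that by (simp add: y(2) to_def cong_def)
      have "[x i = grad \<psi> sk i] (mod int q)" if "i \<in> ?I" for i
      proof -
        have "[x i = grad \<psi> sk i + int q * y i] (mod int q)"
          by (rule cong_dvd_modulus[OF c[OF that]]) (simp add: m_qr)
        then show ?thesis by (simp add: cong_def)
      qed
      moreover have "x \<in> ?I \<rightarrow>\<^sub>E {0..<int m}" using m by (auto simp: y(2) to_def)
      ultimately show "x \<in> ?X" using equiv[OF c] y(1) unfolding solutions_def potential_def by blast
    qed
    show "quo ` ?X \<subseteq> ?Y"
    proof
      fix y assume "y \<in> quo ` ?X"
      then obtain x where x: "x \<in> ?X" "y = quo x" by blast
      have c: "[x i = grad \<psi> sk i + int q * y i] (mod int m)" if "i \<in> ?I" for i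
        using back_cong[of x i] x that by (simp add: cong_def)
      have "y \<in> ?I \<rightarrow>\<^sub>E {0..<int r}" using r by (auto simp: x(2) quo_def)
      then show "y \<in> ?Y" using equiv[OF c] x(1) unfolding solutions_def by blast
    qed
  qed
  then have "card ?X = card ?Y" by (simp add: bij_betw_same_card)
  then show ?thesis using card_word_lin_solutions[OF r n on linked sum_t] by (simp add: r_def)
qed

text \<open>
  Count the pairs of a solution and a potential for it. A solution with a potential has exactly \<open>q\<close>
  of them, as the word is connected. A function \<open>\<psi>\<close> occurs only if the coloring \<open>b\<close> agrees modulo \<open>q\<close> with
  \<open>\<psi> \<circ> u - \<psi>\<close>, and then it belongs to the same number of solutions as any other.
\<close>

lemma card_solutions_with_potential:
  assumes m: "m > 0" and n: "n > 0" and on: "\<forall>s\<in>set sk. letter_on n s"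
    and linked: "linked n (edges_of sk)" and qm: "q dvd m" and diag: "\<forall>s\<in>set sk. int q dvd diag_label s"
    and total: "int m dvd (\<Sum>j\<in>{1..n}. b j) - diag_sum sk"
  shows "card {x \<in> solutions m n b sk. \<exists>\<psi>. potential q \<psi> sk x} * q * (m div q) ^ (n - 1) =
    (if \<forall>S\<in>cycle_supports n (word_perm sk). int q dvd color b S
     then q ^ card (cycle_supports n (word_perm sk)) * (m div q) ^ length (filter isl sk) else 0)"
proof -
  let ?S = "solutions m n b sk" and ?u = "word_perm sk"
  let ?\<Psi> = "{1..n} \<rightarrow>\<^sub>E {0..<int q}"
  let ?C = "{\<psi> \<in> ?\<Psi>. \<forall>x\<in>{1..n}. [\<psi> (?u x) - \<psi> x = b x] (mod int q)}"
  have q: "q > 0" using m qm by (auto intro: Nat.gr0I)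
  have fin: "finite ?\<Psi>" by (simp add: finite_PiE)
  have cocycle: "[\<psi> (?u j) - \<psi> j = b j] (mod int q)"
    if x: "x \<in> ?S" "potential q \<psi> sk x" and j: "j \<in> {1..n}" for x \<psi> j
  proof -
    have "[b j = word_color sk x j] (mod int q)"
    proof -
      have "[word_color sk x j = b j] (mod int m)" using x j by (simp add: solutions_def)
      moreover have "int q dvd int m" using qm by simp
      ultimately show ?thesis by (metis cong_sym cong_dvd_modulus)
    qed
    moreover have "[word_color sk x j = word_color sk (grad \<psi> sk) j] (mod int q)"
      by (rule word_color_cong) (use x in \<open>simp add: potential_def\<close>)
    moreover have "[word_color sk (grad \<psi> sk) j = \<psi> (?u j) - \<psi> j] (mod int q)"
      using dvd_word_color_zero[OF diag, of j]
      unfolding word_color_lin[of sk "grad \<psi> sk"] word_lin_grad by (simp add: cong_iff_dvd_diff)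
    ultimately show ?thesis by (meson cong_sym cong_trans)
  qed
  have "(\<Sum>\<psi>\<in>?\<Psi>. card {x \<in> ?S. potential q \<psi> sk x}) = (\<Sum>x\<in>?S. card {\<psi> \<in> ?\<Psi>. potential q \<psi> sk x})"
    by (rule sum_multicount_gen[OF fin]) simp_all
  also have "\<dots> = (\<Sum>x\<in>?S. if \<exists>\<psi>. potential q \<psi> sk x then q else 0)"
    using card_potentials[OF linked on n q] by simp
  also have "\<dots> = card {x \<in> ?S. \<exists>\<psi>. potential q \<psi> sk x} * q"
    by (simp flip: sum.inter_filter)
  finally have "card {x \<in> ?S. \<exists>\<psi>. potential q \<psi> sk x} * q * (m div q) ^ (n - 1) =
      (\<Sum>\<psi>\<in>?\<Psi>. card {x \<in> ?S. potential q \<psi> sk x} * (m div q) ^ (n - 1))"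
    by (simp only: sum_distrib_right[symmetric])
  also have "\<dots> = (\<Sum>\<psi>\<in>?\<Psi>. if \<forall>x\<in>{1..n}. [\<psi> (?u x) - \<psi> x = b x] (mod int q)
                          then (m div q) ^ length (filter isl sk) else 0)"
  proof (rule sum.cong[OF refl])
    fix \<psi>
    show "card {x \<in> ?S. potential q \<psi> sk x} * (m div q) ^ (n - 1) =
      (if \<forall>x\<in>{1..n}. [\<psi> (?u x) - \<psi> x = b x] (mod int q)
       then (m div q) ^ length (filter isl sk) else 0)"
    proof (cases "\<forall>x\<in>{1..n}. [\<psi> (?u x) - \<psi> x = b x] (mod int q)")
      case True
      then show ?thesis
        using card_solutions_over_potential[OF m n on linked qm diag _ total, of \<psi>] by simp
    next
      case False
      then have "{x \<in> ?S. potential q \<psi> sk x} = {}" using cocycle by blast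
      then show ?thesis using False by (simp only: card.empty if_False mult_0)
    qed
  qed
  also have "\<dots> = card ?C * (m div q) ^ length (filter isl sk)"
    using fin by (simp flip: sum.inter_filter)
  finally show ?thesis
    unfolding card_cocycles[OF word_perm_permutes[OF on] q] by simp
qed

section \<open>Moebius inversion over the divisors of \<open>p\<close>\<close>

lemma moebius_prime_mult:
  assumes "prime r" "\<not> r dvd q" "q > 0"
  shows "moebius (r * q) = - moebius q"
proof -
  have cop: "coprime r q" using assms prime_imp_coprime by blast
  have "squarefree (r * q) \<longleftrightarrow> squarefree q"
    using squarefree_mult_coprime[OF cop] squarefree_multD(2) squarefree_prime assms(1) by blast
  moreover have "prime_factors (r * q) = insert r (prime_factors q)"
    using assms by (simp add: prime_factors_product prime_prime_factors)
  moreover have "r \<notin> prime_factors q" using assms by auto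
  ultimately show ?thesis by (simp add: moebius_def)
qed

text \<open>
  For a prime \<open>r\<close> dividing \<open>D\<close>, multiplication by \<open>r\<close> is a bijection from the squarefree divisors
  prime to \<open>r\<close> to the squarefree divisors that are multiples of \<open>r\<close>, and it changes the sign.
\<close>

lemma sum_moebius_divisors:
  assumes "D > 0"
  shows "(\<Sum>q | q dvd D. moebius q) = of_bool (D = 1)"
proof (cases "D = 1")
  case True
  then show ?thesis by (simp add: moebius_def)
next
  case False
  then obtain r where r: "prime r" "r dvd D" by (meson prime_factor_nat)
  have fin: "finite {q. q dvd D}" using assms by simp
  define A where "A = {q. q dvd D \<and> squarefree q \<and> \<not> r dvd q}"
  have finA: "finite A" unfolding A_def by (rule finite_subset[OF _ fin]) auto
  have r0: "r > 0" using r by (simp add: prime_gt_0_nat)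
  have A0: "q > 0" if "q \<in> A" for q using that assms by (auto simp: A_def intro: Nat.gr0I)
  have disj: "A \<inter> (*) r ` A = {}" by (auto simp: A_def)
  have "(\<Sum>q | q dvd D. moebius q) = (\<Sum>q\<in>A \<union> (*) r ` A. moebius q)"
  proof (rule sum.mono_neutral_right[OF fin])
    have "r * q dvd D" if "q \<in> A" for q
    proof -
      have "coprime r q" using that r prime_imp_coprime unfolding A_def by blast
      then show ?thesis using that r by (auto simp: A_def intro: divides_mult)
    qed
    then show "A \<union> (*) r ` A \<subseteq> {q. q dvd D}" by (auto simp: A_def)
    show "\<forall>q\<in>{q. q dvd D} - (A \<union> (*) r ` A). moebius q = 0"
    proof
      fix q assume q: "q \<in> {q. q dvd D} - (A \<union> (*) r ` A)"
      have "\<not> squarefree q"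
      proof
        assume sf: "squarefree q"
        then have "r dvd q" using q by (auto simp: A_def)
        then obtain q' where q': "q = r * q'" by (elim dvdE)
        have "\<not> r dvd q'"
        proof
          assume "r dvd q'"
          then have "r\<^sup>2 dvd q" by (auto simp: q' power2_eq_square elim!: dvdE)
          then have "r dvd 1" using sf unfolding squarefree_def by blast
          then show False using r(1) by simp
        qed
        moreover have "squarefree q'" using sf q' squarefree_multD(2) by blast
        moreover have "q' dvd D" using q q' by (auto intro: dvd_mult_right)
        ultimately have "q' \<in> A" by (simp add: A_def)
        then show False using q q' by blast
      qed
      then show "moebius q = 0" by (simp add: moebius_def)
    qed
  qed
  also have "\<dots> = (\<Sum>q\<in>A. moebius q) + (\<Sum>q\<in>(*) r ` A. moebius q)"
    using finA disj by (intro sum.union_disjoint) auto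
  also have "(\<Sum>q\<in>(*) r ` A. moebius q) = (\<Sum>q\<in>A. moebius (r * q))"
    using r0 by (subst sum.reindex) (auto simp: inj_on_def)
  also have "\<dots> = (\<Sum>q\<in>A. - moebius q)"
    by (rule sum.cong[OF refl]) (use A0 r(1) in \<open>auto simp: A_def intro!: moebius_prime_mult\<close>)
  finally show ?thesis using False by (simp add: sum_negf)
qed

text \<open>
  This is \<open>J\<^sub>e(d) / d\<^sup>e\<close> for the Jordan totient function \<open>J\<^sub>e\<close>.
\<close>

definition moebius_zeta_sum :: "nat \<Rightarrow> nat \<Rightarrow> real" where
  "moebius_zeta_sum e d = (\<Sum>q | q dvd d. of_int (moebius q) / real q ^ e)"

text \<open>
  If the voltages have a potential modulo \<open>q\<close>, then conjugation by a diagonal matrix makes every edge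
  uncolored modulo \<open>q\<close>; for \<open>q\<close> dividing \<open>p\<close> the same holds for the diagonal letters. So if there are at least
  two points, a potential modulo some divisor \<open>q > 1\<close> of \<open>p\<close> keeps the letters from generating the whole group.
\<close>

definition nondegenerate :: "nat \<Rightarrow> letter list \<Rightarrow> (nat \<Rightarrow> int) \<Rightarrow> bool" where
  "nondegenerate p sk x \<longleftrightarrow> (\<forall>q \<psi>. q dvd p \<longrightarrow> potential q \<psi> sk x \<longrightarrow> q = 1)"

text \<open>
  The moduli for which given voltages have a potential are the divisors of a single number \<open>D\<close>, so the
  sum of \<open>\<mu>(q)\<close> over the moduli that divide \<open>p\<close> is \<open>1\<close> for nondegenerate voltages and \<open>0\<close> for the others.
  The voltages with a potential modulo a single \<open>q\<close> number \<open>m ^ (k - 1 + 2 * h) / q ^ (2 * h)\<close> if \<open>q\<close> divides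
  \<open>d\<close>, and there are none otherwise.
\<close>

theorem card_nondegenerate_solutions:
  fixes m p n h :: nat and b :: "nat \<Rightarrow> int" and sk :: "letter list"
  defines "k \<equiv> card (cycle_supports n (word_perm sk))"
    and "d \<equiv> nat (Gcd (insert (int p) (color b ` cycle_supports n (word_perm sk))))"
  assumes m: "m > 0" and n: "n > 0" and pm: "p dvd m" and on: "\<forall>s\<in>set sk. letter_on n s"
    and linked: "linked n (edges_of sk)" and diag: "\<forall>s\<in>set sk. int p dvd diag_label s"
    and total: "int m dvd (\<Sum>j\<in>{1..n}. b j) - diag_sum sk"
    and len: "length (filter isl sk) + 2 = n + k + 2 * h"
  shows "real (card {x \<in> solutions m n b sk. nondegenerate p sk x}) =
           real m ^ (k - 1 + 2 * h) * moebius_zeta_sum (2 * h) d"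
proof -
  let ?S = "solutions m n b sk"
  have p: "p > 0" using m pm by (auto intro: Nat.gr0I)
  have k: "k > 0"
    unfolding k_def using n by (auto simp: card_gt_0_iff cycle_supports_def)
  have d_iff: "q dvd d \<longleftrightarrow> q dvd p \<and> (\<forall>S\<in>cycle_supports n (word_perm sk). int q dvd color b S)" for q
  proof -
    have "q dvd d \<longleftrightarrow> int q dvd Gcd (insert (int p) (color b ` cycle_supports n (word_perm sk)))"
    proof -
      have "int d = Gcd (insert (int p) (color b ` cycle_supports n (word_perm sk)))"
        unfolding d_def by simp
      then show ?thesis by (metis int_dvd_int_iff)
    qed
    then show ?thesis by (auto simp: dvd_Gcd_iff)
  qed
  have count: "real (card {x \<in> ?S. \<exists>\<psi>. potential q \<psi> sk x}) =
      (if q dvd d then real m ^ (k - 1 + 2 * h) / real q ^ (2 * h) else 0)" if qp: "q dvd p" for q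
  proof -
    define r where "r = m div q"
    have qm: "q dvd m" using dvd_trans[OF qp pm] .
    then have m_qr: "m = q * r" by (simp add: r_def)
    have q: "q > 0" and r: "r > 0" using m m_qr by simp_all
    have "int q dvd int p" using qp by simp
    then have "\<forall>s\<in>set sk. int q dvd diag_label s" using diag dvd_trans by blast
    note N = card_solutions_with_potential[OF m n on linked qm this total, folded k_def r_def]
    show ?thesis
    proof (cases "q dvd d")
      case True
      let ?N = "card {x \<in> ?S. \<exists>\<psi>. potential q \<psi> sk x}"
      have e: "length (filter isl sk) = (n - 1) + (k - 1 + 2 * h)" "k = Suc (k - 1)"
        using len n k by linarith+
      have "?N * q * r ^ (n - 1) = q ^ k * r ^ length (filter isl sk)"
        using N True d_iff[of q] by simp
      also have "q ^ k = q * q ^ (k - 1)" using k by (simp add: power_eq_if)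
      also have "r ^ length (filter isl sk) = r ^ (n - 1) * r ^ (k - 1 + 2 * h)"
        unfolding e(1) power_add ..
      finally have "?N * q * r ^ (n - 1) = q * q ^ (k - 1) * (r ^ (n - 1) * r ^ (k - 1 + 2 * h))" .
      then have "q * r ^ (n - 1) * ?N = q * r ^ (n - 1) * (q ^ (k - 1) * r ^ (k - 1 + 2 * h))"
        by (simp only: mult_ac)
      then have "?N = q ^ (k - 1) * r ^ (k - 1 + 2 * h)" using q r by simp
      then have "?N * q ^ (2 * h) = m ^ (k - 1 + 2 * h)"
        unfolding m_qr power_mult_distrib power_add by (simp only: mult_ac)
      then have "real ?N * real q ^ (2 * h) = real m ^ (k - 1 + 2 * h)"
        unfolding of_nat_power[symmetric] of_nat_mult[symmetric] of_nat_eq_iff .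
      then show ?thesis using True q by (simp add: field_simps)
    next
      case False
      then have "card {x \<in> ?S. \<exists>\<psi>. potential q \<psi> sk x} * q * r ^ (n - 1) = 0"
        using N d_iff[of q] qp by auto
      then show ?thesis using False q r by simp
    qed
  qed
  have fin: "finite {q. q dvd p}" using p by simp
  have pointwise: "of_bool (nondegenerate p sk x) =
      (\<Sum>q | q dvd p. of_int (moebius q) * of_bool (\<exists>\<psi>. potential q \<psi> sk x) :: real)" for x
  proof -
    obtain D where D: "\<And>q. (\<exists>\<psi>. potential q \<psi> sk x) \<longleftrightarrow> q dvd D"
      using potential_exists_iff_dvd[OF linked on] by blast
    have "(\<Sum>q | q dvd p. of_int (moebius q) * of_bool (\<exists>\<psi>. potential q \<psi> sk x) :: real)
        = of_int (\<Sum>q | q dvd gcd p D. moebius q)"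
      unfolding D of_int_sum by (rule sum.mono_neutral_cong_right[OF fin]) auto
    also have "\<dots> = of_bool (gcd p D = 1)" using sum_moebius_divisors[of "gcd p D"] p by simp
    also have "gcd p D = 1 \<longleftrightarrow> nondegenerate p sk x"
    proof -
      have "nondegenerate p sk x \<longleftrightarrow> (\<forall>q. q dvd gcd p D \<longrightarrow> q = 1)"
        unfolding nondegenerate_def gcd_greatest_iff D[symmetric] by blast
      also have "\<dots> \<longleftrightarrow> gcd p D = 1"
      proof -
        have "(\<forall>q. q dvd g \<longrightarrow> q = 1) \<longleftrightarrow> g = 1" for g :: nat by auto
        then show ?thesis .
      qed
      finally show ?thesis by simp
    qed
    finally show ?thesis by simp
  qed
  have "real (card {x \<in> ?S. nondegenerate p sk x}) = (\<Sum>x\<in>?S. of_bool (nondegenerate p sk x))"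
    by (simp add: of_bool_def flip: sum.inter_filter)
  also have "\<dots> = (\<Sum>q | q dvd p. \<Sum>x\<in>?S. of_int (moebius q) * of_bool (\<exists>\<psi>. potential q \<psi> sk x))"
    unfolding pointwise by (rule sum.swap)
  also have "\<dots> = (\<Sum>q | q dvd p. of_int (moebius q) * real (card {x \<in> ?S. \<exists>\<psi>. potential q \<psi> sk x}))"
    unfolding sum_distrib_left[symmetric]
    by (simp add: of_bool_def flip: sum.inter_filter)
  also have "\<dots> = (\<Sum>q | q dvd p. if q dvd d then of_int (moebius q) * (real m ^ (k - 1 + 2 * h) / real q ^ (2 * h)) else 0)"
    by (rule sum.cong[OF refl]) (simp add: count)
  also have "\<dots> = (\<Sum>q | q dvd d. of_int (moebius q) * (real m ^ (k - 1 + 2 * h) / real q ^ (2 * h)))"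
    by (rule sum.mono_neutral_cong_right[OF fin]) (auto simp: d_iff)
  also have "\<dots> = real m ^ (k - 1 + 2 * h) * moebius_zeta_sum (2 * h) d"
    unfolding moebius_zeta_sum_def sum_distrib_left by (rule sum.cong) simp_all
  finally show ?thesis .
qed

text \<open>
  Apply the count of voltages with a potential to \<open>m = 2\<close> and the uncolored permutation. Voltages with
  a potential modulo \<open>2\<close> number \<open>2 ^ (k - 1)\<close> and are among the \<open>2 ^ (c - n + 1)\<close> solutions altogether,
  where \<open>c\<close> is the length and \<open>k\<close> the number of cycles. So \<open>k - 1 \<le> c - n + 1\<close>.
\<close>

lemma genus_nonnegative:
  assumes n: "n > 0" and on: "\<forall>s\<in>set sk. letter_on n s" and linked: "linked n (edges_of sk)"
    and edges: "\<forall>s\<in>set sk. isl s"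
  shows "n + card (cycle_supports n (word_perm sk)) \<le> length sk + 2"
proof -
  let ?S = "solutions 2 n (\<lambda>_. 0) sk" and ?k = "card (cycle_supports n (word_perm sk))"
  let ?N = "\<lambda>q. card {x \<in> ?S. \<exists>\<psi>. potential q \<psi> sk x}"
  have label: "diag_label s = 0" if "s \<in> set sk" for s
    using that edges by (cases s rule: letter_cases) auto
  then have diag: "\<forall>s\<in>set sk. int q dvd diag_label s" for q by simp
  have "map diag_label sk = map (\<lambda>_. 0) sk" using label by simp
  then have "diag_sum sk = 0" unfolding diag_sum_def by (simp only: sum_list_0)
  then have total: "int 2 dvd (\<Sum>j\<in>{1..n}. 0) - diag_sum sk" by simp
  have len: "length (filter isl sk) = length sk" using edges by simp
  have col: "color (\<lambda>_. 0) S = 0" for S by (simp add: color_def)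
  have k: "?k > 0" using n by (auto simp: card_gt_0_iff cycle_supports_def)
  have "?N 2 * 2 = 2 ^ ?k"
    using card_solutions_with_potential[OF _ n on linked _ diag total, of 2] by (simp add: col)
  moreover have "?N 1 * 2 ^ (n - 1) = 2 ^ length sk"
    using card_solutions_with_potential[OF _ n on linked _ diag total, of 1] by (simp add: col len)
  moreover have "?N 2 \<le> ?N 1"
  proof (rule card_mono)
    have "potential 1 \<psi> sk x" for \<psi> x by (simp add: potential_def)
    then show "{x \<in> ?S. \<exists>\<psi>. potential 2 \<psi> sk x} \<subseteq> {x \<in> ?S. \<exists>\<psi>. potential 1 \<psi> sk x}" by blast
  qed simp
  ultimately have "2 ^ ?k = ?N 2 * 2" "2 ^ length sk = ?N 1 * 2 ^ (n - 1)" "?N 2 \<le> ?N 1"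
    by simp_all
  then have "(2::nat) ^ ?k * 2 ^ (n - 1) \<le> 2 * 2 ^ length sk" by simp
  then have "(2::nat) ^ (?k + (n - 1)) \<le> 2 ^ (length sk + 1)" by (simp add: power_add)
  then have "?k + (n - 1) \<le> length sk + 1" by (rule power_le_imp_le_exp[rotated]) simp
  then show ?thesis using n by simp
qed

section \<open>Matrices \<open>[u;b]\<close>\<close>

lemma colored_perm_mat_carrier [simp]: "colored_perm_mat m n u b \<in> carrier_mat n n"
  by (simp add: colored_perm_mat_def)

lemma colored_perm_mat_index:
  "i < n \<Longrightarrow> j < n \<Longrightarrow> colored_perm_mat m n u b $$ (i, j) = (if Suc i = u (Suc j) then zeta m powi b (Suc j) else 0)"
  by (simp add: colored_perm_mat_def)

lemma permutes_Suc_index: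
  assumes "u permutes {1..n}" "j < n"
  obtains i where "i < n" "u (Suc j) = Suc i"
proof -
  have "u (Suc j) \<in> {1..n}" using permutes_in_image[OF assms(1)] assms(2) by simp
  then show ?thesis using that[of "u (Suc j) - 1"] by auto
qed

lemma colored_perm_mat_mult:
  assumes v: "v permutes {1..n}"
  shows "colored_perm_mat m n u b * colored_perm_mat m n v c = colored_perm_mat m n (u \<circ> v) (\<lambda>j. b (v j) + c j)"
proof (rule eq_matI)
  fix i j assume "i < dim_row (colored_perm_mat m n (u \<circ> v) (\<lambda>j. b (v j) + c j))"
    "j < dim_col (colored_perm_mat m n (u \<circ> v) (\<lambda>j. b (v j) + c j))"
  then have ij: "i < n" "j < n" by (simp_all add: colored_perm_mat_def)
  obtain k where k: "k < n" "v (Suc j) = Suc k" using permutes_Suc_index[OF v ij(2)] .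
  have "(colored_perm_mat m n u b * colored_perm_mat m n v c) $$ (i, j)
      = (\<Sum>l\<in>{0..<n}. colored_perm_mat m n u b $$ (i, l) * colored_perm_mat m n v c $$ (l, j))"
    using ij by (simp add: colored_perm_mat_def scalar_prod_def)
  also have "\<dots> = (\<Sum>l\<in>{0..<n}. if l = k then colored_perm_mat m n u b $$ (i, k) * zeta m powi c (Suc j) else 0)"
    by (rule sum.cong[OF refl]) (use ij k in \<open>simp add: colored_perm_mat_index\<close>)
  also have "\<dots> = colored_perm_mat m n u b $$ (i, k) * zeta m powi c (Suc j)" using k by simp
  also have "\<dots> = colored_perm_mat m n (u \<circ> v) (\<lambda>j. b (v j) + c j) $$ (i, j)"
    using ij k by (simp add: colored_perm_mat_index power_int_add zeta_nonzero)
  finally show "(colored_perm_mat m n u b * colored_perm_mat m n v c) $$ (i, j)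
      = colored_perm_mat m n (u \<circ> v) (\<lambda>j. b (v j) + c j) $$ (i, j)" .
qed (simp_all add: colored_perm_mat_def)

lemma zeta_powi_eq_iff:
  assumes "m > 0"
  shows "zeta m powi k = zeta m powi l \<longleftrightarrow> [k = l] (mod int m)"
proof -
  have "zeta m powi k = zeta m powi l \<longleftrightarrow> zeta m powi (k - l) = 1"
    using zeta_nonzero[of m] by (simp add: power_int_diff)
  then show ?thesis by (simp add: zeta_powi_eq_1_iff[OF assms] cong_iff_dvd_diff)
qed

lemma colored_perm_mat_cong:
  assumes "m > 0" "\<And>j. j \<in> {1..n} \<Longrightarrow> [b j = c j] (mod int m)"
  shows "colored_perm_mat m n u b = colored_perm_mat m n u c"
  by (rule eq_matI) (use assms in \<open>auto simp: colored_perm_mat_def zeta_powi_eq_iff\<close>)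

lemma colored_perm_mat_eq_iff:
  assumes m: "m > 0" and u: "u permutes {1..n}" and v: "v permutes {1..n}"
  shows "colored_perm_mat m n u b = colored_perm_mat m n v c \<longleftrightarrow>
           u = v \<and> (\<forall>j\<in>{1..n}. [b j = c j] (mod int m))"
proof
  assume eq: "colored_perm_mat m n u b = colored_perm_mat m n v c"
  have *: "u (Suc j) = v (Suc j) \<and> [b (Suc j) = c (Suc j)] (mod int m)" if j: "j < n" for j
  proof -
    obtain i where i: "i < n" "u (Suc j) = Suc i" using permutes_Suc_index[OF u j] .
    have "colored_perm_mat m n u b $$ (i, j) = colored_perm_mat m n v c $$ (i, j)" by (simp add: eq)
    then show ?thesis using i j m zeta_nonzero[of m]
      by (simp add: colored_perm_mat_index zeta_powi_eq_iff split: if_splits)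
  qed
  have "u x = v x" for x
  proof (cases "x \<in> {1..n}")
    case True
    then show ?thesis using *[of "x - 1"] by auto
  next
    case False
    then show ?thesis using permutes_not_in[OF u] permutes_not_in[OF v] by simp
  qed
  moreover have "[b j = c j] (mod int m)" if "j \<in> {1..n}" for j using *[of "j - 1"] that by auto
  ultimately show "u = v \<and> (\<forall>j\<in>{1..n}. [b j = c j] (mod int m))" by auto
next
  assume "u = v \<and> (\<forall>j\<in>{1..n}. [b j = c j] (mod int m))"
  then show "colored_perm_mat m n u b = colored_perm_mat m n v c"
    using colored_perm_mat_cong[OF m, of n b c] by simp
qed

lemma colored_perm_mat_one: "colored_perm_mat m n id (\<lambda>_. 0) = 1\<^sub>m n"
  by (rule eq_matI) (auto simp: colored_perm_mat_def)

lemma colored_perm_mat_inverse: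
  assumes u: "u permutes {1..n}"
  shows "colored_perm_mat m n u b * colored_perm_mat m n (inv' u) (\<lambda>j. - b (inv' u j)) = 1\<^sub>m n"
    and "colored_perm_mat m n (inv' u) (\<lambda>j. - b (inv' u j)) * colored_perm_mat m n u b = 1\<^sub>m n"
proof -
  have "u \<circ> inv' u = id" "inv' u \<circ> u = id" "inv' u (u j) = j" for j
    using permutes_inv_o[OF u] permutes_inverses[OF u] by simp_all
  then show "colored_perm_mat m n u b * colored_perm_mat m n (inv' u) (\<lambda>j. - b (inv' u j)) = 1\<^sub>m n"
    and "colored_perm_mat m n (inv' u) (\<lambda>j. - b (inv' u j)) * colored_perm_mat m n u b = 1\<^sub>m n"
    using colored_perm_mat_mult[OF permutes_inv[OF u]] colored_perm_mat_mult[OF u]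
    by (simp_all add: colored_perm_mat_one)
qed

lemma color_reindex:
  assumes "u permutes {1..n}"
  shows "(\<Sum>j\<in>{1..n}. f (u j)) = (\<Sum>j\<in>{1..n}. f j)"
  using sum.permute[OF assms, of f] by (simp add: comp_def)

lemma Gmpn_simps [simp]:
  "mult (Gmpn m p n) = (*)" "one (Gmpn m p n) = 1\<^sub>m n"
  by (simp_all add: Gmpn_def)

lemma colored_perm_mat_inverse_color:
  assumes u: "u permutes {1..n}"
  shows "color (\<lambda>j. - b (inv' u j)) {1..n} = - color b {1..n}"
  using color_reindex[OF permutes_inv[OF u], of b] by (simp add: color_def sum_negf)

lemma group_Gmpn:
  assumes mp: "m > 0" "p > 0" "p dvd m"
  shows "group (Gmpn m p n)"
proof (rule groupI)
  note mem = mem_Gmpn_iff[OF mp]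
  fix A B assume "A \<in> carrier (Gmpn m p n)" "B \<in> carrier (Gmpn m p n)"
  then obtain u b v c where AB: "u permutes {1..n}" "int p dvd color b {1..n}" "A = colored_perm_mat m n u b"
    "v permutes {1..n}" "int p dvd color c {1..n}" "B = colored_perm_mat m n v c"
    unfolding mem by blast
  have "color (\<lambda>j. b (v j) + c j) {1..n} = color b {1..n} + color c {1..n}"
    using color_reindex[OF AB(4), of b] by (simp add: color_def sum.distrib)
  then have "int p dvd color (\<lambda>j. b (v j) + c j) {1..n}" using AB by simp
  then show "A \<otimes>\<^bsub>Gmpn m p n\<^esub> B \<in> carrier (Gmpn m p n)"
    unfolding mem using AB colored_perm_mat_mult[OF AB(4)] permutes_compose[OF AB(4) AB(1)] by auto
next
  show "\<one>\<^bsub>Gmpn m p n\<^esub> \<in> carrier (Gmpn m p n)"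
    unfolding mem_Gmpn_iff[OF mp] Gmpn_simps colored_perm_mat_one[of m n, symmetric]
    using permutes_id by (force simp: color_def)
next
  fix A assume "A \<in> carrier (Gmpn m p n)"
  then obtain u b where A: "u permutes {1..n}" "int p dvd color b {1..n}" "A = colored_perm_mat m n u b"
    unfolding mem_Gmpn_iff[OF mp] by blast
  have "colored_perm_mat m n (inv' u) (\<lambda>j. - b (inv' u j)) \<in> carrier (Gmpn m p n)"
    using colored_perm_mat_in_Gmpn_iff[OF mp permutes_inv[OF A(1)]] A(2)
      colored_perm_mat_inverse_color[OF A(1)] by simp
  then show "\<exists>B\<in>carrier (Gmpn m p n). B \<otimes>\<^bsub>Gmpn m p n\<^esub> A = \<one>\<^bsub>Gmpn m p n\<^esub>"
    using colored_perm_mat_inverse(2)[OF A(1)] A(3) by auto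
  show "\<one>\<^bsub>Gmpn m p n\<^esub> \<otimes>\<^bsub>Gmpn m p n\<^esub> A = A"
    using A(3) by (simp add: left_mult_one_mat[of _ n n])
next
  fix A B C assume "A \<in> carrier (Gmpn m p n)" "B \<in> carrier (Gmpn m p n)" "C \<in> carrier (Gmpn m p n)"
  then have "A \<in> carrier_mat n n" "B \<in> carrier_mat n n" "C \<in> carrier_mat n n"
    unfolding mem_Gmpn_iff[OF mp] by auto
  then show "(A \<otimes>\<^bsub>Gmpn m p n\<^esub> B) \<otimes>\<^bsub>Gmpn m p n\<^esub> C = A \<otimes>\<^bsub>Gmpn m p n\<^esub> (B \<otimes>\<^bsub>Gmpn m p n\<^esub> C)"
    by (simp add: assoc_mult_mat[of A n n B n C n])
qed

lemma Gmpn_inv: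
  assumes mp: "m > 0" "p > 0" "p dvd m" and u: "u permutes {1..n}" and b: "int p dvd color b {1..n}"
  shows "inv\<^bsub>Gmpn m p n\<^esub> colored_perm_mat m n u b = colored_perm_mat m n (inv' u) (\<lambda>j. - b (inv' u j))"
proof -
  interpret group "Gmpn m p n" by (rule group_Gmpn[OF mp])
  show ?thesis
  proof (rule inv_equality)
    show "colored_perm_mat m n (inv' u) (\<lambda>j. - b (inv' u j)) \<otimes>\<^bsub>Gmpn m p n\<^esub> colored_perm_mat m n u b = \<one>\<^bsub>Gmpn m p n\<^esub>"
      using colored_perm_mat_inverse(2)[OF u] by simp
    show "colored_perm_mat m n u b \<in> carrier (Gmpn m p n)"
      using colored_perm_mat_in_Gmpn_iff[OF mp u] b by simp
    show "colored_perm_mat m n (inv' u) (\<lambda>j. - b (inv' u j)) \<in> carrier (Gmpn m p n)"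
      using colored_perm_mat_in_Gmpn_iff[OF mp permutes_inv[OF u]] b colored_perm_mat_inverse_color[OF u]
      by simp
  qed
qed

section \<open>Classification of the reflections\<close>

lemma cnj_zeta_powi: "cnj (zeta m powi k) = zeta m powi (- k)"
  by (simp add: zeta_powi cis_cnj)

lemma unitary_colored_perm_mat:
  assumes u: "u permutes {1..n}"
  shows "unitary_mat n (colored_perm_mat m n u b)"
proof -
  let ?A = "colored_perm_mat m n u b"
  have "mat_adjoint ?A = colored_perm_mat m n (inv' u) (\<lambda>j. - b (inv' u j))"
  proof (rule eq_matI)
    fix i j assume "i < dim_row (colored_perm_mat m n (inv' u) (\<lambda>j. - b (inv' u j)))"
      "j < dim_col (colored_perm_mat m n (inv' u) (\<lambda>j. - b (inv' u j)))"
    then have ij: "i < n" "j < n" by (simp_all add: colored_perm_mat_def)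
    have "mat_adjoint ?A $$ (i, j) = cnj (?A $$ (j, i))"
      using ij by (simp add: mat_adjoint_def mat_of_rows_index colored_perm_mat_def)
    moreover have "cnj (?A $$ (j, i)) = colored_perm_mat m n (inv' u) (\<lambda>j. - b (inv' u j)) $$ (i, j)"
    proof (cases "Suc j = u (Suc i)")
      case True
      then have "inv' u (Suc j) = Suc i" by (simp add: permutes_inverses[OF u])
      then have "colored_perm_mat m n (inv' u) (\<lambda>j. - b (inv' u j)) $$ (i, j) = zeta m powi (- b (Suc i))"
        using ij by (simp add: colored_perm_mat_index)
      moreover have "?A $$ (j, i) = zeta m powi b (Suc i)"
        using True ij by (simp add: colored_perm_mat_index)
      ultimately show ?thesis by (simp only: cnj_zeta_powi)
    next
      case False
      then have "Suc i \<noteq> inv' u (Suc j)" using permutes_inverses(1)[OF u, of "Suc j"] by auto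
      then show ?thesis using False ij by (simp add: colored_perm_mat_index)
    qed
    ultimately show "mat_adjoint ?A $$ (i, j) = colored_perm_mat m n (inv' u) (\<lambda>j. - b (inv' u j)) $$ (i, j)"
      by simp
  qed (simp_all add: mat_adjoint_def colored_perm_mat_def)
  then show ?thesis
    unfolding unitary_mat_def using colored_perm_mat_inverse(1)[OF u, of m b] by simp
qed

lemma colored_perm_mat_mult_vec:
  assumes u: "u permutes {1..n}" and x: "x \<in> carrier_vec n" and j: "j < n" and i: "u (Suc j) = Suc i"
  shows "(colored_perm_mat m n u b *\<^sub>v x) $ i = zeta m powi b (Suc j) * x $ j"
proof -
  have i_n: "i < n" using permutes_in_image[OF u, of "Suc j"] j i by simp
  have uniq: "Suc i = u (Suc l) \<longleftrightarrow> l = j" for l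
    using i permutes_inj[OF u] by (metis injD nat.inject)
  have "(colored_perm_mat m n u b *\<^sub>v x) $ i = (\<Sum>l\<in>{0..<n}. colored_perm_mat m n u b $$ (i, l) * x $ l)"
    using i_n x by (simp add: scalar_prod_def colored_perm_mat_def)
  also have "\<dots> = (\<Sum>l\<in>{0..<n}. if l = j then zeta m powi b (Suc j) * x $ j else 0)"
    by (rule sum.cong[OF refl]) (use i_n uniq in \<open>simp add: colored_perm_mat_index\<close>)
  also have "\<dots> = zeta m powi b (Suc j) * x $ j" using j by simp
  finally show ?thesis .
qed

lemma colored_perm_mat_fixes_iff:
  assumes u: "u permutes {1..n}" and x: "x \<in> carrier_vec n"
  shows "colored_perm_mat m n u b *\<^sub>v x = x \<longleftrightarrow>
    (\<forall>j<n. \<forall>i. u (Suc j) = Suc i \<longrightarrow> x $ i = zeta m powi b (Suc j) * x $ j)"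
proof
  assume "colored_perm_mat m n u b *\<^sub>v x = x"
  then show "\<forall>j<n. \<forall>i. u (Suc j) = Suc i \<longrightarrow> x $ i = zeta m powi b (Suc j) * x $ j"
    using colored_perm_mat_mult_vec[OF u x] by metis
next
  assume r: "\<forall>j<n. \<forall>i. u (Suc j) = Suc i \<longrightarrow> x $ i = zeta m powi b (Suc j) * x $ j"
  show "colored_perm_mat m n u b *\<^sub>v x = x"
  proof (rule eq_vecI)
    fix i assume i: "i < dim_vec x"
    then obtain j where j: "j < n" "inv' u (Suc i) = Suc j"
      using permutes_Suc_index[OF permutes_inv[OF u], of i] x by auto
    then have "u (Suc j) = Suc i" using permutes_inverses(1)[OF u] by metis
    then show "(colored_perm_mat m n u b *\<^sub>v x) $ i = x $ i"
      using colored_perm_mat_mult_vec[OF u x j(1)] r j(1) by metis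
  qed (use x in \<open>simp add: colored_perm_mat_def\<close>)
qed

text \<open>
  The coordinates are numbered from \<open>1\<close> here, so that \<open>u\<close> and \<open>b\<close> act on them directly.
\<close>

lemma reflection_iff_functional:
  assumes u: "u permutes {1..n}"
  shows "reflection n (colored_perm_mat m n u b) \<longleftrightarrow>
    (\<exists>\<gamma>. (\<exists>j\<in>{1..n}. \<gamma> j \<noteq> 0) \<and>
       (\<forall>x. (\<forall>j\<in>{1..n}. x (u j) = zeta m powi b j * x j) \<longleftrightarrow> (\<Sum>j\<in>{1..n}. \<gamma> j * x j) = 0))"
    (is "_ \<longleftrightarrow> (\<exists>\<gamma>. ?nz \<gamma> \<and> (\<forall>x. ?fix x \<longleftrightarrow> ?sum \<gamma> x = 0))")
proof -
  let ?A = "colored_perm_mat m n u b"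
  define tv where "tv x = vec n (\<lambda>i. x (Suc i))" for x :: "nat \<Rightarrow> complex"
  define fv where "fv v j = v $ (j - 1)" for v :: "complex vec" and j
  have tv_carrier [simp]: "tv x \<in> carrier_vec n" for x by (simp add: tv_def)
  have tv_fv: "tv (fv v) = v" if "v \<in> carrier_vec n" for v
    using that by (intro eq_vecI) (auto simp: tv_def fv_def)
  have fixes_iff: "?A *\<^sub>v tv x = tv x \<longleftrightarrow> ?fix x" for x
  proof -
    have "(\<forall>j<n. \<forall>i. u (Suc j) = Suc i \<longrightarrow> tv x $ i = zeta m powi b (Suc j) * tv x $ j) \<longleftrightarrow> ?fix x"
    proof
      assume l: "\<forall>j<n. \<forall>i. u (Suc j) = Suc i \<longrightarrow> tv x $ i = zeta m powi b (Suc j) * tv x $ j"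
      show "?fix x"
      proof
        fix j assume j: "j \<in> {1..n}"
        then have j': "j - 1 < n" "Suc (j - 1) = j" by auto
        obtain i where i: "i < n" "u (Suc (j - 1)) = Suc i" using permutes_Suc_index[OF u j'(1)] .
        have "tv x $ i = zeta m powi b (Suc (j - 1)) * tv x $ (j - 1)" using l j'(1) i(2) by blast
        then show "x (u j) = zeta m powi b j * x j" using i j' by (simp add: tv_def)
      qed
    next
      assume r: "?fix x"
      show "\<forall>j<n. \<forall>i. u (Suc j) = Suc i \<longrightarrow> tv x $ i = zeta m powi b (Suc j) * tv x $ j"
      proof (intro allI impI)
        fix j i assume ji: "j < n" "u (Suc j) = Suc i"
        have "i < n" using permutes_in_image[OF u, of "Suc j"] ji by simp
        moreover have "Suc j \<in> {1..n}" using ji by simp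
        moreover from this have "x (u (Suc j)) = zeta m powi b (Suc j) * x (Suc j)" using r by blast
        ultimately show "tv x $ i = zeta m powi b (Suc j) * tv x $ j"
          using ji by (simp add: tv_def)
      qed
    qed
    then show ?thesis using colored_perm_mat_fixes_iff[OF u tv_carrier] by simp
  qed
  have scalar: "tv \<gamma> \<bullet> tv x = ?sum \<gamma> x" for \<gamma> x
  proof -
    have "tv \<gamma> \<bullet> tv x = (\<Sum>i\<in>{0..<n}. \<gamma> (Suc i) * x (Suc i))"
      by (simp add: scalar_prod_def tv_def)
    also have "\<dots> = ?sum \<gamma> x"
      by (simp add: sum.atLeast1_atMost_eq atLeast0LessThan One_nat_def)
    finally show ?thesis .
  qed
  have tv_zero: "tv \<gamma> \<noteq> 0\<^sub>v n \<longleftrightarrow> ?nz \<gamma>" for \<gamma>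
  proof -
    have "tv \<gamma> = 0\<^sub>v n \<longleftrightarrow> (\<forall>i<n. \<gamma> (Suc i) = 0)"
      by (auto simp: tv_def vec_eq_iff)
    also have "\<dots> \<longleftrightarrow> (\<forall>j\<in>{1..n}. \<gamma> j = 0)"
    proof
      assume a: "\<forall>i<n. \<gamma> (Suc i) = 0"
      show "\<forall>j\<in>{1..n}. \<gamma> j = 0"
      proof
        fix j assume "j \<in> {1..n}"
        then have "j - 1 < n" "Suc (j - 1) = j" by auto
        then show "\<gamma> j = 0" using a by metis
      qed
    qed simp
    finally show ?thesis by blast
  qed
  have "hyperplane n {v \<in> carrier_vec n. ?A *\<^sub>v v = v} \<longleftrightarrow>
      (\<exists>\<gamma>. ?nz \<gamma> \<and> (\<forall>x. ?fix x \<longleftrightarrow> ?sum \<gamma> x = 0))"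
  proof
    assume "hyperplane n {v \<in> carrier_vec n. ?A *\<^sub>v v = v}"
    then obtain c where c: "c \<in> carrier_vec n" "c \<noteq> 0\<^sub>v n"
      "{v \<in> carrier_vec n. ?A *\<^sub>v v = v} = {v \<in> carrier_vec n. c \<bullet> v = 0}"
      unfolding hyperplane_def by blast
    have "?nz (fv c)" using tv_zero[of "fv c"] tv_fv[OF c(1)] c(2) by simp
    moreover have "?fix x \<longleftrightarrow> ?sum (fv c) x = 0" for x
    proof -
      have "?A *\<^sub>v tv x = tv x \<longleftrightarrow> c \<bullet> tv x = 0" using c(3) tv_carrier by blast
      then show ?thesis using fixes_iff scalar[of "fv c" x] tv_fv[OF c(1)] by simp
    qed
    ultimately show "\<exists>\<gamma>. ?nz \<gamma> \<and> (\<forall>x. ?fix x \<longleftrightarrow> ?sum \<gamma> x = 0)" by blast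
  next
    assume "\<exists>\<gamma>. ?nz \<gamma> \<and> (\<forall>x. ?fix x \<longleftrightarrow> ?sum \<gamma> x = 0)"
    then obtain \<gamma> where g: "?nz \<gamma>" "\<And>x. ?fix x \<longleftrightarrow> ?sum \<gamma> x = 0" by blast
    have "?A *\<^sub>v v = v \<longleftrightarrow> tv \<gamma> \<bullet> v = 0" if v: "v \<in> carrier_vec n" for v
      using g(2)[of "fv v"] fixes_iff[of "fv v"] scalar[of \<gamma> "fv v"] tv_fv[OF v] by simp
    then have "{v \<in> carrier_vec n. ?A *\<^sub>v v = v} = {v \<in> carrier_vec n. tv \<gamma> \<bullet> v = 0}" by blast
    then show "hyperplane n {v \<in> carrier_vec n. ?A *\<^sub>v v = v}"
      unfolding hyperplane_def using tv_zero[of \<gamma>] g(1) tv_carrier by blast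
  qed
  then show ?thesis unfolding reflection_def using unitary_colored_perm_mat[OF u] by simp
qed

lemma edge_letter_reflection:
  assumes vw: "letter_on n (Inl (v, w))"
  shows "reflection n (colored_perm_mat m n (letter_perm (Inl (v, w))) (letter_color (Inl (v, w)) y))"
proof -
  have v: "v \<in> {1..n}" "w \<in> {1..n}" "v \<noteq> w" using vw by auto
  define \<gamma> :: "nat \<Rightarrow> complex" where "\<gamma> j = (if j = v then zeta m powi y else if j = w then - 1 else 0)" for j
  have sum: "(\<Sum>j\<in>{1..n}. \<gamma> j * x j) = zeta m powi y * x v - x w" for x
  proof -
    have "(\<Sum>j\<in>{1..n}. \<gamma> j * x j) = (\<Sum>j\<in>{1..n}. (if j = v then zeta m powi y * x v else 0) + (if j = w then - x w else 0))"
      by (rule sum.cong[OF refl]) (use v(3) in \<open>simp add: \<gamma>_def\<close>)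
    then show ?thesis using v by (simp add: sum.distrib)
  qed
  have "(\<forall>j\<in>{1..n}. x (letter_perm (Inl (v, w)) j) = zeta m powi letter_color (Inl (v, w)) y j * x j)
      \<longleftrightarrow> zeta m powi y * x v - x w = 0" (is "?l \<longleftrightarrow> ?r") for x
  proof
    assume ?l
    then have "x (letter_perm (Inl (v, w)) v) = zeta m powi letter_color (Inl (v, w)) y v * x v" using v(1) by blast
    then show ?r by simp
  next
    assume ?r
    then have xw: "x w = zeta m powi y * x v" by simp
    have "zeta m powi (- y) * zeta m powi y = 1"
      by (simp add: power_int_add[symmetric] zeta_nonzero)
    then have "x v = zeta m powi (- y) * x w" unfolding xw by (simp add: mult.assoc[symmetric])
    then show ?l using xw v(3) by (auto simp: transpose_def)
  qed
  moreover have "\<exists>j\<in>{1..n}. \<gamma> j \<noteq> 0" using v zeta_nonzero[of m] by (intro bexI[of _ v]) (simp_all add: \<gamma>_def)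
  ultimately show ?thesis
    unfolding reflection_iff_functional[OF letter_perm_permutes[OF vw]] sum[symmetric] by blast
qed

lemma diag_letter_reflection:
  assumes m: "m > 0" and i: "i \<in> {1..n}" and e: "\<not> int m dvd e"
  shows "reflection n (colored_perm_mat m n (letter_perm (Inr (i, e))) (letter_color (Inr (i, e)) y))"
proof -
  have ne: "zeta m powi e \<noteq> 1" using e zeta_powi_eq_1_iff[OF m] by simp
  have sum: "(\<Sum>j\<in>{1..n}. of_bool (j = i) * x j) = x i" for x :: "nat \<Rightarrow> complex"
  proof -
    have "(\<Sum>j\<in>{1..n}. of_bool (j = i) * x j) = (\<Sum>j\<in>{1..n}. if j = i then x i else 0)"
      by (rule sum.cong) auto
    then show ?thesis using i by simp
  qed
  have "(\<forall>j\<in>{1..n}. x (letter_perm (Inr (i, e)) j) = zeta m powi letter_color (Inr (i, e)) y j * x j)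
      \<longleftrightarrow> x i = 0" (is "?l \<longleftrightarrow> ?r") for x
  proof
    assume ?l
    then have "x (letter_perm (Inr (i, e)) i) = zeta m powi letter_color (Inr (i, e)) y i * x i" using i by blast
    then have "(zeta m powi e - 1) * x i = 0" by (simp add: left_diff_distrib)
    then show ?r using ne by simp
  qed auto
  then show ?thesis
    unfolding reflection_iff_functional[OF letter_perm_permutes[of n "Inr (i, e)", unfolded letter_on.simps, OF i]]
    using i by (intro exI[of _ "\<lambda>j. of_bool (j = i)"]) (auto simp: sum)
qed

text \<open>
  Let \<open>\<gamma>\<close> be a normal functional of the fixed hyperplane with \<open>\<gamma> i \<noteq> 0\<close>. The vectors with entries
  \<open>\<gamma> i\<close> at \<open>l\<close> and \<open>- \<gamma> l\<close> at \<open>i\<close> lie in the hyperplane, so they are fixed. If \<open>u i = i\<close>, this forces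
  \<open>\<gamma>\<close> to vanish off \<open>i\<close>, and the matrix is diagonal with one nontrivial entry. Otherwise \<open>\<gamma>\<close>
  vanishes off \<open>i\<close> and \<open>u i\<close>, every other point is fixed with trivial color, and \<open>u\<close> exchanges \<open>i\<close> and \<open>u i\<close>.
\<close>

lemma reflection_cases:
  assumes m: "m > 0" and u: "u permutes {1..n}" and r: "reflection n (colored_perm_mat m n u b)"
  obtains (edge) v w where "letter_on n (Inl (v, w))" "u = letter_perm (Inl (v, w))"
      "\<forall>j\<in>{1..n}. [b j = letter_color (Inl (v, w)) (b v) j] (mod int m)"
  | (diag) i where "i \<in> {1..n}" "u = id" "\<not> int m dvd b i"
      "\<forall>j\<in>{1..n}. [b j = letter_color (Inr (i, b i)) 0 j] (mod int m)"
proof -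
  obtain \<gamma> i where i: "i \<in> {1..n}" "\<gamma> i \<noteq> 0"
    and fix_iff: "\<And>x. (\<forall>j\<in>{1..n}. x (u j) = zeta m powi b j * x j) \<longleftrightarrow> (\<Sum>j\<in>{1..n}. \<gamma> j * x j) = 0"
    using r unfolding reflection_iff_functional[OF u] by blast
  define probe where "probe l j = (if j = l then \<gamma> i else if j = i then - \<gamma> l else 0)" for l j
  have probe: "probe l (u j) = zeta m powi b j * probe l j" if l: "l \<in> {1..n}" "l \<noteq> i" and j: "j \<in> {1..n}" for l j
  proof -
    have "(\<Sum>j\<in>{1..n}. \<gamma> j * probe l j) = (\<Sum>j\<in>{1..n}. (if j = l then \<gamma> l * \<gamma> i else 0) + (if j = i then - (\<gamma> i * \<gamma> l) else 0))"
      by (rule sum.cong[OF refl]) (use l in \<open>simp add: probe_def\<close>)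
    also have "\<dots> = 0" using l i by (simp add: sum.distrib)
    finally show ?thesis using fix_iff[of "probe l"] j by blast
  qed
  have trivial: "u l = l \<and> int m dvd b l" if l: "l \<in> {1..n}" "l \<noteq> i" "\<gamma> l = 0" for l
  proof -
    have ne: "probe l (u l) \<noteq> 0"
      unfolding probe[OF l(1,2,1)] using i zeta_nonzero[of m] by (simp add: probe_def)
    then have ul: "u l = l" using l(3) by (auto simp: probe_def split: if_splits)
    then have "zeta m powi b l = 1" using probe[OF l(1,2,1)] i by (simp add: probe_def)
    then show ?thesis using ul zeta_powi_eq_1_iff[OF m] by simp
  qed
  have inj: "u a = u c \<longleftrightarrow> a = c" for a c using permutes_inj[OF u] by (simp add: inj_eq)
  show thesis
  proof (cases "u i = i")
    case True
    have ne: "zeta m powi b i \<noteq> 1"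
    proof
      assume one: "zeta m powi b i = 1"
      have "u j = i \<longleftrightarrow> j = i" for j using inj[of j i] True by simp
      then have "\<forall>j\<in>{1..n}. of_bool (u j = i) = zeta m powi b j * (of_bool (j = i) :: complex)"
        using one by simp
      then have "(\<Sum>j\<in>{1..n}. \<gamma> j * of_bool (j = i)) = 0" using fix_iff[of "\<lambda>j. of_bool (j = i)"] by blast
      moreover have "(\<Sum>j\<in>{1..n}. \<gamma> j * of_bool (j = i)) = (\<Sum>j\<in>{1..n}. if j = i then \<gamma> i else 0)"
        by (rule sum.cong) auto
      ultimately show False using i by simp
    qed
    have zero: "\<gamma> l = 0" if l: "l \<in> {1..n}" "l \<noteq> i" for l
    proof -
      have "(zeta m powi b i - 1) * \<gamma> l = 0"
        using probe[OF l i(1)] True l by (simp add: probe_def left_diff_distrib)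
      then show ?thesis using ne by simp
    qed
    have "u j = j" for j
    proof (cases "j \<in> {1..n}")
      case True
      then show ?thesis using trivial zero \<open>u i = i\<close> by (cases "j = i") auto
    next
      case False
      then show ?thesis using permutes_not_in[OF u] by simp
    qed
    then have "u = id" by (simp add: fun_eq_iff)
    moreover have "\<forall>j\<in>{1..n}. [b j = letter_color (Inr (i, b i)) 0 j] (mod int m)"
      using trivial zero by (simp add: cong_0_iff)
    moreover have "\<not> int m dvd b i" using ne zeta_powi_eq_1_iff[OF m] by simp
    ultimately show thesis using diag[of i] i(1) by blast
  next
    case False
    define w where "w = u i"
    have w: "w \<in> {1..n}" "w \<noteq> i" using i(1) permutes_in_image[OF u, of i] False by (simp_all add: w_def)
    have zero: "\<gamma> l = 0" if l: "l \<in> {1..n}" "l \<noteq> i" "l \<noteq> w" for l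
      using probe[OF l(1,2) i(1)] l w zeta_nonzero[of m] by (simp add: probe_def flip: w_def)
    have fixed: "u j = j" if "j \<noteq> i" "j \<noteq> w" for j
    proof (cases "j \<in> {1..n}")
      case True
      then show ?thesis using trivial zero that by blast
    next
      case False
      then show ?thesis using permutes_not_in[OF u] by simp
    qed
    have uw: "u w = i"
    proof (rule ccontr)
      assume "u w \<noteq> i"
      moreover have "u w \<noteq> w" using inj[of w i] w by (simp add: w_def)
      ultimately have "u (u w) = u w" using fixed by blast
      then show False using inj[of "u w" w] \<open>u w \<noteq> w\<close> by simp
    qed
    have u_eq: "u = Transposition.transpose i w"
      using fixed uw by (auto simp: fun_eq_iff transpose_def w_def)
    have g: "\<gamma> i = - (zeta m powi b i * \<gamma> w)" "- \<gamma> w = zeta m powi b w * \<gamma> i"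
      using probe[OF w i(1)] probe[OF w w(1)] uw w(2) by (simp_all add: probe_def flip: w_def)
    have "zeta m powi (b i + b w) = zeta m powi b i * zeta m powi b w"
      by (simp add: power_int_add zeta_nonzero)
    then have "zeta m powi (b i + b w) * \<gamma> i = zeta m powi b i * (zeta m powi b w * \<gamma> i)"
      by (simp add: mult.assoc)
    also have "\<dots> = \<gamma> i" unfolding g(2)[symmetric] using g(1) by simp
    finally have "zeta m powi (b i + b w) = 1" using i(2) by simp
    then have biw: "int m dvd b i + b w" using zeta_powi_eq_1_iff[OF m] by simp
    have triv: "int m dvd b j" if "j \<in> {1..n}" "j \<noteq> i" "j \<noteq> w" for j
      using trivial zero that by blast
    have "\<forall>j\<in>{1..n}. [b j = letter_color (Inl (i, w)) (b i) j] (mod int m)"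
      "\<forall>j\<in>{1..n}. [b j = letter_color (Inl (w, i)) (b w) j] (mod int m)"
      using triv biw by (auto simp: cong_iff_dvd_diff add.commute)
    moreover have "u = letter_perm (Inl (i, w))" "u = letter_perm (Inl (w, i))"
      by (simp_all add: u_eq transpose_commute)
    moreover have "i < w \<or> w < i" using w(2) by auto
    ultimately show thesis using edge[of i w] edge[of w i] i(1) w(1) by auto
  qed
qed

section \<open>Subgroups that contain the letters of a connected word\<close>

text \<open>
  A subgroup of \<open>G(m,1,n)\<close>, given by the pairs \<open>[u;b]\<close> that represent its elements.
\<close>

definition colored_subgroup :: "nat \<Rightarrow> nat \<Rightarrow> ((nat \<Rightarrow> nat) \<Rightarrow> (nat \<Rightarrow> int) \<Rightarrow> bool) \<Rightarrow> bool" where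
  "colored_subgroup m n P \<longleftrightarrow>
     P id (\<lambda>_. 0) \<and>
     (\<forall>u v b c. u permutes {1..n} \<longrightarrow> v permutes {1..n} \<longrightarrow> P u b \<longrightarrow> P v c \<longrightarrow>
        P (u \<circ> v) (\<lambda>j. b (v j) + c j)) \<and>
     (\<forall>u b. u permutes {1..n} \<longrightarrow> P u b \<longrightarrow> P (inv' u) (\<lambda>j. - b (inv' u j))) \<and>
     (\<forall>u b c. P u b \<longrightarrow> (\<forall>j\<in>{1..n}. [b j = c j] (mod int m)) \<longrightarrow> P u c)"

lemma colored_subgroup_one: "colored_subgroup m n P \<Longrightarrow> P id (\<lambda>_. 0)"
  by (simp add: colored_subgroup_def)

lemma colored_subgroup_mult:
  "colored_subgroup m n P \<Longrightarrow> u permutes {1..n} \<Longrightarrow> v permutes {1..n} \<Longrightarrow> P u b \<Longrightarrow> P v c \<Longrightarrow>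
     P (u \<circ> v) (\<lambda>j. b (v j) + c j)"
  by (simp add: colored_subgroup_def)

lemma colored_subgroup_inv:
  "colored_subgroup m n P \<Longrightarrow> u permutes {1..n} \<Longrightarrow> P u b \<Longrightarrow> P (inv' u) (\<lambda>j. - b (inv' u j))"
  by (simp add: colored_subgroup_def)

lemma colored_subgroup_cong:
  "colored_subgroup m n P \<Longrightarrow> P u b \<Longrightarrow> (\<And>j. j \<in> {1..n} \<Longrightarrow> [b j = c j] (mod int m)) \<Longrightarrow> P u c"
  unfolding colored_subgroup_def by blast

text \<open>
  The new predicate describes the conjugate of the subgroup by the diagonal matrix with exponents \<open>\<psi>\<close>.
\<close>

lemma colored_subgroup_gauge:
  assumes P: "colored_subgroup m n P"
  shows "colored_subgroup m n (\<lambda>u b. P u (\<lambda>j. b j + (\<psi> (u j) - \<psi> j)))"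
  unfolding colored_subgroup_def
proof (intro conjI allI impI)
  show "P id (\<lambda>j. 0 + (\<psi> (id j) - \<psi> j))" using colored_subgroup_one[OF P] by simp
next
  fix u v :: "nat \<Rightarrow> nat" and b c
  assume "u permutes {1..n}" "v permutes {1..n}" "P u (\<lambda>j. b j + (\<psi> (u j) - \<psi> j))" "P v (\<lambda>j. c j + (\<psi> (v j) - \<psi> j))"
  from colored_subgroup_mult[OF P, OF this]
  show "P (u \<circ> v) (\<lambda>j. b (v j) + c j + (\<psi> ((u \<circ> v) j) - \<psi> j))"
    by (rule colored_subgroup_cong[OF P]) (simp add: algebra_simps)
next
  fix u :: "nat \<Rightarrow> nat" and b
  assume u: "u permutes {1..n}" and "P u (\<lambda>j. b j + (\<psi> (u j) - \<psi> j))"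
  from colored_subgroup_inv[OF P, OF this]
  show "P (inv' u) (\<lambda>j. - b (inv' u j) + (\<psi> (inv' u j) - \<psi> j))"
    by (rule colored_subgroup_cong[OF P]) (simp add: permutes_inverses[OF u])
next
  fix u :: "nat \<Rightarrow> nat" and b c
  assume b: "P u (\<lambda>j. b j + (\<psi> (u j) - \<psi> j))" and bc: "\<forall>j\<in>{1..n}. [b j = c j] (mod int m)"
  show "P u (\<lambda>j. c j + (\<psi> (u j) - \<psi> j))"
    by (rule colored_subgroup_cong[OF P, OF b]) (use bc in \<open>auto intro: cong_add\<close>)
qed

definition unit_diff :: "nat \<Rightarrow> nat \<Rightarrow> int \<Rightarrow> nat \<Rightarrow> int" where
  "unit_diff v w s j = s * (of_bool (j = v) - of_bool (j = w))"

lemma unit_diff_zero: "unit_diff v w 0 = (\<lambda>_. 0)"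
  by (simp add: unit_diff_def fun_eq_iff)

lemma letter_color_edge: "v \<noteq> w \<Longrightarrow> letter_color (Inl (v, w)) y = unit_diff v w y"
  by (auto simp: unit_diff_def)

lemma colored_subgroup_conjugate_diagonal:
  assumes P: "colored_subgroup m n P" and perms: "\<And>u. u permutes {1..n} \<Longrightarrow> P u (\<lambda>_. 0)"
    and b: "P id b" and s: "\<sigma> permutes {1..n}"
  shows "P id (\<lambda>j. b (\<sigma> j))"
proof -
  have "P (id \<circ> \<sigma>) (\<lambda>j. b (\<sigma> j) + 0)"
    by (rule colored_subgroup_mult[OF P, OF permutes_id s b perms[OF s]])
  then have 1: "P \<sigma> (\<lambda>j. b (\<sigma> j))" by simp
  have "P (inv' \<sigma> \<circ> \<sigma>) (\<lambda>j. 0 + b (\<sigma> j))"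
    by (rule colored_subgroup_mult[OF P, OF permutes_inv[OF s] s perms[OF permutes_inv[OF s]] 1])
  then show ?thesis by (simp add: permutes_inv_o[OF s])
qed

lemma colored_subgroup_diagonal_add:
  assumes P: "colored_subgroup m n P" and "P id b" "P id c"
  shows "P id (\<lambda>j. b j + c j)"
  using colored_subgroup_mult[OF P, OF permutes_id permutes_id assms(2,3)] by simp

lemma colored_subgroup_diagonal_minus:
  assumes P: "colored_subgroup m n P" and "P id b"
  shows "P id (\<lambda>j. - b j)"
  using colored_subgroup_inv[OF P, OF permutes_id assms(2)] by simp

lemma additive_subgroup_mult:
  fixes S :: "int set"
  assumes "0 \<in> S" "\<And>a b. a \<in> S \<Longrightarrow> b \<in> S \<Longrightarrow> a + b \<in> S" "\<And>a. a \<in> S \<Longrightarrow> - a \<in> S" "s \<in> S"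
  shows "c * s \<in> S"
proof (induction c rule: int_induct[of _ 0])
  case (step1 c)
  then have "c * s + s \<in> S" using assms by blast
  then show ?case by (simp add: algebra_simps)
next
  case (step2 c)
  then have "c * s + - s \<in> S" using assms by blast
  then show ?case by (simp add: algebra_simps)
qed (use assms in simp)

lemma additive_subgroup_Gcd:
  fixes S :: "int set"
  assumes S: "0 \<in> S" "\<And>a b. a \<in> S \<Longrightarrow> b \<in> S \<Longrightarrow> a + b \<in> S" "\<And>a. a \<in> S \<Longrightarrow> - a \<in> S"
    and A: "finite A" "A \<subseteq> S"
  shows "Gcd A \<in> S"
  using A
proof (induction A rule: finite_induct)
  case (insert a A)
  obtain c d where "c * a + d * Gcd A = gcd a (Gcd A)" using bezout_int by blast
  moreover have "c * a \<in> S" "d * Gcd A \<in> S"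
    using insert by (auto intro!: additive_subgroup_mult[of S, OF S])
  ultimately show ?case using S(2) by (metis Gcd_insert)
qed (use S in simp)

lemma colored_subgroup_star_transpositions:
  assumes P: "colored_subgroup m n P" and n: "n > 0"
    and star: "\<And>w. w \<in> {1..n} \<Longrightarrow> w \<noteq> 1 \<Longrightarrow> P (Transposition.transpose 1 w) (\<lambda>_. 0)"
    and u: "u permutes {1..n}"
  shows "P u (\<lambda>_. 0)"
proof -
  have one: "1 \<in> {1..n}" using n by simp
  have mult: "P (u \<circ> v) (\<lambda>_. 0)" if "u permutes {1..n}" "v permutes {1..n}" "P u (\<lambda>_. 0)" "P v (\<lambda>_. 0)" for u v
    using colored_subgroup_mult[OF P, OF that] by simp
  have id: "P id (\<lambda>_. 0)" by (rule colored_subgroup_one[OF P])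
  have star': "P (Transposition.transpose 1 w) (\<lambda>_. 0)" if "w \<in> {1..n}" for w
    using star[OF that] id by (cases "w = 1") auto
  have swap_P: "P (Transposition.transpose v w) (\<lambda>_. 0)" if vw: "v \<in> {1..n}" "w \<in> {1..n}" for v w
  proof (cases "v = 1 \<or> w = 1 \<or> v = w")
    case True
    then show ?thesis using star'[OF vw(1)] star'[OF vw(2)] id by (auto simp: transpose_commute)
  next
    case False
    then have "Transposition.transpose v w =
        Transposition.transpose 1 v \<circ> (Transposition.transpose 1 w \<circ> Transposition.transpose 1 v)"
      by (auto simp: fun_eq_iff transpose_def)
    moreover have "P (Transposition.transpose 1 v \<circ> (Transposition.transpose 1 w \<circ> Transposition.transpose 1 v)) (\<lambda>_. 0)"
      by (intro mult permutes_compose permutes_swap_id one vw star')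
    ultimately show ?thesis by simp
  qed
  have "u permutes {1..n} \<and> P u (\<lambda>_. 0)"
    using finite_atLeastAtMost u
  proof (induction rule: permutes_rev_induct)
    case id
    then show ?case using permutes_id \<open>P id (\<lambda>_. 0)\<close> by blast
  next
    case (swap a b p)
    have t: "Transposition.transpose a b permutes {1..n}" by (intro permutes_swap_id swap.hyps)
    have "p \<circ> Transposition.transpose a b permutes {1..n}"
      by (rule permutes_compose[OF t]) (use swap.IH in blast)
    moreover have "P (p \<circ> Transposition.transpose a b) (\<lambda>_. 0)"
      by (rule mult[OF _ t]) (use swap.IH swap.hyps swap_P in blast)+
    ultimately show ?case by (simp add: o_def)
  qed
  then show ?thesis ..
qed

text \<open>
  Conjugating the letters along a path from \<open>1\<close> to \<open>w\<close> yields an element of the group over the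
  transposition \<open>(1 w)\<close>. Its voltage is taken as the value of \<open>\<psi>\<close> at \<open>w\<close>, so that in the new gauge these
  transpositions become uncolored; they generate all permutations.
\<close>

lemma exists_gauge:
  assumes P: "colored_subgroup m n P" and n: "n > 0" and on: "\<forall>s\<in>set sk. letter_on n s"
    and linked: "linked n (edges_of sk)"
    and gens: "\<And>i. i < length sk \<Longrightarrow> P (letter_perm (sk ! i)) (letter_color (sk ! i) (x i))"
  shows "\<exists>\<psi>. \<forall>u. u permutes {1..n} \<longrightarrow> P u (\<lambda>j. \<psi> (u j) - \<psi> j)"
proof -
  have edge: "v \<in> {1..n} \<and> w \<in> {1..n} \<and> v \<noteq> w \<and> (\<exists>y. P (Transposition.transpose v w) (unit_diff v w y))"
    if "(v, w) \<in> edges_of sk \<union> (edges_of sk)\<inverse>" for v w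
  proof -
    have fwd: "a \<in> {1..n} \<and> c \<in> {1..n} \<and> a \<noteq> c \<and> (\<exists>y. P (Transposition.transpose a c) (unit_diff a c y))"
      if "(a, c) \<in> edges_of sk" for a c
    proof -
      have "Inl (a, c) \<in> set sk" using that by (simp add: edges_of_def)
      then obtain i where i: "i < length sk" "sk ! i = Inl (a, c)" by (metis in_set_conv_nth)
      then have ac: "a \<in> {1..n}" "c \<in> {1..n}" "a \<noteq> c" using on nth_mem[OF i(1)] by force+
      then show ?thesis using gens[OF i(1)] i(2) letter_color_edge[OF ac(3)] by auto
    qed
    show ?thesis
    proof (cases "(v, w) \<in> edges_of sk")
      case True
      then show ?thesis by (rule fwd)
    next
      case False
      then have "w \<in> {1..n} \<and> v \<in> {1..n} \<and> w \<noteq> v \<and> (\<exists>y. P (Transposition.transpose w v) (unit_diff w v y))"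
        using that by (intro fwd) auto
      then obtain y where y: "w \<in> {1..n}" "v \<in> {1..n}" "w \<noteq> v" "P (Transposition.transpose w v) (unit_diff w v y)" by blast
      moreover have "unit_diff w v y = unit_diff v w (- y)" by (auto simp: unit_diff_def)
      ultimately show ?thesis by (metis transpose_commute)
    qed
  qed
  have star: "w = 1 \<or> (w \<in> {1..n} \<and> (\<exists>y. P (Transposition.transpose 1 w) (unit_diff 1 w y)))"
    if "(1, w) \<in> (edges_of sk \<union> (edges_of sk)\<inverse>)\<^sup>*" for w
    using that
  proof (induction rule: rtrancl_induct)
    case (step w z)
    obtain y' where y': "w \<in> {1..n}" "z \<in> {1..n}" "w \<noteq> z" "P (Transposition.transpose w z) (unit_diff w z y')"
      using edge[OF step.hyps(2)] by blast
    show ?case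
    proof (cases "z = 1 \<or> w = 1")
      case True
      then show ?thesis using y' by auto
    next
      case False
      then obtain y where y: "P (Transposition.transpose 1 w) (unit_diff 1 w y)" using step.IH by blast
      let ?s = "Transposition.transpose 1 w" and ?t = "Transposition.transpose w z"
      have one: "1 \<in> {1..n}" using n by simp
      have s: "?s permutes {1..n}" "?t permutes {1..n}"
        by (intro permutes_swap_id one y')+
      have "P (?s \<circ> (?t \<circ> ?s)) (\<lambda>j. unit_diff 1 w y ((?t \<circ> ?s) j) + (unit_diff w z y' (?s j) + unit_diff 1 w y j))"
        by (intro colored_subgroup_mult[OF P] permutes_compose s y y'(4))
      moreover have "?s \<circ> (?t \<circ> ?s) = Transposition.transpose 1 z"
        using False y'(3) by (auto simp: fun_eq_iff transpose_def)
      moreover have "(\<lambda>j. unit_diff 1 w y ((?t \<circ> ?s) j) + (unit_diff w z y' (?s j) + unit_diff 1 w y j))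
          = unit_diff 1 z (y + y')"
        using False y'(3) by (auto simp: fun_eq_iff transpose_def unit_diff_def)
      ultimately show ?thesis using y'(2) by auto
    qed
  qed simp
  have "\<exists>y. w \<noteq> 1 \<longrightarrow> P (Transposition.transpose 1 w) (unit_diff 1 w y)" if w: "w \<in> {1..n}" for w
  proof -
    have "(1, w) \<in> (edges_of sk \<union> (edges_of sk)\<inverse>)\<^sup>*"
      using linked w n unfolding linked_def links_def by auto
    from star[OF this] show ?thesis by blast
  qed
  then obtain y where y: "\<And>w. w \<in> {1..n} \<Longrightarrow> w \<noteq> 1 \<Longrightarrow> P (Transposition.transpose 1 w) (unit_diff 1 w (y w))"
    by metis
  define \<psi> where "\<psi> = y(1 := 0)"
  let ?P = "\<lambda>u b. P u (\<lambda>j. b j + (\<psi> (u j) - \<psi> j))"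
  have "?P u (\<lambda>_. 0)" if "u permutes {1..n}" for u
  proof (rule colored_subgroup_star_transpositions[OF colored_subgroup_gauge[OF P], OF n _ that])
    fix w assume w: "w \<in> {1..n}" "w \<noteq> 1"
    have "unit_diff 1 w (y w) = (\<lambda>j. 0 + (\<psi> (Transposition.transpose 1 w j) - \<psi> j))"
      using w(2) by (auto simp: fun_eq_iff \<psi>_def unit_diff_def transpose_def)
    then show "P (Transposition.transpose 1 w) (\<lambda>j. 0 + (\<psi> (Transposition.transpose 1 w j) - \<psi> j))"
      using y[OF w] by simp
  qed
  then show ?thesis by auto
qed

text \<open>
  After a change of gauge the group contains all uncolored permutations, so it does not depend
  on \<open>v \<noteq> w\<close> whether the diagonal matrix with exponents \<open>s\<close> at \<open>v\<close> and \<open>-s\<close> at \<open>w\<close> belongs to the group. The \<open>s\<close>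
  for which it does form an additive subgroup of the integers, which contains \<open>m\<close>, the diagonal labels and the numbers
  \<open>x i - grad \<psi> sk i\<close>. Hence it contains their gcd \<open>q\<close>. As \<open>q\<close> divides \<open>p\<close> and \<open>\<psi>\<close> is a
  potential modulo \<open>q\<close>, nondegeneracy gives \<open>q = 1\<close>. These diagonal matrices and one of color \<open>p\<close> generate
  all diagonal matrices whose color is a multiple of \<open>p\<close>.
\<close>

lemma colored_subgroup_eq_all:
  assumes P: "colored_subgroup m n P" and mn: "m > 0" "n > 0" and on: "\<forall>s\<in>set sk. letter_on n s"
    and linked: "linked n (edges_of sk)"
    and gens: "\<And>i. i < length sk \<Longrightarrow> P (letter_perm (sk ! i)) (letter_color (sk ! i) (x i))"
    and labels: "Gcd (insert (int m) (diag_label ` set sk)) = int p"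
    and nondeg: "nondegenerate p sk x"
    and u: "u permutes {1..n}" and b: "int p dvd (\<Sum>j\<in>{1..n}. b j)"
  shows "P u b"
proof -
  obtain \<psi> where \<psi>: "\<And>u. u permutes {1..n} \<Longrightarrow> P u (\<lambda>j. \<psi> (u j) - \<psi> j)"
    using exists_gauge[OF P mn(2) on linked gens] by blast
  define G where "G = (\<lambda>u b. P u (\<lambda>j. b j + (\<psi> (u j) - \<psi> j)))"
  have G: "colored_subgroup m n G" unfolding G_def by (rule colored_subgroup_gauge[OF P])
  have perms: "G u (\<lambda>_. 0)" if "u permutes {1..n}" for u using \<psi>[OF that] by (simp add: G_def)
  have zero: "G id (\<lambda>_. 0)" using perms permutes_id by blast
  note add = colored_subgroup_diagonal_add[OF G] and minus = colored_subgroup_diagonal_minus[OF G]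
  have conj: "G id (\<lambda>j. b (\<sigma> j))" if "G id b" "\<sigma> permutes {1..n}" for b \<sigma>
    by (rule colored_subgroup_conjugate_diagonal[OF G]) (use perms that in blast)+
  define S where "S = {s. \<forall>v\<in>{1..n}. \<forall>w\<in>{1..n}. v \<noteq> w \<longrightarrow> G id (unit_diff v w s)}"
  define E where "E = {e. \<forall>v\<in>{1..n}. G id (\<lambda>j. e * of_bool (j = v))}"
  have S: "0 \<in> S" "\<And>a b. a \<in> S \<Longrightarrow> b \<in> S \<Longrightarrow> a + b \<in> S" "\<And>a. a \<in> S \<Longrightarrow> - a \<in> S"
  proof -
    show "0 \<in> S" using zero by (simp add: S_def unit_diff_zero)
    fix a b assume a: "a \<in> S"
    have "unit_diff v w (- a) = (\<lambda>j. - unit_diff v w a j)" for v w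
      by (auto simp: unit_diff_def algebra_simps)
    then show "- a \<in> S" using minus a by (simp add: S_def)
    assume b: "b \<in> S"
    have "unit_diff v w (a + b) = (\<lambda>j. unit_diff v w a j + unit_diff v w b j)" for v w
      by (auto simp: unit_diff_def algebra_simps)
    then show "a + b \<in> S" using add a b by (simp add: S_def)
  qed
  have E: "0 \<in> E" "\<And>a b. a \<in> E \<Longrightarrow> b \<in> E \<Longrightarrow> a + b \<in> E" "\<And>a. a \<in> E \<Longrightarrow> - a \<in> E"
  proof -
    show "0 \<in> E" using zero by (simp add: E_def)
    fix a b assume a: "a \<in> E"
    show "- a \<in> E" using minus a unfolding E_def by fastforce
    assume b: "b \<in> E"
    have "(\<lambda>j. (a + b) * of_bool (j = v)) = (\<lambda>j. a * of_bool (j = v) + b * of_bool (j = v))" for v :: nat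
      by (auto simp: algebra_simps)
    then show "a + b \<in> E" using add a b by (simp add: E_def)
  qed
  have spread: "s \<in> S" if vw: "v \<in> {1..n}" "w \<in> {1..n}" "v \<noteq> w" and s: "G id (unit_diff v w s)" for v w s
    unfolding S_def
  proof (intro CollectI ballI impI)
    fix v' w' assume vw': "v' \<in> {1..n}" "w' \<in> {1..n}" "v' \<noteq> w'"
    \<comment> \<open>\<open>\<sigma>\<close> carries \<open>v'\<close> to \<open>v\<close> and \<open>w'\<close> to \<open>w\<close>.\<close>
    define w'' where "w'' = Transposition.transpose v' v w'"
    have "w'' \<in> {1..n}" using vw vw' by (simp add: w''_def transpose_def)
    define \<sigma> where "\<sigma> = Transposition.transpose w'' w \<circ> Transposition.transpose v' v"
    have \<sigma>: "\<sigma> permutes {1..n}"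
      unfolding \<sigma>_def by (intro permutes_compose permutes_swap_id vw vw' \<open>w'' \<in> {1..n}\<close>)
    have "v \<noteq> w''" using vw' by (auto simp: w''_def transpose_def)
    have "\<sigma> v' = Transposition.transpose w'' w v" by (simp add: \<sigma>_def)
    also have "\<dots> = v" using \<open>v \<noteq> w''\<close> vw(3) by simp
    finally have "\<sigma> v' = v" .
    moreover have "\<sigma> w' = Transposition.transpose w'' w w''" unfolding \<sigma>_def w''_def o_apply ..
    then have "\<sigma> w' = w" by simp
    moreover have "\<sigma> j = \<sigma> l \<longleftrightarrow> j = l" for j l using permutes_inj[OF \<sigma>] by (simp add: inj_eq)
    ultimately have "\<sigma> j = v \<longleftrightarrow> j = v'" "\<sigma> j = w \<longleftrightarrow> j = w'" for j by metis+
    then have "(\<lambda>j. unit_diff v w s (\<sigma> j)) = unit_diff v' w' s" by (auto simp: unit_diff_def)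
    then show "G id (unit_diff v' w' s)" using conj[OF s \<sigma>] by simp
  qed
  have m_S: "int m \<in> S"
    unfolding S_def
  proof (intro CollectI ballI impI)
    fix v w
    show "G id (unit_diff v w (int m))"
      by (rule colored_subgroup_cong[OF G, OF zero]) (simp add: unit_diff_def cong_iff_dvd_diff)
  qed
  have m_E: "int m \<in> E"
    unfolding E_def
  proof (intro CollectI ballI)
    fix v :: nat
    show "G id (\<lambda>j. int m * of_bool (j = v))"
      by (rule colored_subgroup_cong[OF G, OF zero]) (simp add: cong_iff_dvd_diff)
  qed
  have label_E: "diag_label s \<in> E" if s: "s \<in> set sk" for s
  proof (cases s rule: letter_cases)
    case (edge v w)
    then show ?thesis using E(1) by simp
  next
    case (diag i e)
    obtain l where l: "l < length sk" "sk ! l = Inr (i, e)" using s diag by (auto simp: in_set_conv_nth)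
    have i: "i \<in> {1..n}" using on s diag by auto
    have "letter_color (Inr (i, e)) y = (\<lambda>j. e * of_bool (j = i))" for y by auto
    then have ie: "G id (\<lambda>j. e * of_bool (j = i))" using gens[OF l(1)] l(2) by (simp add: G_def id_def)
    have "G id (\<lambda>j. e * of_bool (j = v))" if v: "v \<in> {1..n}" for v
    proof -
      have "Transposition.transpose i v j = i \<longleftrightarrow> j = v" for j by (auto simp: transpose_def)
      then show ?thesis using conj[OF ie permutes_swap_id[OF i v]] by simp
    qed
    then show ?thesis by (simp add: E_def diag)
  qed
  have E_S: "e \<in> S" if e: "e \<in> E" for e
    unfolding S_def
  proof (intro CollectI ballI impI)
    fix v w assume vw: "v \<in> {1..n}" "w \<in> {1..n}" "v \<noteq> w"
    have "G id (\<lambda>j. e * of_bool (j = v) + - e * of_bool (j = w))"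
      using e E(3)[OF e] vw by (intro add) (simp_all add: E_def)
    then show "G id (unit_diff v w e)" by (simp add: unit_diff_def[abs_def] algebra_simps)
  qed
  \<comment> \<open>A closed walk multiplies up to a diagonal element; here the walk is an edge followed by
    the uncolored transposition back.\<close>
  have edge_S: "x i - grad \<psi> sk i \<in> S" if i: "i \<in> edge_positions sk" for i
  proof -
    obtain v w where vw: "sk ! i = Inl (v, w)"
      using i by (cases "sk ! i" rule: letter_cases) (auto simp: edge_positions_def)
    have i': "i < length sk" using i by (simp add: edge_positions_def)
    have on_vw: "letter_on n (Inl (v, w))" using on nth_mem[OF i'] vw by metis
    then have v: "v \<in> {1..n}" "w \<in> {1..n}" "v \<noteq> w" by auto
    let ?t = "Transposition.transpose v w" and ?z = "x i - grad \<psi> sk i"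
    have "(\<lambda>j. unit_diff v w ?z j + (\<psi> (?t j) - \<psi> j)) = letter_color (Inl (v, w)) (x i)"
      using v(3) by (auto simp: fun_eq_iff unit_diff_def transpose_def grad_at[OF vw])
    then have "G ?t (unit_diff v w ?z)" using gens[OF i'] by (simp add: G_def vw)
    moreover have t: "?t permutes {1..n}" by (intro permutes_swap_id v)
    ultimately have "G (?t \<circ> ?t) (\<lambda>j. 0 + unit_diff v w ?z j)"
      by (intro colored_subgroup_mult[OF G, OF t t perms[OF t]])
    then have "G id (unit_diff v w ?z)" by simp
    then show ?thesis by (rule spread[OF v])
  qed
  define A where "A = insert (int m) (diag_label ` set sk \<union> (\<lambda>i. x i - grad \<psi> sk i) ` edge_positions sk)"
  have A_S: "Gcd A \<in> S"
    by (rule additive_subgroup_Gcd[OF S]) (use m_S label_E E_S edge_S in \<open>auto simp: A_def\<close>)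
  have "Gcd A dvd int p"
    unfolding labels[symmetric] by (rule Gcd_greatest) (auto simp: A_def intro: Gcd_dvd simp del: Gcd_insert)
  then have "nat (Gcd A) dvd p" by (simp add: nat_dvd_iff)
  moreover have "potential (nat (Gcd A)) \<psi> sk x"
    unfolding potential_def by (auto simp: cong_iff_dvd_diff A_def intro: Gcd_dvd simp del: Gcd_insert)
  ultimately have "nat (Gcd A) = 1" using nondeg unfolding nondegenerate_def by blast
  then have "Gcd A = 1" by (metis Gcd_int_greater_eq_0 int_nat_eq of_nat_1)
  then have S_all: "s \<in> S" for s using additive_subgroup_mult[OF S A_S, of s] by simp
  have "Gcd (insert (int m) (diag_label ` set sk)) \<in> E"
    by (rule additive_subgroup_Gcd[OF E]) (use m_E label_E in auto)
  then have p_E: "int p \<in> E" by (simp only: labels)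
  have diagonal: "G id c" if c: "int p dvd (\<Sum>j\<in>{1..n}. c j)" for c
  proof -
    have part: "G id (\<lambda>j. \<Sum>v\<in>V. unit_diff v 1 (c v) j)" if "finite V" "V \<subseteq> {2..n}" for V
      using that
    proof (induction V rule: finite_induct)
      case empty
      then show ?case using zero by (simp add: id_def)
    next
      case (insert v V)
      have "G id (unit_diff v 1 (c v))" using S_all[of "c v"] insert.prems mn(2) by (simp add: S_def)
      from add[OF this insert.IH] insert show ?case by (simp add: id_def)
    qed
    obtain l where l: "(\<Sum>j\<in>{1..n}. c j) = int p * l" using c by (elim dvdE)
    have "(\<Sum>j\<in>{1..n}. c j) \<in> E" unfolding l using additive_subgroup_mult[OF E p_E, of l] by (simp add: mult.commute)
    then have total: "G id (\<lambda>j. (\<Sum>j\<in>{1..n}. c j) * of_bool (j = 1))" using mn(2) by (simp add: E_def)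
    have split: "{1..n} = insert 1 {2..n}" using mn(2) by auto
    have sum_split: "(\<Sum>j\<in>{1..n}. c j) = c 1 + (\<Sum>j\<in>{2..n}. c j)" unfolding split by (subst sum.insert) auto
    have "(\<Sum>v\<in>{2..n}. unit_diff v 1 (c v) j) + (\<Sum>j\<in>{1..n}. c j) * of_bool (j = 1) = c j"
      if j: "j \<in> {1..n}" for j
    proof (cases "j = 1")
      case True
      have "(\<Sum>v\<in>{2..n}. unit_diff v 1 (c v) j) = (\<Sum>v\<in>{2..n}. - c v)"
        by (rule sum.cong) (auto simp: True unit_diff_def)
      then show ?thesis unfolding sum_split using True by (simp add: sum_negf)
    next
      case False
      have "(\<Sum>v\<in>{2..n}. unit_diff v 1 (c v) j) = (\<Sum>v\<in>{2..n}. if v = j then c j else 0)"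
        by (rule sum.cong) (auto simp: False unit_diff_def)
      then show ?thesis using False j by auto
    qed
    then show ?thesis
      using colored_subgroup_cong[OF G, OF add[OF part[OF finite_atLeastAtMost subset_refl] total], of c] by simp
  qed
  define c where "c j = b j - (\<psi> (u j) - \<psi> j)" for j
  have "(\<Sum>j\<in>{1..n}. c j) = (\<Sum>j\<in>{1..n}. b j)"
    using color_reindex[OF u, of \<psi>] by (simp add: c_def sum_subtractf)
  then have "G id c" using diagonal b by simp
  from colored_subgroup_mult[OF G, OF u permutes_id perms[OF u] this]
  have "G u c" by simp
  then show ?thesis by (simp add: G_def c_def)
qed

section \<open>Factorizations into reflections as words with voltages\<close>

definition letter_mat :: "nat \<Rightarrow> nat \<Rightarrow> letter \<Rightarrow> int \<Rightarrow> complex mat" where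
  "letter_mat m n s y = colored_perm_mat m n (letter_perm s) (letter_color s y)"

fun word_mats :: "nat \<Rightarrow> nat \<Rightarrow> letter list \<Rightarrow> (nat \<Rightarrow> int) \<Rightarrow> complex mat list" where
  "word_mats m n [] x = []"
| "word_mats m n (s # sk) x = letter_mat m n s (x 0) # word_mats m n sk (\<lambda>i. x (Suc i))"

fun refl_letter :: "nat \<Rightarrow> nat \<Rightarrow> nat \<Rightarrow> letter \<Rightarrow> bool" where
  "refl_letter m p n (Inl (v, w)) \<longleftrightarrow> v \<in> {1..n} \<and> w \<in> {1..n} \<and> v < w"
| "refl_letter m p n (Inr (i, e)) \<longleftrightarrow> i \<in> {1..n} \<and> 0 < e \<and> e < int m \<and> int p dvd e"

lemma refl_letter_on: "refl_letter m p n s \<Longrightarrow> letter_on n s"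
  by (cases s rule: letter_cases) auto

lemma refl_letter_dvd: "refl_letter m p n s \<Longrightarrow> int p dvd diag_label s"
  by (cases s rule: letter_cases) auto

lemma length_word_mats [simp]: "length (word_mats m n sk x) = length sk"
  by (induction sk arbitrary: x) auto

lemma nth_word_mats: "i < length sk \<Longrightarrow> word_mats m n sk x ! i = letter_mat m n (sk ! i) (x i)"
proof (induction sk arbitrary: x i)
  case (Cons s sk)
  then show ?case by (cases i) auto
qed simp

lemma foldr_word_mats:
  assumes "\<forall>s\<in>set sk. letter_on n s"
  shows "foldr (*) (word_mats m n sk x) (1\<^sub>m n) = colored_perm_mat m n (word_perm sk) (word_color sk x)"
  using assms
proof (induction sk arbitrary: x)
  case Nil
  have "word_color [] x = (\<lambda>_. 0)" by (simp add: fun_eq_iff)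
  then show ?case
    using colored_perm_mat_one[of m n]
    by (simp only: word_mats.simps foldr.simps id_apply word_perm.simps id_def)
next
  case (Cons s sk)
  have "word_perm sk permutes {1..n}" by (rule word_perm_permutes) (use Cons.prems in simp)
  note mult = colored_perm_mat_mult[OF this]
  have color: "word_color (s # sk) x =
      (\<lambda>j. letter_color s (x 0) (word_perm sk j) + word_color sk (\<lambda>i. x (Suc i)) j)"
    by (simp add: fun_eq_iff)
  have "foldr (*) (word_mats m n sk (\<lambda>i. x (Suc i))) (1\<^sub>m n) =
      colored_perm_mat m n (word_perm sk) (word_color sk (\<lambda>i. x (Suc i)))"
    by (rule Cons.IH) (use Cons.prems in simp)
  then show ?case
    by (simp only: word_mats.simps foldr.simps o_apply word_perm.simps letter_mat_def mult color o_def)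
qed

lemma letter_mat_inj:
  assumes m: "m > 0" and s: "refl_letter m p n s" and t: "refl_letter m p n t"
    and y: "isl s \<Longrightarrow> y \<in> {0..<int m}" and z: "isl t \<Longrightarrow> z \<in> {0..<int m}"
    and eq: "letter_mat m n s y = letter_mat m n t z"
  shows "s = t \<and> (isl s \<longrightarrow> y = z)"
proof -
  have perm: "letter_perm s = letter_perm t"
    and col: "\<And>j. j \<in> {1..n} \<Longrightarrow> [letter_color s y j = letter_color t z j] (mod int m)"
    using eq colored_perm_mat_eq_iff[OF m letter_perm_permutes letter_perm_permutes, of n s t]
      refl_letter_on[OF s] refl_letter_on[OF t] unfolding letter_mat_def by blast+
  have not_id: "Transposition.transpose v w \<noteq> id" if "v < w" for v w :: nat
  proof
    assume "Transposition.transpose v w = id"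
    then have "Transposition.transpose v w v = v" by simp
    then show False using that by simp
  qed
  show ?thesis
  proof (cases s rule: letter_cases; cases t rule: letter_cases)
    fix v w v' w' assume st: "s = Inl (v, w)" "t = Inl (v', w')"
    have vw: "v < w" "v' < w'" "v \<in> {1..n}" using s t st by auto
    have tr: "Transposition.transpose v w x = Transposition.transpose v' w' x" for x
      using perm st by simp
    have "v = v' \<and> w = w'"
      using tr[of v] tr[of w] vw by (auto simp: transpose_def split: if_splits)
    then show ?thesis using col[OF vw(3)] y z st by (simp add: cong_def)
  next
    fix i e i' e' assume st: "s = Inr (i, e)" "t = Inr (i', e')"
    have "[e = (if i = i' then e' else 0)] (mod int m)" using col[of i] s st by simp
    then show ?thesis using s t st by (auto simp: cong_def split: if_splits)
  next
    fix v w i e assume st: "s = Inl (v, w)" "t = Inr (i, e)"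
    then show ?thesis using perm not_id[of v w] s by simp
  next
    fix v w i e assume st: "s = Inr (i, e)" "t = Inl (v, w)"
    then show ?thesis using perm not_id[of v w] t by simp
  qed
qed

lemma letter_mat_in_reflections:
  assumes mp: "m > 0" "p > 0" "p dvd m" and s: "refl_letter m p n s"
  shows "letter_mat m n s y \<in> {t \<in> carrier (Gmpn m p n). reflection n t}"
proof -
  have on: "letter_on n s" using refl_letter_on[OF s] .
  have "color (letter_color s y) {1..n} = diag_label s"
    unfolding color_def by (rule sum_letter_color[OF on])
  then have "letter_mat m n s y \<in> carrier (Gmpn m p n)"
    unfolding letter_mat_def colored_perm_mat_in_Gmpn_iff[OF mp letter_perm_permutes[OF on]]
    using refl_letter_dvd[OF s] by simp
  moreover have "reflection n (letter_mat m n s y)"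
  proof (cases s rule: letter_cases)
    case (edge v w)
    then show ?thesis unfolding letter_mat_def using edge_letter_reflection on by simp
  next
    case (diag i e)
    then have "i \<in> {1..n}" "\<not> int m dvd e" using s by (auto dest: zdvd_imp_le)
    then show ?thesis unfolding letter_mat_def diag by (intro diag_letter_reflection mp)
  qed
  ultimately show ?thesis by simp
qed

lemma reflection_is_letter_mat:
  assumes mp: "m > 0" "p > 0" "p dvd m" and t: "t \<in> carrier (Gmpn m p n)" "reflection n t"
  shows "\<exists>s y. refl_letter m p n s \<and> y \<in> {0..<int m} \<and> t = letter_mat m n s y"
proof -
  obtain u b where u: "u permutes {1..n}" "int p dvd color b {1..n}" and t_eq: "t = colored_perm_mat m n u b"
    using t(1) unfolding mem_Gmpn_iff[OF mp] by blast
  from mp(1) u(1) t(2)[unfolded t_eq] show ?thesis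
  proof (cases rule: reflection_cases)
    case (edge v w)
    have vw: "v \<noteq> w" using edge(1) by auto
    have "t = letter_mat m n (Inl (v, w)) (b v mod int m)"
      unfolding t_eq letter_mat_def edge(2)
    proof (rule colored_perm_mat_cong[OF mp(1)])
      fix j assume j: "j \<in> {1..n}"
      have "[letter_color (Inl (v, w)) (b v) j = letter_color (Inl (v, w)) (b v mod int m) j] (mod int m)"
        by (auto simp: cong_minus_minus_iff)
      with edge(3) j show "[b j = letter_color (Inl (v, w)) (b v mod int m) j] (mod int m)"
        by (meson cong_trans)
    qed
    moreover have "refl_letter m p n (Inl (v, w))" using edge(1) by simp
    moreover have "b v mod int m \<in> {0..<int m}" using mp(1) by simp
    ultimately show ?thesis by blast
  next
    case (diag i)
    define e where "e = b i mod int m"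
    have "[color b {1..n} = (\<Sum>j\<in>{1..n}. letter_color (Inr (i, b i)) 0 j)] (mod int m)"
      unfolding color_def by (rule cong_sum) (use diag(4) in blast)
    also have "(\<Sum>j\<in>{1..n}. letter_color (Inr (i, b i)) 0 j) = b i"
      using sum_letter_color[of n "Inr (i, b i)"] diag(1) by simp
    finally have "[color b {1..n} = b i] (mod int p)"
      using mp(3) by (meson cong_dvd_modulus int_dvd_int_iff)
    moreover have "[b i = e] (mod int p)"
      using mp(3) cong_dvd_modulus[of "b i" e "int m" "int p"] by (simp add: e_def)
    ultimately have "int p dvd e" using u(2) by (metis cong_dvd_iff)
    moreover have "e > 0" "e < int m"
      using diag(3) mp(1) pos_mod_sign[of "int m" "b i"] by (auto simp: e_def dvd_eq_mod_eq_0 order.not_eq_order_implies_strict)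
    ultimately have "refl_letter m p n (Inr (i, e))" using diag(1) by simp
    moreover have "t = letter_mat m n (Inr (i, e)) 0"
      unfolding t_eq letter_mat_def diag(2) letter_perm.simps
    proof (rule colored_perm_mat_cong[OF mp(1)])
      fix j assume j: "j \<in> {1..n}"
      have "[letter_color (Inr (i, b i)) 0 j = letter_color (Inr (i, e)) 0 j] (mod int m)"
        by (auto simp: e_def)
      with diag(4) j show "[b j = letter_color (Inr (i, e)) 0 j] (mod int m)"
        by (meson cong_trans)
    qed
    ultimately show ?thesis using mp(1) by (intro exI[of _ "Inr (i, e)"] exI[of _ 0]) simp
  qed
qed

lemma bij_betw_word_mats:
  assumes mp: "m > 0" "p > 0" "p dvd m"
  shows "bij_betw (\<lambda>(sk, x). word_mats m n sk x)
    (SIGMA sk : {sk. length sk = N \<and> (\<forall>s\<in>set sk. refl_letter m p n s)}. edge_positions sk \<rightarrow>\<^sub>E {0..<int m})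
    {ts. length ts = N \<and> set ts \<subseteq> {t \<in> carrier (Gmpn m p n). reflection n t}}"
    (is "bij_betw ?f ?W ?T")
  unfolding bij_betw_def
proof
  show "inj_on ?f ?W"
  proof (rule inj_onI)
    fix a a' assume a: "a \<in> ?W" "a' \<in> ?W" "?f a = ?f a'"
    obtain sk x sk' x' where aa: "a = (sk, x)" "a' = (sk', x')" by (cases a; cases a')
    have sk: "length sk = N" "\<forall>s\<in>set sk. refl_letter m p n s" "x \<in> edge_positions sk \<rightarrow>\<^sub>E {0..<int m}"
      "length sk' = N" "\<forall>s\<in>set sk'. refl_letter m p n s" "x' \<in> edge_positions sk' \<rightarrow>\<^sub>E {0..<int m}"
      using a aa by auto
    have letters: "sk ! i = sk' ! i \<and> (isl (sk ! i) \<longrightarrow> x i = x' i)" if i: "i < N" for i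
    proof (rule letter_mat_inj[OF mp(1)])
      show "refl_letter m p n (sk ! i)" "refl_letter m p n (sk' ! i)" using sk i by auto
      show "isl (sk ! i) \<Longrightarrow> x i \<in> {0..<int m}" using sk(1,3) i by (auto simp: edge_positions_def PiE_iff)
      show "isl (sk' ! i) \<Longrightarrow> x' i \<in> {0..<int m}" using sk(4,6) i by (auto simp: edge_positions_def PiE_iff)
      show "letter_mat m n (sk ! i) (x i) = letter_mat m n (sk' ! i) (x' i)"
        using a(3) aa i sk by (metis case_prod_conv nth_word_mats)
    qed
    have "sk = sk'" using sk letters by (intro nth_equalityI) auto
    moreover have "x = x'"
      by (rule PiE_ext[OF sk(3)]) (use sk letters \<open>sk = sk'\<close> in \<open>auto simp: edge_positions_def\<close>)
    ultimately show "a = a'" using aa by simp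
  qed
  show "?f ` ?W = ?T"
  proof (intro Set.set_eqI iffI)
    fix ts assume "ts \<in> ?f ` ?W"
    then obtain sk x where sk: "ts = word_mats m n sk x" "length sk = N" "\<forall>s\<in>set sk. refl_letter m p n s" by auto
    then have "ts ! i \<in> {t \<in> carrier (Gmpn m p n). reflection n t}" if "i < N" for i
      using that nth_word_mats[of i sk m n x] letter_mat_in_reflections[OF mp, of n "sk ! i" "x i"] by simp
    moreover have "length ts = N" using sk by simp
    ultimately show "ts \<in> ?T" unfolding set_conv_nth by blast
  next
    fix ts assume ts: "ts \<in> ?T"
    then have len: "length ts = N" by simp
    have "\<forall>i. \<exists>s y. i < N \<longrightarrow> refl_letter m p n s \<and> y \<in> {0..<int m} \<and> ts ! i = letter_mat m n s y"
      using ts reflection_is_letter_mat[OF mp] by (auto simp: subset_iff)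
    then obtain s y where sy: "\<And>i. i < N \<Longrightarrow> refl_letter m p n (s i)" "\<And>i. i < N \<Longrightarrow> y i \<in> {0..<int m}"
      "\<And>i. i < N \<Longrightarrow> ts ! i = letter_mat m n (s i) (y i)"
      by metis
    define sk where "sk = map s [0..<N]"
    define x where "x = restrict y (edge_positions sk)"
    have sk: "length sk = N" "sk ! i = s i" if "i < N" for i using that by (simp_all add: sk_def)
    have "letter_mat m n (s i) (x i) = letter_mat m n (s i) (y i)" if i: "i < N" for i
    proof (cases "isl (s i)")
      case True
      then show ?thesis using i by (simp add: x_def edge_positions_def sk_def)
    next
      case False
      then show ?thesis by (cases "s i" rule: letter_cases) (auto simp: letter_mat_def letter_color.simps[abs_def])
    qed
    then have "word_mats m n sk x = ts"
      using len sy(3) by (intro nth_equalityI) (auto simp: nth_word_mats sk_def)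
    moreover have "(sk, x) \<in> ?W"
      using sy(1,2) by (auto simp: sk_def x_def edge_positions_def)
    ultimately show "ts \<in> ?f ` ?W" by force
  qed
qed

section \<open>The generation criterion\<close>

text \<open>
  This is how a subgroup given by a predicate on pairs bounds a generated group of matrices from above.
\<close>

lemma generate_invariant:
  assumes mp: "m > 0" "p > 0" "p dvd m"
    and Q: "colored_subgroup m n Q"
    and T: "\<And>t. t \<in> T \<Longrightarrow> \<exists>u b. u permutes {1..n} \<and> int p dvd color b {1..n} \<and> t = colored_perm_mat m n u b \<and> Q u b"
    and A: "colored_perm_mat m n u b \<in> generate (Gmpn m p n) T" and u: "u permutes {1..n}"
  shows "Q u b"
proof -
  have "\<exists>u b. u permutes {1..n} \<and> int p dvd color b {1..n} \<and> A = colored_perm_mat m n u b \<and> Q u b"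
    if "A \<in> generate (Gmpn m p n) T" for A
    using that
  proof (induction rule: generate.induct)
    case one
    have "int p dvd color (\<lambda>_. 0) {1..n}" by (simp add: color_def)
    then show ?case
      unfolding Gmpn_simps colored_perm_mat_one[of m n, symmetric]
      using colored_subgroup_one[OF Q] permutes_id by blast
  next
    case (incl t)
    then show ?case by (rule T)
  next
    case (inv t)
    then obtain u b where t: "u permutes {1..n}" "int p dvd color b {1..n}" "t = colored_perm_mat m n u b" "Q u b"
      using T by blast
    show ?case
    proof (intro exI conjI)
      show "inv' u permutes {1..n}" by (rule permutes_inv[OF t(1)])
      show "int p dvd color (\<lambda>j. - b (inv' u j)) {1..n}"
        using t(2) colored_perm_mat_inverse_color[OF t(1)] by simp
      show "inv\<^bsub>Gmpn m p n\<^esub> t = colored_perm_mat m n (inv' u) (\<lambda>j. - b (inv' u j))"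
        unfolding t(3) by (rule Gmpn_inv[OF mp t(1,2)])
      show "Q (inv' u) (\<lambda>j. - b (inv' u j))" by (rule colored_subgroup_inv[OF Q, OF t(1,4)])
    qed
  next
    case (eng A B)
    then obtain u b v c where AB: "u permutes {1..n}" "int p dvd color b {1..n}" "A = colored_perm_mat m n u b" "Q u b"
      "v permutes {1..n}" "int p dvd color c {1..n}" "B = colored_perm_mat m n v c" "Q v c" by blast
    show ?case
    proof (intro exI conjI)
      show "u \<circ> v permutes {1..n}" by (rule permutes_compose[OF AB(5,1)])
      have "color (\<lambda>j. b (v j) + c j) {1..n} = color b {1..n} + color c {1..n}"
        using color_reindex[OF AB(5), of b] by (simp add: color_def sum.distrib)
      then show "int p dvd color (\<lambda>j. b (v j) + c j) {1..n}" using AB by simp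
      show "A \<otimes>\<^bsub>Gmpn m p n\<^esub> B = colored_perm_mat m n (u \<circ> v) (\<lambda>j. b (v j) + c j)"
        using colored_perm_mat_mult[OF AB(5)] AB by simp
      show "Q (u \<circ> v) (\<lambda>j. b (v j) + c j)" by (rule colored_subgroup_mult[OF Q, OF AB(1,5,4,8)])
    qed
  qed
  from this[OF A] obtain u' b' where u': "u' permutes {1..n}"
    "colored_perm_mat m n u b = colored_perm_mat m n u' b'" "Q u' b'" by blast
  then have "u = u'" "\<forall>j\<in>{1..n}. [b j = b' j] (mod int m)"
    using colored_perm_mat_eq_iff[OF mp(1) u u'(1)] by auto
  then show ?thesis using colored_subgroup_cong[OF Q, OF u'(3)] cong_sym by blast
qed

text \<open>
  The next three predicates are the obstructions to generation: permutations that preserve the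
  components of a graph, colors that are multiples of \<open>f\<close>, and colorings that are coboundaries modulo \<open>q\<close>.
\<close>

lemma colored_subgroup_links: "colored_subgroup m n (\<lambda>u b. \<forall>j. (j, u j) \<in> links E)"
  unfolding colored_subgroup_def
proof (intro conjI allI impI)
  fix u v :: "nat \<Rightarrow> nat" and j assume "\<forall>j. (j, u j) \<in> links E" "\<forall>j. (j, v j) \<in> links E"
  then show "(j, (u \<circ> v) j) \<in> links E" using links_trans by fastforce
next
  fix u :: "nat \<Rightarrow> nat" and j assume u: "u permutes {1..n}" "\<forall>j. (j, u j) \<in> links E"
  then have "(inv' u j, u (inv' u j)) \<in> links E" by blast
  then show "(j, inv' u j) \<in> links E" using links_sym permutes_inverses(1)[OF u(1)] by metis
qed auto

lemma colored_subgroup_total_color: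
  assumes "f dvd int m"
  shows "colored_subgroup m n (\<lambda>u b. f dvd (\<Sum>j\<in>{1..n}. b j))"
  unfolding colored_subgroup_def
proof (intro conjI allI impI)
  fix u v :: "nat \<Rightarrow> nat" and b c :: "nat \<Rightarrow> int"
  assume "v permutes {1..n}" "f dvd (\<Sum>j\<in>{1..n}. b j)" "f dvd (\<Sum>j\<in>{1..n}. c j)"
  then show "f dvd (\<Sum>j\<in>{1..n}. b (v j) + c j)" using color_reindex[of v n b] by (simp add: sum.distrib)
next
  fix u :: "nat \<Rightarrow> nat" and b :: "nat \<Rightarrow> int"
  assume "u permutes {1..n}" "f dvd (\<Sum>j\<in>{1..n}. b j)"
  then show "f dvd (\<Sum>j\<in>{1..n}. - b (inv' u j))"
    using color_reindex[OF permutes_inv, of u n b] by (simp add: sum_negf)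
next
  fix b c :: "nat \<Rightarrow> int"
  assume b: "f dvd (\<Sum>j\<in>{1..n}. b j)" and bc: "\<forall>j\<in>{1..n}. [b j = c j] (mod int m)"
  have "[(\<Sum>j\<in>{1..n}. b j) = (\<Sum>j\<in>{1..n}. c j)] (mod int m)" by (rule cong_sum) (use bc in blast)
  then have "[(\<Sum>j\<in>{1..n}. b j) = (\<Sum>j\<in>{1..n}. c j)] (mod f)" using assms by (rule cong_dvd_modulus)
  then show "f dvd (\<Sum>j\<in>{1..n}. c j)" using b cong_dvd_iff by blast
qed simp

lemma colored_subgroup_coboundary:
  assumes "int q dvd int m"
  shows "colored_subgroup m n (\<lambda>u b. \<forall>j\<in>{1..n}. [b j = \<psi> (u j) - \<psi> j] (mod int q))"
  unfolding colored_subgroup_def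
proof (intro conjI allI impI ballI)
  fix u v :: "nat \<Rightarrow> nat" and b c j
  assume v: "v permutes {1..n}" and b: "\<forall>j\<in>{1..n}. [b j = \<psi> (u j) - \<psi> j] (mod int q)"
    and c: "\<forall>j\<in>{1..n}. [c j = \<psi> (v j) - \<psi> j] (mod int q)" and j: "j \<in> {1..n}"
  have "v j \<in> {1..n}" using permutes_in_image[OF v] j by simp
  then have "[b (v j) + c j = (\<psi> (u (v j)) - \<psi> (v j)) + (\<psi> (v j) - \<psi> j)] (mod int q)"
    using b c j by (intro cong_add) auto
  then show "[b (v j) + c j = \<psi> ((u \<circ> v) j) - \<psi> j] (mod int q)" by simp
next
  fix u :: "nat \<Rightarrow> nat" and b j
  assume u: "u permutes {1..n}" and b: "\<forall>j\<in>{1..n}. [b j = \<psi> (u j) - \<psi> j] (mod int q)" and j: "j \<in> {1..n}"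
  have "inv' u j \<in> {1..n}" using permutes_in_image[OF permutes_inv[OF u]] j by simp
  then have "[b (inv' u j) = \<psi> (u (inv' u j)) - \<psi> (inv' u j)] (mod int q)" using b by blast
  then have "[b (inv' u j) = \<psi> j - \<psi> (inv' u j)] (mod int q)" by (simp only: permutes_inverses(1)[OF u])
  then have "[- b (inv' u j) = - (\<psi> j - \<psi> (inv' u j))] (mod int q)" by (simp only: cong_minus_minus_iff)
  then show "[- b (inv' u j) = \<psi> (inv' u j) - \<psi> j] (mod int q)" by simp
next
  fix u :: "nat \<Rightarrow> nat" and b c j
  assume b: "\<forall>j\<in>{1..n}. [b j = \<psi> (u j) - \<psi> j] (mod int q)" and bc: "\<forall>j\<in>{1..n}. [b j = c j] (mod int m)"
    and j: "j \<in> {1..n}"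
  have "[c j = b j] (mod int q)" using cong_sym[OF cong_dvd_modulus[OF bspec[OF bc j] assms]] .
  then show "[c j = \<psi> (u j) - \<psi> j] (mod int q)" by (rule cong_trans) (use b j in blast)
qed simp

text \<open>
  If a condition fails, then the letters lie in one of the three subgroups above, which misses an
  uncolored transposition, a diagonal matrix of color \<open>p\<close>, or the diagonal matrix with exponents
  \<open>1\<close> and \<open>-1\<close> at two points, respectively. The last one requires two points; for \<open>n = 1\<close> there is no \<open>q > 1\<close>
  to exclude, as then \<open>p = 1\<close>. The converse is \<open>colored_subgroup_eq_all\<close>.
\<close>

theorem word_mats_generate_iff:
  assumes mp: "m > 0" "p > 0" "p dvd m" and n: "n > 0" and np: "n \<noteq> 1 \<or> p = 1"
    and sk: "\<forall>s\<in>set sk. refl_letter m p n s"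
  shows "generate (Gmpn m p n) (set (word_mats m n sk x)) = carrier (Gmpn m p n) \<longleftrightarrow>
    linked n (edges_of sk) \<and> Gcd (insert (int m) (diag_label ` set sk)) = int p \<and> nondegenerate p sk x"
    (is "?H = ?G \<longleftrightarrow> _")
proof -
  interpret group "Gmpn m p n" by (rule group_Gmpn[OF mp])
  let ?T = "set (word_mats m n sk x)"
  have on: "\<forall>s\<in>set sk. letter_on n s" using sk refl_letter_on by blast
  have T_elem: "\<exists>i<length sk. t = letter_mat m n (sk ! i) (x i)" if "t \<in> ?T" for t
    using that by (auto simp: set_conv_nth nth_word_mats)
  have T_mem: "letter_mat m n (sk ! i) (x i) \<in> ?T" if "i < length sk" for i
    using that nth_word_mats[OF that, of m n x] nth_mem[of i "word_mats m n sk x"] by simp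
  have T_carrier: "?T \<subseteq> ?G"
    using T_elem letter_mat_in_reflections[OF mp] sk by fastforce
  have mem: "colored_perm_mat m n u b \<in> ?G \<longleftrightarrow> int p dvd (\<Sum>j\<in>{1..n}. b j)" if "u permutes {1..n}" for u b
    using colored_perm_mat_in_Gmpn_iff[OF mp that] by (simp add: color_def)
  have invariant: "Q u b"
    if full: "?H = ?G" and Q: "colored_subgroup m n Q"
      and gen: "\<And>i. i < length sk \<Longrightarrow> Q (letter_perm (sk ! i)) (letter_color (sk ! i) (x i))"
      and u: "u permutes {1..n}" and b: "int p dvd (\<Sum>j\<in>{1..n}. b j)" for Q u b
  proof (rule generate_invariant[OF mp Q _ _ u])
    show "colored_perm_mat m n u b \<in> ?H" using full mem[OF u] b by simp
    fix t assume "t \<in> ?T"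
    then obtain i where i: "i < length sk" "t = letter_mat m n (sk ! i) (x i)" using T_elem by blast
    have s: "refl_letter m p n (sk ! i)" using sk nth_mem[OF i(1)] by blast
    have "int p dvd color (letter_color (sk ! i) (x i)) {1..n}"
      unfolding color_def sum_letter_color[OF refl_letter_on[OF s]] by (rule refl_letter_dvd[OF s])
    then show "\<exists>u b. u permutes {1..n} \<and> int p dvd color b {1..n} \<and> t = colored_perm_mat m n u b \<and> Q u b"
      using i letter_perm_permutes[OF refl_letter_on[OF s]] gen[OF i(1)] unfolding letter_mat_def by blast
  qed
  show ?thesis
  proof
    assume full: "?H = ?G"
    have "linked n (edges_of sk)"
      unfolding linked_def
    proof (rule subrelI)
      fix v w assume vw: "(v, w) \<in> {1..n} \<times> {1..n}"
      have "\<forall>j. (j, Transposition.transpose v w j) \<in> links (edges_of sk)"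
      proof (rule invariant[OF full colored_subgroup_links, where b = "\<lambda>_. 0"])
        fix i assume "i < length sk"
        then have i: "sk ! i \<in> set sk" by simp
        show "\<forall>j. (j, letter_perm (sk ! i) j) \<in> links (edges_of sk)"
        proof (cases "sk ! i" rule: letter_cases)
          case (edge a c)
          then have "(a, c) \<in> links (edges_of sk)" using i by (intro links_edge) (simp add: edges_of_def)
          then show ?thesis using links_sym by (auto simp: edge transpose_def)
        qed simp
      qed (use vw in \<open>auto intro: permutes_swap_id\<close>)
      then have "(v, Transposition.transpose v w v) \<in> links (edges_of sk)" by blast
      then show "(v, w) \<in> links (edges_of sk)" by simp
    qed
    moreover have "Gcd (insert (int m) (diag_label ` set sk)) = int p" (is "?f = _")
    proof -
      have f_m: "?f dvd int m" by (rule Gcd_dvd) simp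
      have "?f dvd (\<Sum>j\<in>{1..n}. int p * of_bool (j = 1))"
      proof (rule invariant[OF full colored_subgroup_total_color[OF f_m] _ permutes_id])
        fix i assume i: "i < length sk"
        have "diag_label (sk ! i) \<in> insert (int m) (diag_label ` set sk)" using i by simp
        then show "?f dvd (\<Sum>j\<in>{1..n}. letter_color (sk ! i) (x i) j)"
          using sum_letter_color[of n "sk ! i" "x i"] on i by (simp add: Gcd_dvd del: Gcd_insert)
      qed (simp add: sum_distrib_left[symmetric])
      also have "(\<Sum>j\<in>{1..n}. int p * of_bool (j = 1)) = (\<Sum>j\<in>{1..n}. if j = 1 then int p else 0)"
        by (rule sum.cong) auto
      also have "\<dots> = int p" using n by simp
      finally have "?f dvd int p" .
      moreover have "int p dvd ?f"
        using mp(3) sk refl_letter_dvd by (intro Gcd_greatest) auto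
      ultimately show ?thesis by (intro zdvd_antisym_nonneg) simp_all
    qed
    moreover have "nondegenerate p sk x"
      unfolding nondegenerate_def
    proof (intro allI impI)
      fix q \<psi> assume q: "q dvd p" and \<psi>: "potential q \<psi> sk x"
      show "q = 1"
      proof (cases "n = 1")
        case True
        then show ?thesis using np q by simp
      next
        case False
        have qm: "int q dvd int m" using dvd_trans[OF q mp(3)] by simp
        have "\<forall>j\<in>{1..n}. [unit_diff 1 2 1 j = \<psi> (id j) - \<psi> j] (mod int q)"
        proof (rule invariant[OF full colored_subgroup_coboundary[OF qm] _ permutes_id])
          fix i assume i: "i < length sk"
          show "\<forall>j\<in>{1..n}. [letter_color (sk ! i) (x i) j = \<psi> (letter_perm (sk ! i) j) - \<psi> j] (mod int q)"
          proof (cases "sk ! i" rule: letter_cases)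
            case (edge v w)
            have xi: "[x i = \<psi> w - \<psi> v] (mod int q)" using \<psi> i edge unfolding potential_iff by blast
            then have "[- x i = - (\<psi> w - \<psi> v)] (mod int q)" by (simp only: cong_minus_minus_iff)
            then have "[- x i = \<psi> v - \<psi> w] (mod int q)" by simp
            then show ?thesis using xi by (auto simp: edge transpose_def)
          next
            case (diag l e)
            have "int p dvd e" using sk nth_mem[OF i] by (auto simp: diag)
            then have "int q dvd e" using q by (meson dvd_trans int_dvd_int_iff)
            then show ?thesis by (simp add: diag cong_0_iff)
          qed
        next
          have "(\<Sum>j\<in>{1..n}. unit_diff 1 2 1 j) = (\<Sum>j\<in>{1..n}. (if j = 1 then 1 else 0) + (if j = 2 then - 1 else 0))"
            by (rule sum.cong) (auto simp: unit_diff_def)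
          also have "\<dots> = 0" using n False by (simp add: sum.distrib)
          finally show "int p dvd (\<Sum>j\<in>{1..n}. unit_diff 1 2 1 j)" by simp
        qed
        then have "[unit_diff 1 2 1 1 = \<psi> (id 1) - \<psi> 1] (mod int q)" using n by fastforce
        then have "int q dvd 1" by (simp add: unit_diff_def cong_iff_dvd_diff)
        then show ?thesis by simp
      qed
    qed
    ultimately show "linked n (edges_of sk) \<and> Gcd (insert (int m) (diag_label ` set sk)) = int p \<and> nondegenerate p sk x"
      by blast
  next
    assume crit: "linked n (edges_of sk) \<and> Gcd (insert (int m) (diag_label ` set sk)) = int p \<and> nondegenerate p sk x"
    define P where "P = (\<lambda>u b. colored_perm_mat m n u b \<in> ?H)"
    have P: "colored_subgroup m n P"
      unfolding colored_subgroup_def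
    proof (intro conjI allI impI)
      show "P id (\<lambda>_. 0)" unfolding P_def colored_perm_mat_one using generate.one[of "Gmpn m p n" ?T] by simp
    next
      fix u v b c assume "u permutes {1..n}" "v permutes {1..n}" "P u b" "P v c"
      then show "P (u \<circ> v) (\<lambda>j. b (v j) + c j)"
        unfolding P_def colored_perm_mat_mult[OF \<open>v permutes {1..n}\<close>, symmetric]
        using generate.eng[of _ "Gmpn m p n" ?T] by fastforce
    next
      fix u b assume u: "u permutes {1..n}" and b: "P u b"
      then have "colored_perm_mat m n u b \<in> ?G" unfolding P_def using generate_incl[OF T_carrier] by blast
      then have "int p dvd color b {1..n}" using mem[OF u] by (simp add: color_def)
      from Gmpn_inv[OF mp u this]
      show "P (inv' u) (\<lambda>j. - b (inv' u j))"
        using generate_m_inv_closed[OF T_carrier b[unfolded P_def]] unfolding P_def by simp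
    next
      fix u b c assume "P u b" "\<forall>j\<in>{1..n}. [b j = c j] (mod int m)"
      then show "P u c" unfolding P_def using colored_perm_mat_cong[OF mp(1), of n b c u] by simp
    qed
    have "A \<in> ?H" if A_G: "A \<in> ?G" for A
    proof -
      obtain u b where u: "u permutes {1..n}" and b: "int p dvd color b {1..n}" and A: "A = colored_perm_mat m n u b"
        using A_G unfolding mem_Gmpn_iff[OF mp] by blast
      have "P u b"
      proof (rule colored_subgroup_eq_all[OF P, OF mp(1) n on])
        fix i assume "i < length sk"
        then show "P (letter_perm (sk ! i)) (letter_color (sk ! i) (x i))"
          using generate.incl[OF T_mem, of i "Gmpn m p n"] unfolding P_def letter_mat_def by simp
      qed (use crit u b in \<open>auto simp: color_def\<close>)
      then show ?thesis unfolding P_def A .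
    qed
    then show "?H = ?G" using generate_incl[OF T_carrier] by blast
  qed
qed

section \<open>Factorizations into transpositions as words of edges\<close>

definition edges :: "nat \<Rightarrow> (nat \<times> nat) set" where
  "edges n = {(v, w). v \<in> {1..n} \<and> w \<in> {1..n} \<and> v < w}"

definition edge_factorizations :: "nat \<Rightarrow> (nat \<Rightarrow> nat) \<Rightarrow> nat \<Rightarrow> (nat \<times> nat) list set" where
  "edge_factorizations n u c =
     {es. length es = c \<and> set es \<subseteq> edges n \<and> linked n (set es) \<and> word_perm (map Inl es) = u}"

definition mk_edge :: "nat \<Rightarrow> nat \<Rightarrow> nat \<times> nat" where
  "mk_edge a b = (min a b, max a b)"

lemma finite_edges [simp]: "finite (edges n)"
  by (rule finite_subset[of _ "{1..n} \<times> {1..n}"]) (auto simp: edges_def)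

lemma finite_edge_factorizations [simp]: "finite (edge_factorizations n u c)"
  by (rule finite_subset[OF _ finite_lists_length_eq[OF finite_edges, of n c]])
    (auto simp: edge_factorizations_def)

lemma mk_edge_in: "a \<in> {1..n} \<Longrightarrow> b \<in> {1..n} \<Longrightarrow> a \<noteq> b \<Longrightarrow> mk_edge a b \<in> edges n"
  by (auto simp: mk_edge_def edges_def min_def max_def)

lemma letter_perm_mk_edge: "letter_perm (Inl (mk_edge a b)) = Transposition.transpose a b"
  by (auto simp: mk_edge_def min_def max_def transpose_commute)

lemma links_mk_edge: "mk_edge a b \<in> E \<Longrightarrow> (a, b) \<in> links E"
  using links_edge[of "mk_edge a b" E] links_sym[of b a E] by (auto simp: mk_edge_def min_def max_def split: if_splits)

lemma edges_letter_on: "set es \<subseteq> edges n \<Longrightarrow> \<forall>s\<in>set (map Inl es). letter_on n s"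
  by (auto simp: edges_def)

lemma edges_of_map_Inl [simp]: "edges_of (map Inl es) = set es"
  by (auto simp: edges_of_def)

lemma word_perm_append: "word_perm (xs @ ys) = word_perm xs \<circ> word_perm ys"
  by (induction xs) (simp_all add: comp_assoc)

section \<open>Conjugation of edge words\<close>

lemma transpose_conjugate:
  assumes "bij \<pi>"
  shows "Transposition.transpose (\<pi> v) (\<pi> w) \<circ> \<pi> = \<pi> \<circ> Transposition.transpose v w"
  using assms by (auto simp: fun_eq_iff transpose_def bij_def inj_eq)

lemma card_edge_factorizations_conjugate_le:
  assumes \<pi>: "\<pi> permutes {1..n}" and comm: "u \<circ> \<pi> = \<pi> \<circ> s"
  shows "card (edge_factorizations n s c) \<le> card (edge_factorizations n u c)"
proof -
  have bij: "bij \<pi>" using permutes_bij[OF \<pi>] .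
  have inj: "\<pi> a = \<pi> b \<longleftrightarrow> a = b" for a b using permutes_inj[OF \<pi>] by (simp add: inj_eq)
  have mem: "\<pi> a \<in> {1..n} \<longleftrightarrow> a \<in> {1..n}" for a using permutes_in_image[OF \<pi>] .
  define f where "f e = mk_edge (\<pi> (fst e)) (\<pi> (snd e))" for e
  have f_in: "f e \<in> edges n" if "e \<in> edges n" for e
    using that mem inj unfolding f_def by (intro mk_edge_in) (auto simp: edges_def)
  have inj_f: "inj_on f (edges n)"
    by (rule inj_onI) (auto simp: f_def mk_edge_def edges_def min_def max_def inj split: if_splits)
  have perm: "word_perm (map Inl (map f es)) \<circ> \<pi> = \<pi> \<circ> word_perm (map Inl es)" for es
  proof (induction es)
    case (Cons e es)
    have "word_perm (map Inl (map f (e # es))) \<circ> \<pi>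
        = letter_perm (Inl (f e)) \<circ> (word_perm (map Inl (map f es)) \<circ> \<pi>)"
      by (simp add: comp_assoc)
    also have "\<dots> = (Transposition.transpose (\<pi> (fst e)) (\<pi> (snd e)) \<circ> \<pi>) \<circ> word_perm (map Inl es)"
      unfolding Cons.IH f_def letter_perm_mk_edge by (simp only: comp_assoc)
    also have "\<dots> = \<pi> \<circ> word_perm (map Inl (e # es))"
      unfolding transpose_conjugate[OF bij] by (cases e) (simp add: comp_assoc)
    finally show ?case .
  qed simp
  show ?thesis
  proof (rule card_inj_on_le[of "map f"])
    have "edge_factorizations n s c \<subseteq> lists (edges n)" by (auto simp: edge_factorizations_def)
    then show "inj_on (map f) (edge_factorizations n s c)"
      using inj_on_subset[OF inj_on_mapI] inj_f
      by (intro inj_on_mapI inj_on_subset[OF inj_f]) (auto simp: edge_factorizations_def)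
    show "map f ` edge_factorizations n s c \<subseteq> edge_factorizations n u c"
    proof
      fix es' assume "es' \<in> map f ` edge_factorizations n s c"
      then obtain es where es: "es \<in> edge_factorizations n s c" "es' = map f es" by blast
      have "word_perm (map Inl es') \<circ> \<pi> = u \<circ> \<pi>"
        using perm[of es] es comm by (simp add: edge_factorizations_def)
      then have "word_perm (map Inl es') = u"
        using bij_is_surj[OF bij] by (metis comp_apply ext surj_def)
      moreover have "linked n (set es')"
        unfolding linked_def
      proof (rule subrelI)
        fix v w assume vw: "(v, w) \<in> {1..n} \<times> {1..n}"
        have "(\<pi> a, \<pi> b) \<in> links (f ` set es)" if "(a, b) \<in> links (set es)" for a b
          using that
        proof (induction a b rule: links_induct)
          case (edge a b)
          then have "mk_edge (\<pi> a) (\<pi> b) \<in> f ` set es" by (force simp: f_def)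
          then show ?case by (rule links_mk_edge)
        qed (auto intro: links_sym links_trans)
        moreover obtain a b where ab: "v = \<pi> a" "w = \<pi> b" using bij by (metis bij_pointE)
        moreover have "a \<in> {1..n}" "b \<in> {1..n}" using vw ab mem[of a] mem[of b] by simp_all
        then have "(a, b) \<in> links (set es)"
          using es(1) unfolding edge_factorizations_def linked_def by blast
        ultimately show "(v, w) \<in> links (set es')" using es(2) by simp
      qed
      ultimately show "es' \<in> edge_factorizations n u c"
        using es f_in by (auto simp: edge_factorizations_def)
    qed
  qed simp
qed

lemma card_edge_factorizations_conjugate:
  assumes \<pi>: "\<pi> permutes {1..n}" and comm: "u \<circ> \<pi> = \<pi> \<circ> s"
  shows "card (edge_factorizations n s c) = card (edge_factorizations n u c)"
proof (rule antisym)
  show "card (edge_factorizations n s c) \<le> card (edge_factorizations n u c)"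
    by (rule card_edge_factorizations_conjugate_le[OF \<pi> comm])
  have "s \<circ> inv' \<pi> = (inv' \<pi> \<circ> \<pi>) \<circ> s \<circ> inv' \<pi>" by (simp add: permutes_inv_o[OF \<pi>])
  also have "\<dots> = inv' \<pi> \<circ> (u \<circ> \<pi>) \<circ> inv' \<pi>" by (simp only: comm comp_assoc)
  also have "\<dots> = inv' \<pi> \<circ> u \<circ> (\<pi> \<circ> inv' \<pi>)" by (simp only: comp_assoc)
  also have "\<dots> = inv' \<pi> \<circ> u" by (simp add: permutes_inv_o[OF \<pi>])
  finally show "card (edge_factorizations n u c) \<le> card (edge_factorizations n s c)"
    by (rule card_edge_factorizations_conjugate_le[OF permutes_inv[OF \<pi>]])
qed

lemma card_orbit:
  assumes "r \<in> Orbits.orbit u r"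
  shows "card (Orbits.orbit u r) = funpow_dist1 u r r"
  unfolding orbit_conv_funpow_dist1[OF assms]
  using card_image[OF inj_on_funpow_dist1[OF assms]] by simp

text \<open>
  Match the cycles of \<open>s\<close> with cycles of \<open>u\<close> of the same size, choose a representative in each,
  and let \<open>\<pi>\<close> follow \<open>s\<close> and \<open>u\<close> simultaneously from the representatives. Where a cycle of \<open>s\<close> closes,
  the matching cycle of \<open>u\<close> closes as well because the sizes agree.
\<close>

lemma same_cycle_type_conjugate:
  assumes s: "s permutes {1..n}" and u: "u permutes {1..n}" and type: "cycle_type n s = cycle_type n u"
  shows "\<exists>\<pi>. \<pi> permutes {1..n} \<and> u \<circ> \<pi> = \<pi> \<circ> s"
proof -
  let ?S = "cycle_supports n s" and ?U = "cycle_supports n u"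
  have "size (cycle_type n s) = size (cycle_type n u)" by (simp add: type)
  then have card_eq: "card ?S = card ?U" by (simp add: cycle_type_def)
  obtain g where g: "bij_betw g {..<card ?S} ?S"
    using ex_bij_betw_nat_finite[of ?S] by (auto simp: atLeast0LessThan)
  obtain g' where g': "bij_betw g' {..<card ?S} ?U"
    using ex_bij_betw_nat_finite[of ?U] card_eq by (auto simp: atLeast0LessThan)
  have "image_mset card (mset_set ?S) = image_mset (card \<circ> g) (mset_set {..<card ?S})"
    using g image_mset_mset_set[of g "{..<card ?S}"] by (simp add: bij_betw_def flip: image_mset.comp multiset.map_comp)
  moreover have "image_mset card (mset_set ?U) = image_mset (card \<circ> g') (mset_set {..<card ?S})"
    using g' image_mset_mset_set[of g' "{..<card ?S}"] by (simp add: bij_betw_def flip: image_mset.comp multiset.map_comp)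
  ultimately have "image_mset (card \<circ> g) (mset_set {..<card ?S}) = image_mset (card \<circ> g') (mset_set {..<card ?S})"
    using type by (simp add: cycle_type_def)
  then obtain p where p: "p permutes {..<card ?S}" "\<forall>i\<in>{..<card ?S}. (card \<circ> g) i = (card \<circ> g') (p i)"
    using image_mset_eq_implies_permutes[of "{..<card ?S}" "card \<circ> g" "card \<circ> g'"] by auto
  define f where "f = (\<lambda>C. g' (p (inv_into {..<card ?S} g C)))"
  have f: "f C \<in> ?U \<and> card (f C) = card C" if "C \<in> ?S" for C
  proof -
    let ?i = "inv_into {..<card ?S} g C"
    have i: "?i \<in> {..<card ?S}" "g ?i = C"
      using that g by (metis bij_betw_def inv_into_into, metis bij_betw_inv_into_right)
    then have "p ?i \<in> {..<card ?S}" using permutes_in_image[OF p(1)] by blast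
    then have "g' (p ?i) \<in> ?U" using g' by (auto simp: bij_betw_def)
    moreover have "card (g' (p ?i)) = card (g ?i)" using p(2) i(1) by simp
    ultimately show ?thesis using i(2) by (simp add: f_def)
  qed
  have f_surj: "\<exists>C\<in>?S. f C = D" if D: "D \<in> ?U" for D
  proof -
    obtain i where i: "i \<in> {..<card ?S}" "g' i = D" using D g' by (metis bij_betw_def imageE)
    then obtain l where l: "l \<in> {..<card ?S}" "p l = i"
      using permutes_image[OF p(1)] by (metis imageE)
    have "f (g l) = D" using l i g by (simp add: f_def bij_betw_inv_into_left)
    moreover have "g l \<in> ?S" using l g by (auto simp: bij_betw_def)
    ultimately show ?thesis by blast
  qed
  define rep where "rep C = (SOME x. x \<in> C)" for C :: "nat set"
  have rep: "rep (Orbits.orbit w x) \<in> Orbits.orbit w x" if "w permutes {1..n}" for w x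
    unfolding rep_def by (rule someI[of "\<lambda>y. y \<in> Orbits.orbit w x", OF permutes_self_in_orbit[OF that]])
  define orb where "orb x = Orbits.orbit s x" for x
  define \<pi> where "\<pi> x = (if x \<in> {1..n} then (u ^^ funpow_dist s (rep (orb x)) x) (rep (f (orb x))) else x)" for x
  have o_in: "orb x \<in> ?S" if "x \<in> {1..n}" for x using that by (simp add: orb_def cycle_supports_def)
  have orbit_in: "x \<in> {1..n}" if "y \<in> {1..n}" "x \<in> Orbits.orbit w y" "w permutes {1..n}" for x y w
    using invariant_on_orbit[OF that(3), of "\<lambda>_. 0::nat" y x] that by simp
  have f_orbit: "f (orb x) = Orbits.orbit u (rep (f (orb x)))" "rep (f (orb x)) \<in> {1..n}" if x: "x \<in> {1..n}" for x
  proof -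
    obtain y where y: "y \<in> {1..n}" "f (orb x) = Orbits.orbit u y"
      using f[OF o_in[OF x]] unfolding cycle_supports_def by blast
    show "f (orb x) = Orbits.orbit u (rep (f (orb x)))" "rep (f (orb x)) \<in> {1..n}"
      using permutes_orbit_eq[OF u rep[OF u, of y]] orbit_in[OF y(1) rep[OF u] u] y(2) by auto
  qed
  have x_in: "x \<in> Orbits.orbit s (rep (orb x))" "orb x = Orbits.orbit s (rep (orb x))" for x
    using permutes_orbit_eq[OF s rep[OF s, of x]] permutes_self_in_orbit[OF s, of x] by (simp_all add: orb_def)
  have step: "\<pi> (s x) = u (\<pi> x)" if x: "x \<in> {1..n}" for x
  proof -
    have sx: "s x \<in> {1..n}" using permutes_in_image[OF s] x by simp
    have o_sx: "orb (s x) = orb x" unfolding orb_def by (rule permutes_orbit_step[OF s])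
    show ?thesis
    proof (cases "s x = rep (orb x)")
      case False
      show ?thesis
        using funpow_dist_to_image[OF permutes_inj[OF s] x_in(1) False] x sx by (simp add: \<pi>_def o_sx)
    next
      case True
      let ?r = "rep (f (orb x))"
      have "card (orb x) = Suc (funpow_dist s (rep (orb x)) x)"
        using card_orbit[OF permutes_self_in_orbit[OF s]] x_in(2)[of x]
          funpow_dist_closing[OF permutes_inj[OF s] x_in(1) True] by metis
      moreover have "card (f (orb x)) = funpow_dist1 u ?r ?r"
        using card_orbit[OF permutes_self_in_orbit[OF u]] f_orbit(1)[OF x] by metis
      ultimately have "Suc (funpow_dist s (rep (orb x)) x) = funpow_dist1 u ?r ?r"
        using f[OF o_in[OF x]] by simp
      then have "(u ^^ Suc (funpow_dist s (rep (orb x)) x)) ?r = ?r"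
        using funpow_dist1_prop[OF permutes_self_in_orbit[OF u]] by metis
      then have "u (\<pi> x) = ?r" using x by (simp add: \<pi>_def)
      moreover have "\<pi> (s x) = ?r"
        using sx by (simp add: \<pi>_def o_sx funpow_dist_0[OF True[symmetric]])
      ultimately show ?thesis by simp
    qed
  qed
  have \<pi>_in: "\<pi> x \<in> {1..n}" if x: "x \<in> {1..n}" for x
  proof -
    have "(u ^^ t) y \<in> {1..n}" if "y \<in> {1..n}" for t y
      using that permutes_in_image[OF u] by (induction t) auto
    then show ?thesis using f_orbit(2)[OF x] x by (simp add: \<pi>_def)
  qed
  have "{1..n} \<subseteq> \<pi> ` {1..n}"
  proof
    fix y assume y: "y \<in> {1..n}"
    then have "Orbits.orbit u y \<in> ?U" by (simp add: cycle_supports_def)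
    then obtain C where C: "C \<in> ?S" "f C = Orbits.orbit u y" using f_surj by blast
    then obtain x0 where x0: "x0 \<in> {1..n}" "C = orb x0" by (auto simp: cycle_supports_def orb_def)
    define r where "r = rep (orb x0)"
    have r: "r \<in> {1..n}" "orb r = orb x0"
      using orbit_in[OF x0(1) rep[OF s] s] permutes_orbit_eq[OF s rep[OF s, of x0]]
      by (simp_all add: r_def orb_def)
    have \<pi>r: "\<pi> r = rep (f (orb x0))"
      using r by (simp add: \<pi>_def r_def[symmetric] funpow_dist_0)
    have "y \<in> Orbits.orbit u (\<pi> r)"
      using permutes_self_in_orbit[OF u, of y] f_orbit(1)[OF x0(1)] C(2) x0(2) \<pi>r by simp
    then show "y \<in> \<pi> ` {1..n}"
    proof (induction rule: Orbits.orbit.induct)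
      case base
      then show ?case using step[OF r(1)] permutes_in_image[OF s, of r] r(1) by (metis imageI)
    next
      case (step y)
      then obtain x where "x \<in> {1..n}" "y = \<pi> x" by blast
      then show ?case using \<open>\<And>x. x \<in> {1..n} \<Longrightarrow> \<pi> (s x) = u (\<pi> x)\<close> permutes_in_image[OF s, of x] by (metis imageI)
    qed
  qed
  then have "bij_betw \<pi> {1..n} {1..n}"
    using \<pi>_in unfolding bij_betw_def by (metis finite_atLeastAtMost eq_card_imp_inj_on image_subsetI subset_antisym)
  then have "\<pi> permutes {1..n}" by (rule bij_imp_permutes) (auto simp: \<pi>_def)
  moreover have "u \<circ> \<pi> = \<pi> \<circ> s"
  proof
    fix x show "(u \<circ> \<pi>) x = (\<pi> \<circ> s) x"
    proof (cases "x \<in> {1..n}")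
      case True
      then show ?thesis by (simp add: step)
    next
      case False
      then show ?thesis using permutes_not_in[OF s False] permutes_not_in[OF u False] by (auto simp: \<pi>_def)
    qed
  qed
  ultimately show ?thesis by blast
qed

section \<open>Transitivity and Hurwitz numbers\<close>

lemma generates_transitive_iff_linked:
  assumes E: "E \<subseteq> edges n"
  shows "generates_transitive n ((\<lambda>e. letter_perm (Inl e)) ` E) \<longleftrightarrow> linked n E" (is "generates_transitive n ?T \<longleftrightarrow> _")
proof
  assume tr: "generates_transitive n ?T"
  have "\<forall>j. (j, letter_perm (Inl e) j) \<in> links E" if "e \<in> E" for e
    using word_perm_links[of _ "[Inl e]"] links_mono[of "{e}" E] that by auto
  then have gen: "\<forall>j. (j, t j) \<in> links E" if "t \<in> ?T" for t using that by blast
  have T: "t permutes {1..n}" if "t \<in> ?T" for t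
    using that E letter_perm_permutes[of n] by (auto simp: edges_def simp del: letter_perm.simps)
  have "s permutes {1..n} \<and> (\<forall>j. (j, s j) \<in> links E)" if "s \<in> generate (sym_group n) ?T" for s
    using that
  proof (induction rule: generate.induct)
    case one
    have "id permutes {1..n}" by (rule permutes_id)
    moreover have "\<forall>j. (j, id j) \<in> links E" by simp
    ultimately show ?case unfolding sym_group_one by blast
  next
    case (incl t)
    then show ?case using gen T by blast
  next
    case (inv t)
    have t: "t permutes {1..n}" using T[OF inv] .
    have "inv\<^bsub>sym_group n\<^esub> t = inv' t"
      by (rule sym_group_inv_equality) (use t in \<open>simp add: sym_group_carrier\<close>)
    moreover have "(j, inv' t j) \<in> links E" for j
    proof -
      have "(inv' t j, t (inv' t j)) \<in> links E" using gen[OF inv] by blast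
      then show ?thesis using links_sym by (simp add: permutes_inverses[OF t])
    qed
    ultimately show ?case using permutes_inv[OF t] by simp
  next
    case (eng s t)
    have "s \<circ> t permutes {1..n}" by (rule permutes_compose) (use eng.IH in blast)+
    moreover have "(j, (s \<circ> t) j) \<in> links E" for j
      using links_trans[of j "t j" E "s (t j)"] eng.IH by simp
    ultimately show ?case unfolding sym_group_mult by blast
  qed
  then have "(v, w) \<in> links E" if "v \<in> {1..n}" "w \<in> {1..n}" for v w
    using tr that unfolding generates_transitive_def by metis
  then show "linked n E" unfolding linked_def by auto
next
  assume linked: "linked n E"
  show "generates_transitive n ?T"
    unfolding generates_transitive_def
  proof (intro ballI)
    fix v w assume vw: "v \<in> {1..n}" "w \<in> {1..n}"
    then have "(v, w) \<in> (E \<union> E\<inverse>)\<^sup>*" using linked by (auto simp: linked_def links_def)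
    then show "\<exists>s\<in>generate (sym_group n) ?T. s v = w"
    proof (induction rule: rtrancl_induct)
      case base
      have "id \<in> generate (sym_group n) ?T"
        using generate.one[of "sym_group n" ?T] unfolding sym_group_one .
      then show ?case by (rule bexI[rotated]) simp
    next
      case (step y z)
      then obtain s where s: "s \<in> generate (sym_group n) ?T" "s v = y" by blast
      obtain e where e: "e \<in> E" "letter_perm (Inl e) y = z" using step.hyps(2) by force
      have "letter_perm (Inl e) \<in> generate (sym_group n) ?T" using e by (intro generate.incl) blast
      from generate.eng[OF this s(1)] show ?case using s(2) e(2)
        by (intro bexI[of _ "letter_perm (Inl e) \<circ> s"]) (simp_all add: sym_group_mult)
    qed
  qed
qed

lemma card_transposition_factorizations:
  "card {ts. set ts \<subseteq> transpositions n \<and> length ts = c \<and> foldr (\<circ>) ts id = u \<and> generates_transitive n (set ts)}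
     = card (edge_factorizations n u c)"
proof -
  let ?t = "\<lambda>e. letter_perm (Inl e)"
  have inj: "inj_on ?t (edges n)"
  proof (rule inj_onI)
    fix e e' assume e: "e \<in> edges n" "e' \<in> edges n" "?t e = ?t e'"
    obtain v w v' w' where vw: "e = (v, w)" "e' = (v', w')" by (cases e; cases e')
    have "Transposition.transpose v w x = Transposition.transpose v' w' x" for x using e(3) vw by simp
    from this[of v] this[of w] show "e = e'" using e(1,2) vw
      by (auto simp: edges_def transpose_def split: if_splits)
  qed
  have img: "?t ` edges n = transpositions n"
  proof (intro Set.set_eqI iffI)
    fix t assume "t \<in> transpositions n"
    then obtain i j where ij: "t = Transposition.transpose i j" "i \<in> {1..n}" "j \<in> {1..n}" "i \<noteq> j"
      unfolding transpositions_def by blast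
    then have "t = ?t (mk_edge i j)" "mk_edge i j \<in> edges n" using letter_perm_mk_edge mk_edge_in by auto
    then show "t \<in> ?t ` edges n" by blast
  next
    fix t assume "t \<in> ?t ` edges n"
    then obtain v w where "t = Transposition.transpose v w" "v \<in> {1..n}" "w \<in> {1..n}" "v < w"
      by (auto simp: edges_def)
    moreover from this have "v \<noteq> w" by simp
    ultimately show "t \<in> transpositions n" unfolding transpositions_def by blast
  qed
  have fold: "foldr (\<circ>) (map ?t es) id = word_perm (map Inl es)" for es
    by (induction es) simp_all
  have "{ts. set ts \<subseteq> transpositions n \<and> length ts = c \<and> foldr (\<circ>) ts id = u \<and> generates_transitive n (set ts)}
      = map ?t ` edge_factorizations n u c" (is "?L = _")
  proof (intro Set.set_eqI iffI)
    fix ts assume ts: "ts \<in> ?L"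
    then have "set ts \<subseteq> ?t ` edges n" unfolding img by blast
    then have "ts \<in> lists (?t ` edges n)" by (auto simp only: in_lists_conv_set)
    then obtain es where es: "set es \<subseteq> edges n" "ts = map ?t es"
      unfolding lists_image by auto
    then have "es \<in> edge_factorizations n u c"
      using ts fold[of es] generates_transitive_iff_linked[OF es(1)] by (auto simp: edge_factorizations_def)
    then show "ts \<in> map ?t ` edge_factorizations n u c" using es(2) by blast
  next
    fix ts assume "ts \<in> map ?t ` edge_factorizations n u c"
    then obtain es where es: "es \<in> edge_factorizations n u c" "ts = map ?t es" by blast
    then have sub: "set es \<subseteq> edges n" by (simp add: edge_factorizations_def)
    have "set ts = ?t ` set es" using es(2) by simp
    then have "set ts \<subseteq> transpositions n" unfolding img[symmetric] using sub by blast
    then show "ts \<in> ?L"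
      using es fold[of es] generates_transitive_iff_linked[OF sub] by (auto simp: edge_factorizations_def)
  qed
  moreover have "inj_on (map ?t) (edge_factorizations n u c)"
    by (intro inj_on_mapI inj_on_subset[OF inj]) (auto simp: edge_factorizations_def)
  ultimately show ?thesis by (simp add: card_image)
qed

lemma cycle_supports_partition:
  assumes u: "u permutes {1..n}"
  shows "\<Union> (cycle_supports n u) = {1..n}" "disjoint (cycle_supports n u)"
proof -
  show "\<Union> (cycle_supports n u) = {1..n}"
  proof
    show "\<Union> (cycle_supports n u) \<subseteq> {1..n}"
      unfolding cycle_supports_def using invariant_on_orbit[OF u, of "\<lambda>_. 0::nat"] by blast
    show "{1..n} \<subseteq> \<Union> (cycle_supports n u)"
      unfolding cycle_supports_def using permutes_self_in_orbit[OF u] by blast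
  qed
  show "disjoint (cycle_supports n u)"
    unfolding disjoint_def
  proof (intro ballI impI)
    fix A B assume AB: "A \<in> cycle_supports n u" "B \<in> cycle_supports n u" "A \<noteq> B"
    obtain x y where xy: "A = Orbits.orbit u x" "B = Orbits.orbit u y"
      using AB unfolding cycle_supports_def by blast
    have False if "z \<in> A" "z \<in> B" for z
      using that AB(3) permutes_orbit_eq[OF u, of z x] permutes_orbit_eq[OF u, of z y] xy by simp
    then show "A \<inter> B = {}" by blast
  qed
qed

lemma sum_mset_cycle_type:
  assumes u: "u permutes {1..n}"
  shows "sum_mset (cycle_type n u) = n"
proof -
  have "finite S" if "S \<in> cycle_supports n u" for S
    using cycle_supports_partition(1)[OF u] that by (metis Union_upper finite_atLeastAtMost finite_subset)
  then have "card (\<Union> (cycle_supports n u)) = (\<Sum>S\<in>cycle_supports n u. card S)"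
    by (intro card_Union_disjoint cycle_supports_partition(2)[OF u])
  then show ?thesis using cycle_supports_partition(1)[OF u] by (simp add: cycle_type_def sum_unfold_sum_mset)
qed

text \<open>
  The Hurwitz number is defined through an unspecified permutation of the given cycle type;
  conjugation carries its factorizations over to those of \<open>u\<close>.
\<close>

theorem hurwitz_eq_card_edge_factorizations:
  assumes u: "u permutes {1..n}"
  shows "hurwitz h (cycle_type n u) =
    card (edge_factorizations n u (n + card (cycle_supports n u) + 2 * h - 2))"
proof -
  define s where "s = (SOME s. s permutes {1..n} \<and> cycle_type n s = cycle_type n u)"
  have s: "s permutes {1..n} \<and> cycle_type n s = cycle_type n u"
    unfolding s_def by (rule someI[of _ u]) (use u in simp)
  then obtain \<pi> where \<pi>: "\<pi> permutes {1..n}" "u \<circ> \<pi> = \<pi> \<circ> s"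
    using same_cycle_type_conjugate[OF _ u] by blast
  have "size (cycle_type n u) = card (cycle_supports n u)" by (simp add: cycle_type_def)
  then have "hurwitz h (cycle_type n u) = card (edge_factorizations n s (n + card (cycle_supports n u) + 2 * h - 2))"
    unfolding hurwitz_def Let_def sum_mset_cycle_type[OF u] s_def[symmetric]
    by (simp only: card_transposition_factorizations)
  then show ?thesis using card_edge_factorizations_conjugate[OF \<pi>] by simp
qed

section \<open>Lengths of factorizations into edges\<close>

lemma card_cycles_id: "card (cycle_supports n id) = n"
proof -
  have "{f \<in> {1..n} \<rightarrow>\<^sub>E {0, 1::nat}. \<forall>x\<in>{1..n}. f (id x) = f x} = {1..n} \<rightarrow>\<^sub>E {0, 1}" by auto
  then have "(2::nat) ^ card (cycle_supports n id) = 2 ^ n"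
    using card_invariant_functions[OF permutes_id, of "{0, 1::nat}" n] by (simp add: card_PiE)
  then show ?thesis by simp
qed

text \<open>
  As \<open>v\<close> fixes \<open>i\<close>, the value at \<open>i\<close> of a \<open>v\<close>-invariant function is free, and the \<open>u\<close>-invariant
  functions are those whose value at \<open>i\<close> equals the value at \<open>u i\<close>. So twice as many functions with
  two values are invariant under \<open>v\<close> as under \<open>u\<close>.
\<close>

lemma card_cycles_split_off:
  assumes u: "u permutes {1..n}" and i: "i \<in> {1..n}" "u i \<noteq> i"
  defines "v \<equiv> Transposition.transpose i (u i) \<circ> u"
  shows "card (cycle_supports n v) = Suc (card (cycle_supports n u))"
proof -
  let ?A = "{0, 1::nat}" and ?j = "u i"
  let ?F = "\<lambda>w. {f \<in> {1..n} \<rightarrow>\<^sub>E ?A. \<forall>x\<in>{1..n}. f (w x) = f x}"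
  have j: "?j \<in> {1..n}" using permutes_in_image[OF u] i(1) by simp
  have v: "v permutes {1..n}"
    unfolding v_def by (intro permutes_compose[OF u] permutes_swap_id i(1) j)
  have vi: "v i = i" by (simp add: v_def)
  have v_eq_i: "v x = i \<longleftrightarrow> x = i" for x using permutes_inj[OF v] vi by (metis injD)
  have u_v: "u x = Transposition.transpose i ?j (v x)" for x by (simp add: v_def)
  have "bij_betw (\<lambda>f. (f(i := f ?j), f i)) (?F v) (?F u \<times> ?A)"
  proof (rule bij_betw_byWitness[where f' = "\<lambda>(g, c). g(i := c)"])
    show "\<forall>f\<in>?F v. (\<lambda>(g, c). g(i := c)) (f(i := f ?j), f i) = f" by simp
    show "\<forall>y\<in>?F u \<times> ?A. (\<lambda>f. (f(i := f ?j), f i)) ((\<lambda>(g, c). g(i := c)) y) = y"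
    proof
      fix y assume "y \<in> ?F u \<times> ?A"
      then obtain g c where y: "y = (g, c)" "g ?j = g i" using i(1) by auto
      then have "g(i := g ?j) = g" by auto
      then show "(\<lambda>f. (f(i := f ?j), f i)) ((\<lambda>(g, c). g(i := c)) y) = y" using y i(2) by simp
    qed
    show "(\<lambda>f. (f(i := f ?j), f i)) ` ?F v \<subseteq> ?F u \<times> ?A"
    proof
      fix y assume "y \<in> (\<lambda>f. (f(i := f ?j), f i)) ` ?F v"
      then obtain f where f: "f \<in> ?F v" "y = (f(i := f ?j), f i)" by blast
      have vals: "f x \<in> ?A" if "x \<in> {1..n}" for x using f(1) that by (auto simp: PiE_iff)
      let ?g = "f(i := f ?j)"
      have "?g (u x) = ?g x" if x: "x \<in> {1..n}" for x
      proof -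
        have "?g (u x) = ?g (v x)" using i(2) by (simp add: u_v[of x] transpose_def)
        also have "\<dots> = ?g x" using f(1) x v_eq_i[of x] by auto
        finally show ?thesis .
      qed
      moreover have "?g \<in> {1..n} \<rightarrow>\<^sub>E ?A" using f(1) vals[OF j] i(1) by (auto simp: PiE_iff extensional_def)
      ultimately show "y \<in> ?F u \<times> ?A" using f(2) vals[OF i(1)] by blast
    qed
    show "(\<lambda>(g, c). g(i := c)) ` (?F u \<times> ?A) \<subseteq> ?F v"
    proof
      fix y assume "y \<in> (\<lambda>(g, c). g(i := c)) ` (?F u \<times> ?A)"
      then obtain g c where g: "g \<in> ?F u" "c \<in> ?A" "y = g(i := c)" by auto
      have gij: "g ?j = g i" using g(1) i(1) by blast
      have "y (v x) = y x" if x: "x \<in> {1..n}" for x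
      proof (cases "x = i")
        case False
        have "g (v x) = g (u x)" using gij by (simp add: u_v[of x] transpose_def)
        also have "\<dots> = g x" using g(1) x by blast
        finally show ?thesis using False v_eq_i[of x] by (simp add: g(3))
      qed (simp add: vi)
      moreover have "y \<in> {1..n} \<rightarrow>\<^sub>E ?A" using g i(1) by (auto simp: PiE_iff extensional_def)
      ultimately show "y \<in> ?F v" by blast
    qed
  qed
  then have "card (?F v) = card (?F u \<times> ?A)" by (rule bij_betw_same_card)
  then have "(2::nat) ^ card (cycle_supports n v) = 2 ^ Suc (card (cycle_supports n u))"
    using card_invariant_functions[OF u, of ?A] card_invariant_functions[OF v, of ?A]
    by (simp add: card_cartesian_product numeral_2_eq_2)
  then show ?thesis by (simp only: power_inject_exp)
qed

text \<open>
  Each transposition \<open>(i u(i))\<close> turns a moved point into a fixed one and splits it off its cycle.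
\<close>

lemma exists_minimal_edge_word:
  assumes "u permutes {1..n}"
  shows "\<exists>es. set es \<subseteq> edges n \<and> word_perm (map Inl es) = u \<and> length es + card (cycle_supports n u) = n"
  using assms
proof (induction "card {x \<in> {1..n}. u x \<noteq> x}" arbitrary: u rule: less_induct)
  case less
  note u = less.prems
  show ?case
  proof (cases "\<exists>i\<in>{1..n}. u i \<noteq> i")
    case False
    then have "u = id" using permutes_not_in[OF u] by (metis eq_id_iff)
    then show ?thesis by (intro exI[of _ "[]"]) (simp add: card_cycles_id id_def[symmetric])
  next
    case True
    then obtain i where i: "i \<in> {1..n}" "u i \<noteq> i" by blast
    define v where "v = Transposition.transpose i (u i) \<circ> u"
    have j: "u i \<in> {1..n}" using permutes_in_image[OF u] i(1) by simp
    have v: "v permutes {1..n}"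
      unfolding v_def by (intro permutes_compose[OF u] permutes_swap_id i(1) j)
    have inj: "u a = u b \<longleftrightarrow> a = b" for a b using permutes_inj[OF u] by (simp add: inj_eq)
    have "v x = x" if "u x = x" for x
    proof -
      have "x \<noteq> i" "x \<noteq> u i" using that i(2) inj[of x i] by auto
      then show ?thesis using that by (simp add: v_def)
    qed
    moreover have "v i = i" by (simp add: v_def)
    ultimately have "{x \<in> {1..n}. v x \<noteq> x} \<subset> {x \<in> {1..n}. u x \<noteq> x}" using i by blast
    then have "card {x \<in> {1..n}. v x \<noteq> x} < card {x \<in> {1..n}. u x \<noteq> x}" by (rule psubset_card_mono[rotated]) simp
    from less.hyps[OF this v] obtain es where es: "set es \<subseteq> edges n" "word_perm (map Inl es) = v"
      "length es + card (cycle_supports n v) = n" by blast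
    have "Transposition.transpose i (u i) \<circ> v = u" by (simp add: v_def comp_assoc[symmetric])
    then have "word_perm (map Inl (mk_edge i (u i) # es)) = u"
      unfolding list.map word_perm.simps letter_perm_mk_edge es(2) .
    moreover have "length (mk_edge i (u i) # es) + card (cycle_supports n u) = n"
      using es(3) card_cycles_split_off[OF u i] unfolding v_def by simp
    moreover have "set (mk_edge i (u i) # es) \<subseteq> edges n" using es(1) mk_edge_in[OF i(1) j] i(2) by auto
    ultimately show ?thesis by blast
  qed
qed

lemma sign_edge_word:
  assumes "set es \<subseteq> edges n"
  shows "sign (word_perm (map Inl es)) = (- 1) ^ length es"
  using assms
proof (induction es)
  case (Cons e es)
  obtain v w where e: "e = (v, w)" by (cases e)
  then have vw: "v \<noteq> w" using Cons.prems by (auto simp: edges_def)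
  have "word_perm (map Inl es) permutes {1..n}"
    using Cons.prems by (intro word_perm_permutes edges_letter_on) simp
  then have "permutation (word_perm (map Inl es))" by (auto simp: permutation_permutes)
  then have "sign (Transposition.transpose v w \<circ> word_perm (map Inl es)) =
      sign (Transposition.transpose v w) * sign (word_perm (map Inl es))"
    by (intro sign_compose permutation_swap_id)
  then show ?case using Cons vw by (simp add: e sign_swap_id o_def)
qed (simp add: sign_id id_def[symmetric])

text \<open>
  The bound is the nonnegativity of the genus; the parity of the length is read off from the sign
  by comparison with a factorization into \<open>n - k\<close> edges.
\<close>

lemma edge_factorizations_length:
  assumes n: "n > 0" and u: "u permutes {1..n}" and ne: "edge_factorizations n u c \<noteq> {}"
  shows "\<exists>h. c + 2 = n + card (cycle_supports n u) + 2 * h"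
proof -
  let ?k = "card (cycle_supports n u)"
  obtain es where es: "set es \<subseteq> edges n" "length es = c" "linked n (set es)" "word_perm (map Inl es) = u"
    using ne by (auto simp: edge_factorizations_def)
  obtain es' where es': "set es' \<subseteq> edges n" "word_perm (map Inl es') = u" "length es' + ?k = n"
    using exists_minimal_edge_word[OF u] by blast
  have le: "n + ?k \<le> c + 2"
    using genus_nonnegative[OF n edges_letter_on[OF es(1)]] es by simp
  have "(- 1 :: int) ^ c = (- 1) ^ length es'"
    using sign_edge_word[OF es(1)] sign_edge_word[OF es'(1)] es es' by simp
  then have "even c \<longleftrightarrow> even (length es')" by (simp add: minus_one_power_iff split: if_splits)
  moreover have "even (n + ?k) \<longleftrightarrow> even (length es' + 2 * ?k)" 
    by (rule arg_cong[of _ _ even]) (use es'(3) in simp)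
  ultimately have "even (c + 2) \<longleftrightarrow> even (n + ?k)" by simp
  then have "even (c + 2 - (n + ?k))" using le by (simp add: even_diff_nat)
  then obtain h where "c + 2 - (n + ?k) = 2 * h" by (elim evenE)
  then have "c + 2 = n + ?k + 2 * h" using le by linarith
  then show ?thesis ..
qed

definition doubled :: "'a list \<Rightarrow> 'a list" where
  "doubled es = concat (map (\<lambda>e. [e, e]) es)"

lemma doubled_simps [simp]: "doubled [] = []" "doubled (e # es) = e # e # doubled es"
  by (simp_all add: doubled_def)

lemma set_doubled [simp]: "set (doubled es) = set es"
  by (induction es) auto

lemma length_doubled [simp]: "length (doubled es) = 2 * length es"
  by (induction es) auto

lemma word_perm_doubled: "word_perm (map Inl (doubled es)) = id"
proof (induction es)
  case (Cons e es)
  then show ?case by (cases e) (simp add: fun_eq_iff)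
qed (simp add: fun_eq_iff)

text \<open>
  A factorization into \<open>n - k\<close> edges already links the points of each cycle. Doubled edges
  do not change the product: a star of \<open>k - 1\<close> of them links the minima of the cycles to \<open>1\<close>, and \<open>h\<close>
  further copies of some edge raise the genus to \<open>h\<close>.
\<close>

lemma edge_factorizations_nonempty:
  assumes n: "n > 0" and u: "u permutes {1..n}" and h: "h = 0 \<or> n \<noteq> 1"
    and c: "c + 2 = n + card (cycle_supports n u) + 2 * h"
  shows "edge_factorizations n u c \<noteq> {}"
proof -
  let ?CS = "cycle_supports n u"
  obtain es where es: "set es \<subseteq> edges n" "word_perm (map Inl es) = u" "length es + card ?CS = n"
    using exists_minimal_edge_word[OF u] by blast
  have CS: "finite S" "S \<noteq> {}" "S \<subseteq> {1..n}" if "S \<in> ?CS" for S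
  proof -
    show "S \<subseteq> {1..n}" using cycle_supports_partition(1)[OF u] that by blast
    then show "finite S" by (rule finite_subset) simp
    show "S \<noteq> {}" using that permutes_self_in_orbit[OF u] by (auto simp: cycle_supports_def)
  qed
  have Min_in: "Min S \<in> S" "Min S \<in> {1..n}" if "S \<in> ?CS" for S using CS[OF that] Min_in by blast+
  have inj: "inj_on Min ?CS"
  proof (rule inj_onI)
    fix S T assume ST: "S \<in> ?CS" "T \<in> ?CS" "Min S = Min T"
    then have "S \<inter> T \<noteq> {}" using Min_in by fastforce
    then show "S = T" using cycle_supports_partition(2)[OF u] ST by (auto simp: disjoint_def)
  qed
  have same_cycle: "(x, y) \<in> links (set es)" if "y \<in> Orbits.orbit u x" for x y
    using that
  proof (induction rule: Orbits.orbit.induct)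
    case base
    then show ?case using word_perm_links[of x "map Inl es"] es(2) by simp
  next
    case (step y)
    then show ?case using word_perm_links[of y "map Inl es"] es(2) links_trans by (metis edges_of_map_Inl)
  qed
  define R where "R = Min ` ?CS - {1}"
  have one: "1 \<in> Min ` ?CS"
  proof -
    obtain S where S: "S \<in> ?CS" "1 \<in> S"
      using cycle_supports_partition(1)[OF u] n by (metis UnionE atLeastAtMost_iff le_refl less_one linorder_not_less)
    then have "Min S \<le> 1" "Min S \<ge> 1" using CS[OF S(1)] Min_in(2)[OF S(1)] by auto
    then show ?thesis using S(1) by (metis antisym image_eqI)
  qed
  have R: "finite R" "R \<subseteq> {1..n}" "1 \<notin> R" using Min_in by (auto simp: R_def)
  have card_R: "Suc (card R) = card ?CS"
    using one card_image[OF inj] card_Suc_Diff1[of "Min ` ?CS" 1] by (simp add: R_def)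
  obtain rs where rs: "set rs = R" "length rs = card R"
    using R(1) finite_distinct_list distinct_card by metis
  define ds where "ds = map (mk_edge 1) rs @ replicate h (1, 2)"
  have two: "(1, 2) \<in> edges n" if "h \<noteq> 0" using that h n by (auto simp: edges_def)
  have "set (es @ doubled ds) \<subseteq> edges n"
  proof -
    have "mk_edge 1 r \<in> edges n" if "r \<in> R" for r
    proof (rule mk_edge_in)
      show "1 \<in> {1..n}" using n by simp
      show "r \<in> {1..n}" "1 \<noteq> r" using that R by auto
    qed
    then show ?thesis using es(1) two rs(1) by (auto simp: ds_def)
  qed
  moreover have "length (es @ doubled ds) = c"
    using es(3) card_R c by (simp add: ds_def rs(2))
  moreover have "word_perm (map Inl (es @ doubled ds)) = u"
    by (simp only: map_append word_perm_append word_perm_doubled es(2) comp_id)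
  moreover have "linked n (set (es @ doubled ds))"
    unfolding linked_def
  proof -
    let ?E = "set (es @ doubled ds)"
    have to_one: "(x, 1) \<in> links ?E" if x: "x \<in> {1..n}" for x
    proof -
      let ?S = "Orbits.orbit u x"
      have S: "?S \<in> ?CS" using x by (simp add: cycle_supports_def)
      have 1: "(x, Min ?S) \<in> links ?E"
        using same_cycle[OF Min_in(1)[OF S]] links_mono[of "set es" ?E] by auto
      have "(Min ?S, 1) \<in> links ?E"
      proof (cases "Min ?S = 1")
        case False
        then have "Min ?S \<in> R" using S by (simp add: R_def)
        then have "mk_edge 1 (Min ?S) \<in> ?E" using rs(1) by (simp add: ds_def)
        then show ?thesis by (rule links_sym[OF links_mk_edge])
      qed simp
      from links_trans[OF 1 this] show ?thesis .
    qed
    show "{1..n} \<times> {1..n} \<subseteq> links ?E"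
    proof (rule subrelI)
      fix v w assume "(v, w) \<in> {1..n} \<times> {1..n}"
      then show "(v, w) \<in> links ?E" using links_trans[OF to_one links_sym[OF to_one], of v w] by simp
    qed
  qed
  ultimately show ?thesis unfolding edge_factorizations_def by blast
qed

section \<open>Diagonal letters\<close>

text \<open>
  The possible lists of diagonal letters in a full factorization of an element of color \<open>C\<close>. The
  edges contribute nothing to the color, which gives the condition on the sum, and the colors
  of the letters must generate the multiples of \<open>p\<close> modulo \<open>m\<close>.
\<close>

definition diag_lists :: "nat \<Rightarrow> nat \<Rightarrow> nat \<Rightarrow> int \<Rightarrow> nat \<Rightarrow> (nat \<times> int) list set" where
  "diag_lists m p n C r = {ds. length ds = r \<and>
     (\<forall>(i, e)\<in>set ds. i \<in> {1..n} \<and> 0 < e \<and> e < int m \<and> int p dvd e) \<and>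
     int m dvd C - sum_list (map snd ds) \<and> Gcd (insert (int m) (snd ` set ds)) = int p}"

lemma finite_diag_lists [simp]: "finite (diag_lists m p n C r)"
  by (rule finite_subset[OF _ finite_lists_length_eq[of "{1..n} \<times> {0<..<int m}" r]])
    (auto simp: diag_lists_def)

lemma diag_lists_0: "diag_lists m p n C 0 = (if m = p \<and> int m dvd C then {[]} else {})"
  by (auto simp: diag_lists_def)

lemma gcd_mod_int: "gcd m (y mod m) = gcd m (y :: int)"
  by (metis gcd_red_int gcd.commute)

lemma diag_lists_1:
  assumes m: "m > 0" and p: "p > 0" and mp: "m \<noteq> p" and pm: "p dvd m" and C: "int p dvd C"
  shows "card (diag_lists m p n C 1) = (if gcd C (int m) = int p then n else 0)"
proof (cases "gcd C (int m) = int p")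
  case True
  define e where "e = C mod int m"
  have "\<not> int m dvd C"
  proof
    assume "int m dvd C"
    then have "gcd C (int m) = int m" by (simp add: gcd_proj2_iff)
    then show False using True mp by simp
  qed
  then have e: "0 < e" "e < int m"
    using m pos_mod_sign[of "int m" C] by (auto simp: e_def dvd_eq_mod_eq_0 order.not_eq_order_implies_strict)
  have gcd_e: "gcd (int m) e = int p" using True by (simp add: e_def gcd.commute gcd_red_int[symmetric])
  then have pe: "int p dvd e" by (metis gcd_dvd2)
  have "diag_lists m p n C 1 = (\<lambda>i. [(i, e)]) ` {1..n}"
  proof (intro Set.set_eqI iffI)
    fix ds assume ds: "ds \<in> diag_lists m p n C 1"
    then have "length ds = Suc 0" by (simp add: diag_lists_def One_nat_def)
    then obtain i e' where ds_eq: "ds = [(i, e')]" by (auto simp: length_Suc_conv)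
    have e': "i \<in> {1..n}" "0 < e'" "e' < int m" "int m dvd C - e'" using ds by (auto simp: diag_lists_def ds_eq)
    have "C mod int m = e' mod int m" using e'(4) unfolding mod_eq_dvd_iff .
    then have "C mod int m = e'" using e'(2,3) by simp
    with e' show "ds \<in> (\<lambda>i. [(i, e)]) ` {1..n}" by (simp add: ds_eq e_def)
  next
    fix ds assume "ds \<in> (\<lambda>i. [(i, e)]) ` {1..n}"
    moreover have "int m dvd C - e" by (simp add: e_def)
    ultimately show "ds \<in> diag_lists m p n C 1"
      using e pe gcd_e by (auto simp: diag_lists_def)
  qed
  then have "card (diag_lists m p n C 1) = card {1..n}" by (simp add: card_image inj_on_def)
  then show ?thesis using True by simp
next
  case False
  have "diag_lists m p n C 1 = {}"
  proof (rule equals0I)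
    fix ds assume ds: "ds \<in> diag_lists m p n C 1"
    then have "length ds = Suc 0" by (simp add: diag_lists_def One_nat_def)
    then obtain i e where ds_eq: "ds = [(i, e)]" by (auto simp: length_Suc_conv)
    have "int m dvd C - e" "gcd (int m) e = int p" using ds by (auto simp: diag_lists_def ds_eq)
    moreover have "gcd (int m) C = gcd (int m) e"
    proof -
      have "C mod int m = e mod int m" using \<open>int m dvd C - e\<close> by (simp add: mod_eq_dvd_iff)
      then show ?thesis using gcd_mod_int[of "int m" C] gcd_mod_int[of "int m" e] by simp
    qed
    ultimately show False using False by (simp add: gcd.commute)
  qed
  then show ?thesis using False by simp
qed

lemma card_coprime_residues:
  assumes "a > 1"
  shows "card {x \<in> {0..<a * s}. coprime x a} = s * totient a"
proof -
  have "bij_betw (\<lambda>x. (x div a, x mod a)) {x \<in> {0..<a * s}. coprime x a} ({0..<s} \<times> totatives a)"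
  proof (rule bij_betw_byWitness[where f' = "\<lambda>(q, r). a * q + r"])
    have tot: "r < a" if "r \<in> totatives a" for r
      using that totatives_less[of r a] assms by simp
    show "\<forall>x\<in>{x \<in> {0..<a * s}. coprime x a}. (\<lambda>(q, r). a * q + r) (x div a, x mod a) = x" by simp
    show "\<forall>y\<in>{0..<s} \<times> totatives a. (\<lambda>x. (x div a, x mod a)) ((\<lambda>(q, r). a * q + r) y) = y"
      using tot assms by auto
    show "(\<lambda>x. (x div a, x mod a)) ` {x \<in> {0..<a * s}. coprime x a} \<subseteq> {0..<s} \<times> totatives a"
    proof (clarify, intro conjI)
      fix x assume x: "x \<in> {0..<a * s}" "coprime x a"
      show "x div a \<in> {0..<s}" using x by (simp add: less_mult_imp_div_less mult.commute)
      have "coprime (x mod a) a" using x(2) assms by (simp add: coprime_mod_left_iff)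
      moreover from this have "x mod a \<noteq> 0" using assms by (intro notI) simp
      ultimately show "x mod a \<in> totatives a" using assms by (simp add: totatives_def less_imp_le)
    qed
    show "(\<lambda>(q, r). a * q + r) ` ({0..<s} \<times> totatives a) \<subseteq> {x \<in> {0..<a * s}. coprime x a}"
    proof clarify
      fix q r assume qr: "q \<in> {0..<s}" "r \<in> totatives a"
      have "a * q + r < a * Suc q" using tot[OF qr(2)] by simp
      also have "\<dots> \<le> a * s" using qr(1) by (intro mult_le_mono2) simp
      finally have "a * q + r < a * s" .
      moreover have "coprime (a * q + r) a"
        using qr(2) unfolding coprime_iff_gcd_eq_1 gcd.commute[of _ a] mult.commute[of a q] gcd_add_mult
        by (simp add: totatives_def coprime_iff_gcd_eq_1 gcd.commute)
      ultimately show "a * q + r \<in> {0..<a * s} \<and> coprime (a * q + r) a" by simp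
    qed
  qed
  from bij_betw_same_card[OF this] show ?thesis by (simp add: card_cartesian_product totient_def)
qed

text \<open>
  The first label \<open>e = p x\<close> determines the second one, and the gcd of both with \<open>m\<close> is
  \<open>gcd e (gcd C m) = p * gcd x a\<close>. So \<open>x\<close> ranges over the residues modulo \<open>m / p\<close> that are coprime
  to \<open>a\<close>; none of them makes a label vanish, because \<open>a \<noteq> 1\<close>.
\<close>

lemma card_diag_lists_2:
  assumes m: "m > 0" and p: "p > 0" and pm: "p dvd m" and C: "int p dvd C"
    and a: "gcd C (int m) = int (p * a)" and a1: "a > 1"
  shows "card (diag_lists m p n C 2) * (p * a) = n ^ 2 * m * totient a"
proof -
  define M where "M = m div p"
  have m_pM: "m = p * M" using pm by (simp add: M_def)
  have "int (p * a) dvd int m" unfolding a[symmetric] by simp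
  then have "p * a dvd p * M" unfolding m_pM by (simp only: int_dvd_int_iff)
  then have "a dvd M" using p by simp
  then obtain s where s: "M = a * s" by (elim dvdE)
  define X where "X = {x \<in> {0..<M}. coprime x a}"
  have card_X: "card X = s * totient a" unfolding X_def s by (rule card_coprime_residues[OF a1])
  let ?f = "\<lambda>(i, l, x). [(i, int (p * x)), (l, (C - int (p * x)) mod int m)]"
  have gcd_e: "gcd (int m) (gcd e ((C - e) mod int m)) = gcd e (int (p * a))" for e
  proof -
    have "gcd (int m) (gcd e ((C - e) mod int m)) = gcd e (gcd (int m) (C - e))"
      by (simp only: gcd.left_commute[of "int m" e] gcd_mod_int)
    also have "\<dots> = gcd (int m) (gcd e (C - e))" by (rule gcd.left_commute)
    also have "gcd e (C - e) = gcd e C" by (simp only: gcd.commute[of e] gcd_diff1)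
    also have "gcd (int m) (gcd e C) = gcd e (gcd (int m) C)" by (rule gcd.left_commute)
    also have "gcd (int m) C = gcd C (int m)" by (rule gcd.commute)
    finally show ?thesis by (simp only: a)
  qed
  have gcd_px: "gcd (int (p * x)) (int (p * a)) = int p \<longleftrightarrow> coprime x a" for x
  proof -
    have "gcd (int (p * x)) (int (p * a)) = int (p * gcd x a)"
      by (simp only: gcd_int_int_eq gcd_mult_distrib_nat)
    then show ?thesis using p by (simp add: coprime_iff_gcd_eq_1)
  qed
  have "diag_lists m p n C 2 = ?f ` ({1..n} \<times> {1..n} \<times> X)"
  proof (intro Set.set_eqI iffI)
    fix ds assume ds: "ds \<in> diag_lists m p n C 2"
    then have "length ds = Suc (Suc 0)" by (simp add: diag_lists_def numeral_2_eq_2)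
    then obtain i e l e' where ds_eq: "ds = [(i, e), (l, e')]" by (auto simp: length_Suc_conv)
    have props: "i \<in> {1..n}" "l \<in> {1..n}" "0 < e" "e < int m" "int p dvd e" "0 < e'" "e' < int m"
      "int m dvd C - (e + e')" "gcd (int m) (gcd e e') = int p"
      using ds by (auto simp: diag_lists_def ds_eq)
    have "e' mod int m = (C - e) mod int m" using props(8) by (simp add: mod_eq_dvd_iff dvd_diff_commute algebra_simps)
    then have e': "e' = (C - e) mod int m" using props(6,7) by simp
    obtain z where z: "e = int p * z" using props(5) by (elim dvdE)
    have "z > 0" using props(3) p by (simp add: z zero_less_mult_iff)
    then have ex: "e = int (p * nat z)" by (simp add: z)
    have "p * nat z < p * M" using props(4) unfolding ex m_pM by (simp only: of_nat_less_iff)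
    then have "nat z < M" by simp
    moreover have "coprime (nat z) a"
      using props(9) gcd_e[of e] gcd_px[of "nat z"] unfolding e'[symmetric] by (simp add: ex)
    ultimately have "nat z \<in> X" by (simp add: X_def)
    then show "ds \<in> ?f ` ({1..n} \<times> {1..n} \<times> X)"
      using props(1,2) by (intro image_eqI[of _ _ "(i, l, nat z)"]) (simp_all add: ds_eq e' ex)
  next
    fix ds assume "ds \<in> ?f ` ({1..n} \<times> {1..n} \<times> X)"
    then obtain i l x where ilx: "i \<in> {1..n}" "l \<in> {1..n}" "x \<in> X"
      "ds = [(i, int (p * x)), (l, (C - int (p * x)) mod int m)]" by auto
    define e where "e = int (p * x)"
    define e' where "e' = (C - e) mod int m"
    have x: "x < M" "coprime x a" using ilx(3) by (simp_all add: X_def)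
    have x0: "x \<noteq> 0" using x(2) a1 by (intro notI) simp
    have e: "0 < e" "e < int m" "int p dvd e"
      using x0 x(1) p by (simp_all add: e_def m_pM)
    have gcd: "gcd (int m) (gcd e e') = int p"
      unfolding e'_def gcd_e unfolding e_def gcd_px by (rule x(2))
    have "int p dvd int m" using pm by simp
    then have pe': "int p dvd e'" using C e(3) unfolding e'_def by (simp add: dvd_mod)
    have "e' \<noteq> 0"
    proof
      assume "e' = 0"
      then have "int m dvd C - e" by (simp add: e'_def dvd_eq_mod_eq_0)
      then have "C mod int m = e mod int m" by (simp add: mod_eq_dvd_iff)
      then have "gcd (int m) e = gcd (int m) C"
        using gcd_mod_int[of "int m" C] gcd_mod_int[of "int m" e] by simp
      moreover have "gcd (int m) e = int p" using gcd \<open>e' = 0\<close> e(1) by simp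
      ultimately show False using a a1 p by (simp add: gcd.commute)
    qed
    then have "0 < e'" "e' < int m"
      using m pos_mod_sign[of "int m" "C - e"] by (auto simp: e'_def order.not_eq_order_implies_strict)
    moreover have "int m dvd C - (e + e')"
    proof -
      have "C - (e + e') = (C - e) - (C - e) mod int m" by (simp add: e'_def)
      then show ?thesis by (simp only: dvd_minus_mod)
    qed
    ultimately show "ds \<in> diag_lists m p n C 2"
      using ilx e pe' gcd unfolding e_def[symmetric] e'_def[symmetric]
      by (auto simp: diag_lists_def)
  qed
  moreover have "inj_on ?f ({1..n} \<times> {1..n} \<times> X)" using p by (auto simp: inj_on_def)
  ultimately have "card (diag_lists m p n C 2) = card ({1..n} \<times> {1..n} \<times> X)" by (simp only: card_image)
  also have "\<dots> = n * (n * (s * totient a))" by (simp add: card_cartesian_product card_X)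
  finally show ?thesis by (simp add: m_pM s power2_eq_square)
qed

section \<open>The arithmetic factor\<close>

lemma moebius_zeta_sum_0:
  assumes "d > 0"
  shows "moebius_zeta_sum 0 d = of_bool (d = 1)"
  using sum_moebius_divisors[OF assms] unfolding moebius_zeta_sum_def
  by (simp flip: of_int_sum)

lemma moebius_zeta_sum_2:
  assumes d: "d > 0"
  shows "moebius_zeta_sum 2 d = real_of_int (jordan_totient2 d) / real d ^ 2"
proof -
  have "real_of_int (jordan_totient2 d) = (\<Sum>b | b dvd d. of_int (moebius (d div b)) * real b ^ 2)"
    unfolding jordan_totient2_def by simp
  also have "\<dots> = (\<Sum>q | q dvd d. of_int (moebius q) * real (d div q) ^ 2)"
    by (rule sum.reindex_bij_witness[of _ "\<lambda>q. d div q" "\<lambda>b. d div b"]) (use d in auto)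
  also have "\<dots> = (\<Sum>q | q dvd d. real d ^ 2 * (of_int (moebius q) / real q ^ 2))"
    by (rule sum.cong) (auto simp: real_of_nat_div power_divide)
  also have "\<dots> = real d ^ 2 * moebius_zeta_sum 2 d"
    unfolding moebius_zeta_sum_def sum_distrib_left ..
  finally show ?thesis using d by simp
qed

lemma sum_inverse_squares_le: "n \<ge> 1 \<Longrightarrow> (\<Sum>q\<in>{2..n}. 1 / real q ^ 2) \<le> 1 - 1 / real n"
proof (induction n rule: dec_induct)
  case base
  then show ?case by simp
next
  case (step n)
  have split: "{2..Suc n} = insert (Suc n) {2..n}" using step.hyps by auto
  have "1 / real (Suc n) ^ 2 \<le> 1 / (real n * real (Suc n))"
    using step.hyps by (intro divide_left_mono) (simp_all add: power2_eq_square)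
  also have "\<dots> = 1 / real n - 1 / real (Suc n)" using step.hyps by (simp add: field_simps)
  finally show ?case using step.IH unfolding split by simp
qed

text \<open>
  The term for \<open>q = 1\<close> outweighs all others, as the sum of \<open>1 / q\<^sup>2\<close> over \<open>q \<ge> 2\<close> is less than \<open>1\<close>.
\<close>

lemma moebius_zeta_sum_2_pos:
  assumes d: "d > 0"
  shows "moebius_zeta_sum 2 d > 0"
proof -
  have fin: "finite {q. q dvd d}" using d by simp
  have "{q. q dvd d} = insert 1 ({q. q dvd d} - {1})" by auto
  then have "moebius_zeta_sum 2 d = 1 + (\<Sum>q\<in>{q. q dvd d} - {1}. of_int (moebius q) / real q ^ 2)"
    unfolding moebius_zeta_sum_def using fin by (subst sum.remove[of _ 1]) (simp_all add: moebius_def)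
  moreover have "\<bar>\<Sum>q\<in>{q. q dvd d} - {1}. of_int (moebius q) / real q ^ 2\<bar> \<le> (\<Sum>q\<in>{q. q dvd d} - {1}. 1 / real q ^ 2)"
  proof (rule order.trans[OF sum_abs], rule sum_mono)
    fix q :: nat
    have "\<bar>moebius q\<bar> \<le> 1" by (simp add: moebius_def power_abs)
    then have "\<bar>real_of_int (moebius q)\<bar> \<le> 1" by linarith
    then show "\<bar>of_int (moebius q) / real q ^ 2\<bar> \<le> 1 / real q ^ 2" by (simp add: divide_right_mono)
  qed
  moreover have "(\<Sum>q\<in>{q. q dvd d} - {1}. 1 / real q ^ 2) \<le> (\<Sum>q\<in>{2..d}. 1 / real q ^ 2)"
  proof (rule sum_mono2)
    show "{q. q dvd d} - {1} \<subseteq> {2..d}"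
    proof
      fix q assume q: "q \<in> {q. q dvd d} - {1}"
      then have "q \<le> d" "q \<noteq> 0" "q \<noteq> 1" using d by (auto intro: dvd_imp_le)
      then show "q \<in> {2..d}" by simp
    qed
  qed simp_all
  moreover have "(\<Sum>q\<in>{2..d}. 1 / real q ^ 2) \<le> 1 - 1 / real d" by (rule sum_inverse_squares_le) (use d in simp)
  moreover have "1 / real d > 0" using d by simp
  ultimately show ?thesis by linarith
qed

section \<open>Full factorizations as words with voltages\<close>

text \<open>
  The parameter \<open>C\<close> is the color of the factorized element.
\<close>

definition full_words :: "nat \<Rightarrow> nat \<Rightarrow> nat \<Rightarrow> (nat \<Rightarrow> nat) \<Rightarrow> int \<Rightarrow> nat \<Rightarrow> letter list set" where
  "full_words m p n u C N = {sk. length sk = N \<and> (\<forall>s\<in>set sk. refl_letter m p n s) \<and>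
     linked n (edges_of sk) \<and> Gcd (insert (int m) (diag_label ` set sk)) = int p \<and>
     word_perm sk = u \<and> int m dvd C - diag_sum sk}"

definition full_voltages :: "nat \<Rightarrow> nat \<Rightarrow> nat \<Rightarrow> (nat \<Rightarrow> int) \<Rightarrow> letter list \<Rightarrow> (nat \<Rightarrow> int) set" where
  "full_voltages m p n b sk = {x \<in> solutions m n b sk. nondegenerate p sk x}"

lemma finite_refl_letters [simp]: "finite {s. refl_letter m p n s}"
proof (rule finite_subset)
  show "{s. refl_letter m p n s} \<subseteq> Inl ` ({1..n} \<times> {1..n}) \<union> Inr ` ({1..n} \<times> {0<..<int m})"
  proof
    fix s assume "s \<in> {s. refl_letter m p n s}"
    then show "s \<in> Inl ` ({1..n} \<times> {1..n}) \<union> Inr ` ({1..n} \<times> {0<..<int m})"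
      by (cases s rule: letter_cases) auto
  qed
qed auto

lemma finite_full_words [simp]: "finite (full_words m p n u C N)"
  by (rule finite_subset[OF _ finite_lists_length_eq[of "{s. refl_letter m p n s}" N]])
    (auto simp: full_words_def)

lemma finite_full_voltages [simp]: "finite (full_voltages m p n b sk)"
  by (simp add: full_voltages_def)

text \<open>
  Of the conditions for a full factorization only the coloring of the product and
  nondegeneracy depend on the voltages. That \<open>m\<close> divides \<open>C - diag_sum sk\<close> is implied by the coloring;
  it is made a condition on the word so that all words in the sum admit voltages with the right product.
\<close>

theorem card_full_factorizations:
  assumes mp: "m > 0" "p > 0" "p dvd m" and n: "n > 0" and np: "n \<noteq> 1 \<or> p = 1"
    and u: "u permutes {1..n}"
  shows "card {ts \<in> full_refl_factorizations m p n (colored_perm_mat m n u b). length ts = N} =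
    (\<Sum>sk\<in>full_words m p n u (\<Sum>j\<in>{1..n}. b j) N. card (full_voltages m p n b sk))"
proof -
  let ?g = "colored_perm_mat m n u b" and ?C = "\<Sum>j\<in>{1..n}. b j"
  let ?f = "\<lambda>(sk, x). word_mats m n sk x"
  let ?W = "SIGMA sk : {sk. length sk = N \<and> (\<forall>s\<in>set sk. refl_letter m p n s)}. edge_positions sk \<rightarrow>\<^sub>E {0..<int m}"
  let ?A = "SIGMA sk : full_words m p n u ?C N. full_voltages m p n b sk"
  let ?T = "{ts \<in> full_refl_factorizations m p n ?g. length ts = N}"
  have bij: "bij_betw ?f ?W {ts. length ts = N \<and> set ts \<subseteq> {t \<in> carrier (Gmpn m p n). reflection n t}}"
    by (rule bij_betw_word_mats[OF mp])
  have crit: "word_mats m n sk x \<in> full_refl_factorizations m p n ?g \<longleftrightarrow> (sk, x) \<in> ?A"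
    if sk: "length sk = N" "\<forall>s\<in>set sk. refl_letter m p n s" and x: "x \<in> edge_positions sk \<rightarrow>\<^sub>E {0..<int m}" for sk x
  proof -
    have on: "\<forall>s\<in>set sk. letter_on n s" using sk(2) refl_letter_on by blast
    have "set (word_mats m n sk x) \<subseteq> {t \<in> carrier (Gmpn m p n). reflection n t}"
    proof -
      have "?f (sk, x) \<in> ?f ` ?W" using sk x by blast
      then show ?thesis using bij by (simp add: bij_betw_def)
    qed
    then have "word_mats m n sk x \<in> full_refl_factorizations m p n ?g \<longleftrightarrow>
        colored_perm_mat m n (word_perm sk) (word_color sk x) = ?g \<and>
        generate (Gmpn m p n) (set (word_mats m n sk x)) = carrier (Gmpn m p n)"
      unfolding full_refl_factorizations_def foldr_word_mats[OF on, symmetric] by blast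
    also have "\<dots> \<longleftrightarrow> (word_perm sk = u \<and> (\<forall>j\<in>{1..n}. [word_color sk x j = b j] (mod int m))) \<and>
        (linked n (edges_of sk) \<and> Gcd (insert (int m) (diag_label ` set sk)) = int p \<and> nondegenerate p sk x)"
      unfolding word_mats_generate_iff[OF mp n np sk(2)]
        colored_perm_mat_eq_iff[OF mp(1) word_perm_permutes[OF on] u] ..
    also have "\<dots> \<longleftrightarrow> (sk, x) \<in> ?A"
    proof -
      have "int m dvd ?C - diag_sum sk" if "\<forall>j\<in>{1..n}. [word_color sk x j = b j] (mod int m)"
      proof -
        have "[(\<Sum>j\<in>{1..n}. word_color sk x j) = ?C] (mod int m)"
          by (rule cong_sum) (use that in blast)
        then show ?thesis unfolding sum_word_color[OF on] by (simp add: cong_iff_dvd_diff dvd_diff_commute)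
      qed
      then show ?thesis using sk x unfolding full_words_def full_voltages_def solutions_def by blast
    qed
    finally show ?thesis .
  qed
  have sub: "?A \<subseteq> ?W" by (auto simp: full_words_def full_voltages_def solutions_def)
  have "?f ` ?A = ?T"
  proof (intro Set.set_eqI iffI)
    fix ts assume "ts \<in> ?f ` ?A"
    then obtain sk x where skx: "(sk, x) \<in> ?A" "ts = word_mats m n sk x" by auto
    then have "(sk, x) \<in> ?W" using sub by blast
    then show "ts \<in> ?T" using crit[of sk x] skx by auto
  next
    fix ts assume ts: "ts \<in> ?T"
    then have "ts \<in> ?f ` ?W" using bij unfolding bij_betw_def full_refl_factorizations_def by auto
    then obtain sk x where skx: "(sk, x) \<in> ?W" "ts = word_mats m n sk x" by auto
    then have "(sk, x) \<in> ?A" using crit[of sk x] ts by auto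
    then show "ts \<in> ?f ` ?A" using skx(2) by force
  qed
  moreover have "inj_on ?f ?A" using bij sub unfolding bij_betw_def by (meson inj_on_subset)
  ultimately have "card ?T = card ?A" using card_image by fastforce
  also have "\<dots> = (\<Sum>sk\<in>full_words m p n u ?C N. card (full_voltages m p n b sk))"
    by (rule card_SigmaI) simp_all
  finally show ?thesis .
qed

section \<open>Shuffling edges and diagonal letters\<close>

lemma word_perm_filter: "word_perm (filter isl sk) = word_perm sk"
proof (induction sk)
  case (Cons s sk)
  then show ?case by (cases s rule: letter_cases) simp_all
qed simp

lemma edges_of_filter: "edges_of (filter isl sk) = edges_of sk"
  by (auto simp: edges_of_def)

lemma diag_sum_filter: "diag_sum (filter (\<lambda>s. \<not> isl s) sk) = diag_sum sk"
proof (induction sk)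
  case (Cons s sk)
  then show ?case by (cases s rule: letter_cases) (simp_all add: diag_sum_def)
qed simp

lemma Gcd_labels_filter:
  "Gcd (insert m (diag_label ` set (filter (\<lambda>s. \<not> isl s) sk))) = Gcd (insert m (diag_label ` set sk))"
proof (rule zdvd_antisym_nonneg)
  have "Gcd (insert m (diag_label ` set (filter (\<lambda>s. \<not> isl s) sk))) dvd diag_label s" if "s \<in> set sk" for s
  proof (cases s rule: letter_cases)
    case (diag i e)
    then have "diag_label s \<in> insert m (diag_label ` set (filter (\<lambda>s. \<not> isl s) sk))" using that by force
    then show ?thesis by (rule Gcd_dvd)
  qed simp
  then show "Gcd (insert m (diag_label ` set (filter (\<lambda>s. \<not> isl s) sk))) dvd Gcd (insert m (diag_label ` set sk))"
    by (intro Gcd_greatest) (auto simp del: Gcd_insert intro: Gcd_dvd)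
  show "Gcd (insert m (diag_label ` set sk)) dvd Gcd (insert m (diag_label ` set (filter (\<lambda>s. \<not> isl s) sk)))"
    by (rule Gcd_greatest) (auto simp del: Gcd_insert intro: Gcd_dvd)
qed simp_all

lemma filter_shuffle:
  assumes "zs \<in> shuffles (map Inl es) (map Inr ds)"
  shows "filter isl zs = map Inl es" "filter (\<lambda>s. \<not> isl s) zs = map Inr ds"
proof -
  have "filter isl zs \<in> filter isl ` shuffles (map Inl es) (map Inr ds)" using assms by blast
  then show "filter isl zs = map Inl es" unfolding filter_shuffles by (simp add: filter_map comp_def)
  have "filter (\<lambda>s. \<not> isl s) zs \<in> filter (\<lambda>s. \<not> isl s) ` shuffles (map Inl es) (map Inr ds)" using assms by blast
  then show "filter (\<lambda>s. \<not> isl s) zs = map Inr ds" unfolding filter_shuffles by (simp add: filter_map comp_def)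
qed

lemma word_split:
  obtains es ds where "filter isl sk = map Inl es" "filter (\<lambda>s. \<not> isl s) sk = map Inr ds"
proof -
  have "filter isl sk = map Inl (map projl (filter isl sk))"
    by (rule sym, unfold map_map, rule map_idI) auto
  moreover have "filter (\<lambda>s. \<not> isl s) sk = map Inr (map projr (filter (\<lambda>s. \<not> isl s) sk))"
    by (rule sym, unfold map_map, rule map_idI) auto
  ultimately show ?thesis using that by blast
qed

lemma full_word_iff:
  assumes es: "filter isl sk = map Inl es" and ds: "filter (\<lambda>s. \<not> isl s) sk = map Inr ds"
  shows "sk \<in> full_words m p n u C (length sk) \<longleftrightarrow>
    es \<in> edge_factorizations n u (length es) \<and> ds \<in> diag_lists m p n C (length ds)"
proof -
  have set_sk: "set sk = Inl ` set es \<union> Inr ` set ds"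
  proof -
    have "set sk = set (filter isl sk) \<union> set (filter (\<lambda>s. \<not> isl s) sk)" by auto
    then show ?thesis unfolding es ds by simp
  qed
  have "(\<forall>s\<in>set sk. refl_letter m p n s) \<longleftrightarrow> set es \<subseteq> edges n \<and>
      (\<forall>(i, e)\<in>set ds. i \<in> {1..n} \<and> 0 < e \<and> e < int m \<and> int p dvd e)"
    unfolding set_sk by (auto simp: ball_Un edges_def)
  moreover have "edges_of sk = set es" using edges_of_filter[of sk] unfolding es by simp
  moreover have "word_perm sk = word_perm (map Inl es)" using word_perm_filter[of sk] unfolding es by simp
  moreover have "diag_sum sk = sum_list (map snd ds)"
  proof -
    have "diag_label (Inr d) = snd d" for d by (cases d) simp
    then show ?thesis using diag_sum_filter[of sk] unfolding ds by (simp add: diag_sum_def comp_def)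
  qed
  moreover have "Gcd (insert (int m) (diag_label ` set sk)) = Gcd (insert (int m) (snd ` set ds))"
  proof -
    have "diag_label (Inr d) = snd d" for d by (cases d) simp
    then have "diag_label ` set (map Inr ds) = snd ` set ds" by (simp add: image_image)
    then show ?thesis using Gcd_labels_filter[of "int m" sk] unfolding ds by simp
  qed
  ultimately show ?thesis
    unfolding full_words_def edge_factorizations_def diag_lists_def by auto
qed

lemma length_word_split:
  assumes es: "filter isl sk = map Inl es" and ds: "filter (\<lambda>s. \<not> isl s) sk = map Inr ds"
  shows "length sk = length es + length ds" "length (filter isl sk) = length es"
  using sum_length_filter_compl[of isl sk] assms by simp_all

text \<open>
  The conditions on a full word concern its edges and its diagonal letters separately and do not
  see how these are interleaved.
\<close>

lemma card_full_words_with_edges: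
  "card {sk \<in> full_words m p n u C (c + r). length (filter isl sk) = c} =
     ((c + r) choose c) * (card (edge_factorizations n u c) * card (diag_lists m p n C r))"
proof -
  let ?S = "\<lambda>y. shuffles (map Inl (fst y)) (map Inr (snd y)) :: letter list set"
  let ?P = "edge_factorizations n u c \<times> diag_lists m p n C r"
  have len: "length es = c" "length ds = r" if "(es, ds) \<in> ?P" for es ds
    using that by (auto simp: edge_factorizations_def diag_lists_def)
  have "{sk \<in> full_words m p n u C (c + r). length (filter isl sk) = c} = (\<Union>y\<in>?P. ?S y)"
  proof (intro Set.set_eqI iffI)
    fix sk assume sk: "sk \<in> {sk \<in> full_words m p n u C (c + r). length (filter isl sk) = c}"
    obtain es ds where split: "filter isl sk = map Inl es" "filter (\<lambda>s. \<not> isl s) sk = map Inr ds"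
      by (rule word_split)
    have len_sk: "length sk = c + r" using sk by (simp add: full_words_def)
    have "length es = c" "length ds = r"
      using length_word_split[OF split] len_sk sk by simp_all
    moreover have "sk \<in> full_words m p n u C (length sk)" using sk len_sk by simp
    ultimately have "(es, ds) \<in> ?P" using full_word_iff[OF split] by simp
    moreover have "sk \<in> ?S (es, ds)" using partition_in_shuffles[of sk isl] split by simp
    ultimately show "sk \<in> (\<Union>y\<in>?P. ?S y)" by blast
  next
    fix sk assume "sk \<in> (\<Union>y\<in>?P. ?S y)"
    then obtain es ds where y: "(es, ds) \<in> ?P" "sk \<in> shuffles (map Inl es) (map Inr ds)" by auto
    note split = filter_shuffle[OF y(2)]
    have "length sk = c + r" using length_shuffles[OF y(2)] len[OF y(1)] by simp
    then show "sk \<in> {sk \<in> full_words m p n u C (c + r). length (filter isl sk) = c}"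
      using full_word_iff[OF split, of m p n u C] y(1) len[OF y(1)] length_word_split[OF split] by simp
  qed
  then have "card {sk \<in> full_words m p n u C (c + r). length (filter isl sk) = c} = card (\<Union>y\<in>?P. ?S y)"
    by (rule arg_cong)
  also have "\<dots> = (\<Sum>y\<in>?P. card (?S y))"
  proof (rule card_UN_disjoint)
    show "\<forall>y\<in>?P. \<forall>y'\<in>?P. y \<noteq> y' \<longrightarrow> ?S y \<inter> ?S y' = {}"
    proof (intro ballI impI)
      fix y y' :: "(nat \<times> nat) list \<times> (nat \<times> int) list" assume "y \<noteq> y'"
      show "?S y \<inter> ?S y' = {}"
      proof (rule ccontr)
        assume "?S y \<inter> ?S y' \<noteq> {}"
        then obtain sk where "sk \<in> ?S y" "sk \<in> ?S y'" by blast
        then have "map Inl (fst y) = (map Inl (fst y') :: letter list)" "map Inr (snd y) = (map Inr (snd y') :: letter list)"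
          using filter_shuffle by metis+
        then have "fst y = fst y'" "snd y = snd y'"
          by (simp_all add: inj_map_eq_map)
        then show False using \<open>y \<noteq> y'\<close> by (simp add: prod_eq_iff)
      qed
    qed
  qed simp_all
  also have "\<dots> = (\<Sum>y\<in>?P. (c + r) choose c)"
  proof (rule sum.cong[OF refl])
    fix y :: "(nat \<times> nat) list \<times> (nat \<times> int) list" assume y: "y \<in> ?P"
    have "card (?S y) = (length (map Inl (fst y) :: letter list) + length (map Inr (snd y) :: letter list)) choose length (map Inl (fst y) :: letter list)"
      by (rule card_disjoint_shuffles) auto
    then show "card (?S y) = (c + r) choose c" using len[of "fst y" "snd y"] y by simp
  qed
  finally show ?thesis by (simp add: card_cartesian_product)
qed

section \<open>Factorizations of minimal length\<close>

lemma nat_Gcd_insert_pos: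
  assumes "p > 0"
  shows "nat (Gcd (insert (int p) A)) > 0"
proof -
  have "Gcd (insert (int p) A) \<noteq> 0" using assms by (simp add: Gcd_0_iff)
  moreover have "Gcd (insert (int p) A) \<ge> 0" by simp
  ultimately show ?thesis by linarith
qed

text \<open>
  A word admits suitable voltages only if it has at least \<open>c\<close> edges and at least \<open>r\<close> diagonal
  letters: if \<open>d \<noteq> 1\<close>, then the words of genus \<open>0\<close> are excluded by the factor \<open>\<Sum>q | q dvd d. \<mu>(q) = 0\<close>.
  The two bounds are independent, so \<open>c + r\<close> is the least length, and a word of this length attains
  both. That such words exist, and admit voltages, is what makes \<open>c + r\<close> the minimum.
\<close>

theorem F_full_eq:
  fixes m p n :: nat and u :: "nat \<Rightarrow> nat" and b :: "nat \<Rightarrow> int"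
  assumes mp: "m > 0" "p > 0" "p dvd m" and n: "n > 0" and np: "n \<noteq> 1 \<or> p = 1"
    and u: "u permutes {1..n}"
  defines "k \<equiv> card (cycle_supports n u)" and "C \<equiv> (\<Sum>j\<in>{1..n}. b j)"
    and "d \<equiv> nat (Gcd (insert (int p) (color b ` cycle_supports n u)))"
  assumes h: "h = (if d = 1 then 0 else 1)" and c: "c + 2 = n + k + 2 * h"
    and r_min: "\<And>r'. r' < r \<Longrightarrow> diag_lists m p n C r' = {}" and r_ne: "diag_lists m p n C r \<noteq> {}"
  shows "real (F_full m p n (colored_perm_mat m n u b)) =
    real ((c + r) choose c) * real (hurwitz h (cycle_type n u)) * real (card (diag_lists m p n C r))
      * real m ^ (k - 1 + 2 * h) * moebius_zeta_sum (2 * h) d"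
proof -
  let ?g = "colored_perm_mat m n u b"
  let ?E = "edge_factorizations n u" and ?D = "diag_lists m p n C"
  let ?X = "\<lambda>sk. card (full_voltages m p n b sk)"
  let ?F = "\<lambda>N. card {ts \<in> full_refl_factorizations m p n ?g. length ts = N}"
  have F: "?F N = (\<Sum>sk\<in>full_words m p n u C N. ?X sk)" for N
    unfolding C_def by (rule card_full_factorizations[OF mp n np u])
  have d0: "d > 0" unfolding d_def by (rule nat_Gcd_insert_pos[OF mp(2)])
  have d_p: "d dvd p"
  proof -
    have "int d = Gcd (insert (int p) (color b ` cycle_supports n u))" unfolding d_def by simp
    also have "\<dots> dvd int p" by (rule Gcd_dvd) simp
    finally show ?thesis by (simp only: int_dvd_int_iff)
  qed
  have X_value: "real (?X sk) = real m ^ (k - 1 + 2 * h') * moebius_zeta_sum (2 * h') d"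
    if sk: "sk \<in> full_words m p n u C N" and len: "length (filter isl sk) + 2 = n + k + 2 * h'" for sk N h'
  proof -
    have "word_perm sk = u" using sk by (simp add: full_words_def)
    moreover have "\<forall>s\<in>set sk. letter_on n s" "\<forall>s\<in>set sk. int p dvd diag_label s"
      using sk refl_letter_on refl_letter_dvd by (auto simp: full_words_def)
    moreover have "linked n (edges_of sk)" "int m dvd (\<Sum>j\<in>{1..n}. b j) - diag_sum sk"
      using sk by (simp_all add: full_words_def C_def)
    ultimately show ?thesis
      unfolding full_voltages_def k_def d_def
      using card_nondegenerate_solutions[of m n p sk b h'] mp(1,3) n len by (simp add: k_def)
  qed
  have bounds: "c \<le> length (filter isl sk) \<and> r \<le> N - length (filter isl sk)"
    if sk: "sk \<in> full_words m p n u C N" and ne: "?X sk \<noteq> 0" for sk N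
  proof -
    obtain es ds where split: "filter isl sk = map Inl es" "filter (\<lambda>s. \<not> isl s) sk = map Inr ds"
      by (rule word_split)
    have len_sk: "length sk = N" using sk by (simp add: full_words_def)
    then have mem: "es \<in> ?E (length es)" "ds \<in> ?D (length ds)"
      using full_word_iff[OF split] sk by blast+
    obtain h' where h': "length es + 2 = n + k + 2 * h'"
      using edge_factorizations_length[OF n u] mem(1) unfolding k_def by blast
    have "h \<le> h'"
    proof (rule ccontr)
      assume "\<not> h \<le> h'"
      then have "h' = 0" "d \<noteq> 1" using h by (auto split: if_splits)
      then have "real (?X sk) = 0"
        using X_value[OF sk, of h'] h' length_word_split[OF split] moebius_zeta_sum_0[OF d0] by simp
      then show False using ne by simp
    qed
    then have "c \<le> length es" using c h' by simp
    moreover have "r \<le> length ds" using r_min mem(2) by (metis empty_iff not_le)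
    ultimately show ?thesis using length_word_split[OF split] len_sk by simp
  qed
  have F_value: "real (?F (c + r)) = real ((c + r) choose c) * real (card (?E c)) * real (card (?D r))
      * (real m ^ (k - 1 + 2 * h) * moebius_zeta_sum (2 * h) d)"
  proof -
    let ?M = "{sk \<in> full_words m p n u C (c + r). length (filter isl sk) = c}"
    have "?F (c + r) = (\<Sum>sk\<in>?M. ?X sk)"
      unfolding F
    proof (rule sum.mono_neutral_right)
      show "\<forall>sk\<in>full_words m p n u C (c + r) - ?M. ?X sk = 0"
      proof (intro ballI, rule ccontr)
        fix sk assume sk: "sk \<in> full_words m p n u C (c + r) - ?M" "?X sk \<noteq> 0"
        have "length (filter isl sk) \<le> c + r"
          using sk(1) length_filter_le[of isl sk] by (simp add: full_words_def)
        then show False using bounds[of sk "c + r"] sk by auto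
      qed
    qed auto
    then have "real (?F (c + r)) = (\<Sum>sk\<in>?M. real (?X sk))" by simp
    also have "\<dots> = (\<Sum>sk\<in>?M. real m ^ (k - 1 + 2 * h) * moebius_zeta_sum (2 * h) d)"
      by (rule sum.cong[OF refl]) (use X_value c in auto)
    also have "\<dots> = real (card ?M) * (real m ^ (k - 1 + 2 * h) * moebius_zeta_sum (2 * h) d)" by simp
    finally show ?thesis unfolding card_full_words_with_edges by (simp add: mult_ac)
  qed
  have n1: "h = 0 \<or> n \<noteq> 1"
  proof -
    have "d = 1" if "n = 1" using np d_p that by simp
    then show ?thesis using h by auto
  qed
  have E_ne: "?E c \<noteq> {}" using edge_factorizations_nonempty[OF n u n1] c by (simp add: k_def)
  have "moebius_zeta_sum (2 * h) d > 0"
    using h moebius_zeta_sum_0[OF d0] moebius_zeta_sum_2_pos[OF d0] by (simp split: if_splits)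
  then have "real (?F (c + r)) > 0"
    unfolding F_value using E_ne r_ne mp(1) by (simp add: card_gt_0_iff)
  then have "{ts \<in> full_refl_factorizations m p n ?g. length ts = c + r} \<noteq> {}" by (auto simp: card_gt_0_iff)
  then have ex: "\<exists>ts\<in>full_refl_factorizations m p n ?g. length ts = c + r" by blast
  have min: "c + r \<le> N" if "\<exists>ts\<in>full_refl_factorizations m p n ?g. length ts = N" for N
  proof -
    have "finite {ts \<in> full_refl_factorizations m p n ?g. length ts = N}"
    proof (rule ccontr)
      assume inf: "infinite {ts \<in> full_refl_factorizations m p n ?g. length ts = N}"
      have "finite {ts. length ts = N \<and> set ts \<subseteq> {t \<in> carrier (Gmpn m p n). reflection n t}}"
        using bij_betw_finite[OF bij_betw_word_mats[OF mp, where N = N and n = n]]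
        by (auto simp: finite_PiE intro!: finite_SigmaI
            finite_subset[OF _ finite_lists_length_eq[of "{s. refl_letter m p n s}" N]])
      then have "finite {ts \<in> full_refl_factorizations m p n ?g. length ts = N}"
        by (rule rev_finite_subset) (auto simp: full_refl_factorizations_def)
      then show False using inf by blast
    qed
    then have "?F N \<noteq> 0" using that by auto
    then obtain sk where sk: "sk \<in> full_words m p n u C N" "?X sk \<noteq> 0"
      unfolding F by (meson sum.neutral)
    have "length (filter isl sk) \<le> N" using sk(1) length_filter_le[of isl sk] by (simp add: full_words_def)
    then show ?thesis using bounds[OF sk] by linarith
  qed
  have "min_full_length m p n ?g = c + r"
    unfolding min_full_length_def by (rule Least_equality) (fact ex, rule min)
  moreover have "hurwitz h (cycle_type n u) = card (?E c)"
  proof -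
    have "n + card (cycle_supports n u) + 2 * h - 2 = c" using c by (simp add: k_def)
    then show ?thesis using hurwitz_eq_card_edge_factorizations[OF u, of h] by simp
  qed
  ultimately show ?thesis unfolding F_full_def using F_value by (simp add: mult_ac)
qed

section \<open>The counting formula\<close>

text \<open>
  Without diagonal letters the gcd of \<open>m\<close> and the labels is \<open>m\<close> instead of \<open>p\<close>, and a single diagonal letter
  must carry the whole color of \<open>g\<close>, so that the gcd is \<open>p * a\<close>. Hence the least number of diagonal letters is \<open>0\<close> if \<open>m = p\<close>, \<open>1\<close> if
  \<open>m \<noteq> p\<close> and \<open>a = 1\<close>, and \<open>2\<close> otherwise; the number of edges is governed by \<open>d\<close> alone.
\<close>

theorem theorem5p4:
  fixes m p n k d a :: nat
    and u :: "nat \<Rightarrow> nat" and b :: "nat \<Rightarrow> int"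
    and g :: "complex mat" and L :: "nat multiset"
  assumes "m > 0" "p > 0" "n > 0" "p dvd m"
    and "n \<noteq> 1 \<or> p = 1"
    and "g \<in> carrier (Gmpn m p n)"
    and "u permutes {1..n}" "g = colored_perm_mat m n u b"
    and "k = card (cycle_supports n u)"
    and "L = cycle_type n u"
    and "d = nat (Gcd (insert (int p) (color b ` cycle_supports n u)))"
    and "a = nat (gcd (color b {1..n}) (int m)) div p"
  shows "(m = p \<longrightarrow> real (F_full m m n g) =
           (if d = 1 then real m ^ (k - 1) * real (hurwitz 0 L)
            else real m ^ (k + 1) * (real_of_int (jordan_totient2 d) / real d ^ 2)
                   * real (hurwitz 1 L)))
         \<and> (m \<noteq> p \<longrightarrow> real (F_full m p n g) =
           (if a = 1 \<and> d = 1 then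
              real n * (real n + real k - 1) * real m ^ (k - 1) * real (hurwitz 0 L)
            else if a \<noteq> 1 \<and> d = 1 then
              real n ^ 2 * (real n + real k) * (real n + real k - 1) * real m ^ k / 2
                * (real (totient a) / (real p * real a)) * real (hurwitz 0 L)
            else if a = 1 \<and> d \<noteq> 1 then
              real n * (real n + real k + 1) * real m ^ (k + 1)
                * (real_of_int (jordan_totient2 d) / real d ^ 2) * real (hurwitz 1 L)
            else
              real n ^ 2 * (real n + real k + 2) * (real n + real k + 1) * real m ^ (k + 2) / 2
                * (real (totient a) / (real p * real a))
                * (real_of_int (jordan_totient2 d) / real d ^ 2) * real (hurwitz 1 L)))"
proof -
  note mp = \<open>m > 0\<close> \<open>p > 0\<close> \<open>p dvd m\<close> and n = \<open>n > 0\<close> and u = \<open>u permutes {1..n}\<close>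
  define C where "C = (\<Sum>j\<in>{1..n}. b j)"
  define h :: nat where "h = (if d = 1 then 0 else 1)"
  have k: "k > 0" unfolding \<open>k = _\<close> using n by (auto simp: card_gt_0_iff cycle_supports_def)
  define c where "c = n + k + 2 * h - 2"
  have c: "c + 2 = n + k + 2 * h" using n k by (simp add: c_def)
  have p_C: "int p dvd C"
    using colored_perm_mat_in_Gmpn_iff[OF mp u, of b] \<open>g \<in> _\<close> \<open>g = _\<close> by (simp add: C_def color_def)
  have nat_gcd: "int (nat (gcd C (int m))) = gcd C (int m)" by simp
  have "int p dvd int (nat (gcd C (int m)))" unfolding nat_gcd using p_C mp(3) by simp
  then have "p dvd nat (gcd C (int m))" by (simp only: int_dvd_int_iff)
  then have "p * a = nat (gcd C (int m))"
    unfolding \<open>a = _\<close> color_def C_def[symmetric] by simp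
  then have gcd_C: "gcd C (int m) = int (p * a)" by simp
  have a0: "a > 0"
  proof (rule ccontr)
    assume "\<not> a > 0"
    then have "gcd C (int m) = 0" using gcd_C by simp
    then show False using mp(1) by simp
  qed
  have d0: "d > 0" unfolding \<open>d = _\<close> by (rule nat_Gcd_insert_pos[OF mp(2)])
  define J where "J = real_of_int (jordan_totient2 d) / real d ^ 2"
  define Z where "Z = moebius_zeta_sum (2 * h) d"
  define P where "P = real m ^ (k - 1 + 2 * h)"
  define H where "H = real (hurwitz h L)"
  have F: "real (F_full m p n g) = real ((c + r) choose c) * H * real (card (diag_lists m p n C r)) * P * Z"
    if "\<And>r'. r' < r \<Longrightarrow> diag_lists m p n C r' = {}" "diag_lists m p n C r \<noteq> {}" for r
    using F_full_eq[OF mp n \<open>n \<noteq> 1 \<or> p = 1\<close> u, of h b c r, folded \<open>d = _\<close> \<open>k = _\<close> C_def, OF h_def c that]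
    unfolding \<open>L = _\<close> \<open>g = _\<close> Z_def P_def H_def .
  have genus_0: "real h = 0" "Z = 1" "P = real m ^ (k - 1)" "real m * P = real m ^ k" "H = real (hurwitz 0 L)"
    if d1: "d = 1"
  proof -
    have h0: "h = 0" by (simp add: h_def d1)
    show "real h = 0" "P = real m ^ (k - 1)" "H = real (hurwitz 0 L)" by (simp_all add: h0 P_def H_def)
    show "Z = 1" using moebius_zeta_sum_0[OF d0] d1 unfolding Z_def h0 by simp
    show "real m * P = real m ^ k" using k by (cases k) (simp_all add: h0 P_def)
  qed
  have genus_1: "real h = 1" "Z = J" "P = real m ^ (k + 1)" "real m * P = real m ^ (k + 2)" "H = real (hurwitz 1 L)"
    if d1: "d \<noteq> 1"
  proof -
    have h1: "h = 1" by (simp add: h_def d1)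
    have e: "k - 1 + 2 * h = k + 1" using k by (simp add: h1)
    show "real h = 1" "H = real (hurwitz 1 L)" by (simp_all add: h1 H_def)
    show "P = real m ^ (k + 1)" "real m * P = real m ^ (k + 2)" unfolding P_def e by (simp_all add: power_add power2_eq_square)
    show "Z = J" using moebius_zeta_sum_2[OF d0] by (simp add: Z_def h1 J_def)
  qed
  show ?thesis
  proof (cases "m = p")
    case True
    have "diag_lists m p n C 0 = {[]}" using True p_C by (simp add: diag_lists_0)
    then have "real (F_full m m n g) = H * P * Z"
      using F[of 0] True by simp
    then show ?thesis using True genus_0 genus_1 unfolding J_def[symmetric] by (cases "d = 1") simp_all
  next
    case False
    have D0: "diag_lists m p n C 0 = {}" using False by (simp add: diag_lists_0)
    have D1: "card (diag_lists m p n C 1) = (if a = 1 then n else 0)"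
      using diag_lists_1[OF mp(1,2) False mp(3) p_C] mp(2) unfolding gcd_C by simp
    show ?thesis
    proof (cases "a = 1")
      case True
      have "diag_lists m p n C 1 \<noteq> {}" using D1 True n by auto
      then have F1: "real (F_full m p n g) = real ((c + 1) choose c) * H * real n * P * Z"
        using F[of 1] D0 D1 True by simp
      have choose: "real ((c + 1) choose c) = real n + real k + 2 * real h - 1"
      proof -
        have "(c + 1) choose c = c + 1"
          unfolding Suc_eq_plus1[symmetric] by (rule binomial_Suc_n)
        then have "real ((c + 1) choose c) = real (c + 2) - 1" by simp
        then show ?thesis unfolding c by simp
      qed
      show ?thesis
        using True False genus_0 genus_1 unfolding F1 choose J_def[symmetric]
        by (cases "d = 1") simp_all
    next
      case a1: False
      have "diag_lists m p n C 1 = {}" using D1 a1 by (simp add: card_eq_0_iff)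
      then have empty: "diag_lists m p n C r' = {}" if "r' < 2" for r'
        using D0 that by (cases "r' = 0") (auto simp: less_Suc_eq numeral_2_eq_2 One_nat_def)
      have D2: "card (diag_lists m p n C 2) * (p * a) = n ^ 2 * m * totient a"
        by (rule card_diag_lists_2[OF mp p_C gcd_C]) (use a0 a1 in simp)
      have "card (diag_lists m p n C 2) \<noteq> 0"
      proof
        assume "card (diag_lists m p n C 2) = 0"
        then have "n ^ 2 * m * totient a = 0" using D2 by simp
        then show False using n mp(1) a0 by simp
      qed
      then have "diag_lists m p n C 2 \<noteq> {}" by auto
      from F[OF empty this]
      have F2: "real (F_full m p n g) = real ((c + 2) choose c) * H * real (card (diag_lists m p n C 2)) * P * Z" .
      have "real (card (diag_lists m p n C 2)) * (real p * real a) = real n ^ 2 * real m * real (totient a)"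
        using arg_cong[OF D2, of real] by simp
      then have D2': "real (card (diag_lists m p n C 2)) = real n ^ 2 * real m * (real (totient a) / (real p * real a))"
        using mp(2) a0 by (simp add: field_simps)
      have choose: "real ((c + 2) choose c) = (real n + real k + 2 * real h) * (real n + real k + 2 * real h - 1) / 2"
      proof -
        have pred: "c + 2 - 1 = c + 1" by simp
        have "(c + 2) choose c = (c + 2) choose 2" using binomial_symmetric[of c "c + 2"] by simp
        also have "\<dots> = (c + 2) * (c + 1) div 2" unfolding choose_two pred ..
        finally have "real ((c + 2) choose c) = real ((c + 2) * (c + 1) div 2)" by (rule arg_cong)
        also have "\<dots> = real ((c + 2) * (c + 1)) / real 2" by (rule real_of_nat_div) simp
        also have "\<dots> = real (c + 2) * (real (c + 2) - 1) / 2" by (simp add: algebra_simps)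
        finally show ?thesis unfolding c by simp
      qed
      have "real (F_full m p n g) = (real n + real k + 2 * real h) * (real n + real k + 2 * real h - 1) / 2
          * H * (real n ^ 2 * (real (totient a) / (real p * real a))) * (real m * P) * Z"
        unfolding F2 D2' choose by simp
      then show ?thesis
        using False a1 genus_0 genus_1 unfolding J_def[symmetric]
        by (cases "d = 1") (simp_all add: mult_ac add_ac power_add)
    qed
  qed
qed

end
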